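(* Let $(X,\sigma)$ be a biquandle, $H$ a (not necessarily abelian) group, and $f:X\times X\to H$ a braid non-commutative 2-cocycle of type I. Then the conjugacy biquandle cocycle invariant $$\overrightarrow{\Psi}_{(X,f)}(L)=\{[\Psi_i(L,\mathcal C,f)]\}_{1\le i\le r,\ \mathcal C\in Col_X(L)}$$ of an oriented classical link $L=K_1\cup\dots\cup K_r$ is well defined: computed from an oriented link diagram, it does not depend on the choice of base points on the components, and it is unchanged when the diagram is modified by (oriented) Reidemeister moves of types I, II and III.
   Context: A set-theoretical solution of the Yang-Baxter equation is a pair $(X,\sigma)$ with $\sigma:X\times X\to X\times X$ a bijection satisfying $(\mathrm{Id}\times\sigma)(\sigma\times\mathrm{Id})(\mathrm{Id}\times\sigma)=(\sigma\times\mathrm{Id})(\mathrm{Id}\times\sigma)(\sigma\times\mathrm{Id})$. Write $\sigma(x,y)=(\sigma^1(x,y),\sigma^2(x,y))$. It is a birack if moreover for all $x,z\in X$ there is a unique $y$ with $\sigma^1(x,y)=z$, and for all $y,t\in X$ there is a unique $x$ with $\sigma^2(x,y)=t$. A birack is a biquandle if there is a bijection $s:X\to X$ such that $\{(x,y):\sigma(x,y)=(x,y)\}=\{(x,s(x)):x\in X\}$. A function $f:X\times X\to H$ is a braid non-commutative 2-cocycle if for all $x_1,x_2,x_3\in X$: $f(x_1,x_2)f(\sigma^2(x_1,x_2),x_3)=f(x_1,\sigma^1(x_2,x_3))\,f(\sigma^2(x_1,\sigma^1(x_2,x_3)),\sigma^2(x_2,x_3))$ and $f(\sigma^1(x_1,x_2),\sigma^1(\sigma^2(x_1,x_2),x_3))=f(x_2,x_3)$.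 It is of type I if $f(x,s(x))=1$ for all $x\in X$. Let $L=K_1\cup\dots\cup K_r$ be a classical oriented link diagram in the plane with components $K_1,\dots,K_r$. A semi-arc is a portion of the diagram between two consecutive crossings (over- or under-passages). A coloring of $L$ by $X$ assigns an element of $X$ to each semi-arc so that: at each positive crossing, if the incoming under semi-arc has color $x$ and the incoming over semi-arc has color $y$, then the outgoing over semi-arc has color $\sigma^1(x,y)$ and the outgoing under semi-arc has color $\sigma^2(x,y)$; at each negative crossing, if the incoming over semi-arc has color $a$ and the incoming under semi-arc has color $b$, and $(x,y)=\sigma^{-1}(a,b)$, then the outgoing under semi-arc has color $x$ and the outgoing over semi-arc has color $y$. $Col_X(L)$ is the set of colorings. Boltzmann weights: at a positive crossing $\tau$ with incoming under color $x_\tau$ and incoming over color $y_\tau$, $B_f(\tau,\mathcal C)=f(x_\tau,y_\tau)$. At a negative crossing $\tau$ with incoming over color $\sigma^1(x_\tau,y_\tau)$ and incoming under color $\sigma^2(x_\tau,y_\tau)$, $B_f(\tau,\mathcal C)=f(x_\tau,y_\tau)^{-1}$. Choose a base point $b_i$ on each $K_i$. Let $\tau^{(i)}_1,\dots,\tau^{(i)}_{k(i)}$ be the crossings whose under-arc belongs to $K_i$, in the order they are met when travelling along $K_i$ from $b_i$ following the orientation. Define $\Psi_i(L,\mathcal C,f)=\prod_{j=1}^{k(i)}B_f(\tau^{(i)}_j,\mathcal C)\in H$ (product in this order), and let $[h]$ denote the conjugacy class of $h\in H$. *)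

theory Defs
  imports "HOL-Algebra.Group" "HOL-Combinatorics.Cycles" "HOL-Combinatorics.Orbits"
begin

section \<open>Biquandles\<close>

definition ybe_solution :: "'x set \<Rightarrow> ('x \<times> 'x \<Rightarrow> 'x \<times> 'x) \<Rightarrow> bool" where
  "ybe_solution X \<sigma> \<longleftrightarrow>
     bij_betw \<sigma> (X \<times> X) (X \<times> X) \<and>
     (let id_\<sigma> = map_prod id \<sigma>;
          \<sigma>_id = (\<lambda>(x, y, z). case \<sigma> (x, y) of (x', y') \<Rightarrow> (x', y', z))
      in \<forall>t \<in> X \<times> X \<times> X. id_\<sigma> (\<sigma>_id (id_\<sigma> t)) = \<sigma>_id (id_\<sigma> (\<sigma>_id t)))"

definition birack :: "'x set \<Rightarrow> ('x \<times> 'x \<Rightarrow> 'x \<times> 'x) \<Rightarrow> bool" where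
  "birack X \<sigma> \<longleftrightarrow>
     ybe_solution X \<sigma> \<and>
     (\<forall>x\<in>X. \<forall>z\<in>X. \<exists>!y. y \<in> X \<and> fst (\<sigma> (x, y)) = z) \<and>
     (\<forall>y\<in>X. \<forall>t\<in>X. \<exists>!x. x \<in> X \<and> snd (\<sigma> (x, y)) = t)"

text \<open>The bijection \<open>s\<close> is determined by \<open>\<sigma>\<close> on \<open>X\<close>; it is a parameter because the type I
  condition on cocycles refers to it.\<close>

definition biquandle :: "'x set \<Rightarrow> ('x \<times> 'x \<Rightarrow> 'x \<times> 'x) \<Rightarrow> ('x \<Rightarrow> 'x) \<Rightarrow> bool" where
  "biquandle X \<sigma> s \<longleftrightarrow>
     birack X \<sigma> \<and> bij_betw s X X \<and>
     {(x, y) \<in> X \<times> X. \<sigma> (x, y) = (x, y)} = {(x, s x) | x. x \<in> X}"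

definition braid_cocycle ::
  "'x set \<Rightarrow> ('x \<times> 'x \<Rightarrow> 'x \<times> 'x) \<Rightarrow> ('h, 'm) monoid_scheme \<Rightarrow> ('x \<times> 'x \<Rightarrow> 'h) \<Rightarrow> bool" where
  "braid_cocycle X \<sigma> H f \<longleftrightarrow>
     f \<in> X \<times> X \<rightarrow> carrier H \<and>
     (let \<sigma>1 = (\<lambda>x y. fst (\<sigma> (x, y))); \<sigma>2 = (\<lambda>x y. snd (\<sigma> (x, y)))
      in \<forall>x1\<in>X. \<forall>x2\<in>X. \<forall>x3\<in>X.
           f (x1, x2) \<otimes>\<^bsub>H\<^esub> f (\<sigma>2 x1 x2, x3) =
             f (x1, \<sigma>1 x2 x3) \<otimes>\<^bsub>H\<^esub> f (\<sigma>2 x1 (\<sigma>1 x2 x3), \<sigma>2 x2 x3) \<and>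
           f (\<sigma>1 x1 x2, \<sigma>1 (\<sigma>2 x1 x2) x3) = f (x2, x3))"

definition type_I ::
  "'x set \<Rightarrow> ('x \<Rightarrow> 'x) \<Rightarrow> ('h, 'm) monoid_scheme \<Rightarrow> ('x \<times> 'x \<Rightarrow> 'h) \<Rightarrow> bool" where
  "type_I X s H f \<longleftrightarrow> (\<forall>x\<in>X. f (x, s x) = \<one>\<^bsub>H\<^esub>)"


section \<open>Oriented link diagrams\<close>

text \<open>
  An oriented link diagram is represented by its signed Gauss code: for every component, the
  cyclic list of the passages met when travelling along it, a passage being a crossing traversed
  on its over- or under-strand.  The sign of a crossing is part of its name.  The list \<open>D ! i\<close> is
  to be read cyclically; where it is cut open has no meaning.  An empty list is a component
  without crossings.
\<close>

datatype sign = Positive | Negative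
datatype strand = Over | Under

type_synonym crossing = "nat \<times> sign"
type_synonym passage = "crossing \<times> strand"
type_synonym code = "passage list list"

abbreviation sign_of :: "crossing \<Rightarrow> sign" where
  "sign_of \<equiv> snd"

definition passages :: "code \<Rightarrow> passage set" where
  "passages D = set (concat D)"

definition crossings :: "code \<Rightarrow> crossing set" where
  "crossings D = fst ` passages D"

definition gauss_code :: "code \<Rightarrow> bool" where
  "gauss_code D \<longleftrightarrow> distinct (concat D) \<and> passages D = crossings D \<times> {Over, Under}"

text \<open>In a Gauss code a passage lies on only one component, so at most one of the cycles composed
  here moves it.\<close>

definition next_passage :: "code \<Rightarrow> passage \<Rightarrow> passage" where
  "next_passage D = foldr cycle_of_list D"

fun other_strand :: "passage \<Rightarrow> passage" where
  "other_strand (c, Over) = (c, Under)"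
| "other_strand (c, Under) = (c, Over)"


subsection \<open>Planarity\<close>

text \<open>
  A Gauss code determines a 4-valent graph with a cyclic order at each vertex.  Its half-edges
  are the incoming and the outgoing ends of the strands at the crossings.
\<close>

datatype tip = Incoming | Outgoing

type_synonym half_edge = "passage \<times> tip"

definition half_edges :: "code \<Rightarrow> half_edge set" where
  "half_edges D = passages D \<times> {Incoming, Outgoing}"

fun opposite :: "code \<Rightarrow> half_edge \<Rightarrow> half_edge" where
  "opposite D (p, Outgoing) = (next_passage D p, Incoming)"
| "opposite D (p, Incoming) = (inv_into UNIV (next_passage D) p, Outgoing)"

text \<open>
  The next half-edge counterclockwise around a crossing.  At a positive crossing, with the
  over-strand going from south-west to north-east and the under-strand from south-east to
  north-west, the counterclockwise order is: over out, under out, over in, under in.  At a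
  negative crossing the roles of over and under are exchanged.
\<close>

fun rotate_ccw :: "half_edge \<Rightarrow> half_edge" where
  "rotate_ccw (((n, Positive), Over), t) = (((n, Positive), Under), t)"
| "rotate_ccw (((n, Positive), Under), Outgoing) = (((n, Positive), Over), Incoming)"
| "rotate_ccw (((n, Positive), Under), Incoming) = (((n, Positive), Over), Outgoing)"
| "rotate_ccw (((n, Negative), Under), t) = (((n, Negative), Over), t)"
| "rotate_ccw (((n, Negative), Over), Outgoing) = (((n, Negative), Under), Incoming)"
| "rotate_ccw (((n, Negative), Over), Incoming) = (((n, Negative), Under), Outgoing)"

text \<open>A face is given by the half-edges leaving its corners when its boundary is traversed with
  the face on the right.\<close>

definition faces :: "code \<Rightarrow> half_edge set set" where
  "faces D = orbit (rotate_ccw \<circ> opposite D) ` half_edges D"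

definition connected_parts :: "code \<Rightarrow> passage set set" where
  "connected_parts D =
     (\<lambda>p. Collect (equivclp (\<lambda>q r. r = next_passage D q \<or> r = other_strand q) p)) ` passages D"

text \<open>Euler's formula.  A 4-valent graph with \<open>n\<close> vertices has \<open>2 n\<close> edges.  Since
  \<open>V - E + F \<le> 2\<close> on every connected part, the equation says that every part has genus 0.\<close>

definition planar :: "code \<Rightarrow> bool" where
  "planar D \<longleftrightarrow>
     int (card (crossings D)) - 2 * int (card (crossings D)) + int (card (faces D))
       = 2 * int (card (connected_parts D))"

definition link_diagram :: "code \<Rightarrow> bool" where
  "link_diagram D \<longleftrightarrow> gauss_code D \<and> planar D"


subsection \<open>Reidemeister moves\<close>

text \<open>Two codes of the same diagram differ in the names of the crossings and in where the
  components are cut open.\<close>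

definition same_diagram :: "code \<Rightarrow> code \<Rightarrow> bool" where
  "same_diagram D D' \<longleftrightarrow>
     (\<exists>g. inj_on g (crossings D) \<and> (\<forall>c \<in> crossings D. sign_of (g c) = sign_of c) \<and>
          list_all2 (\<lambda>K K'. \<exists>n. K' = rotate n (map (map_prod g id) K)) D D')"

definition remove_crossings :: "crossing set \<Rightarrow> code \<Rightarrow> code" where
  "remove_crossings A D = map (filter (\<lambda>p. fst p \<notin> A)) D"

text \<open>The sides of a face, each side given by the two passages it joins.\<close>

definition sides :: "code \<Rightarrow> half_edge set \<Rightarrow> passage set set" where
  "sides D F = (\<lambda>h. {fst h, fst (opposite D h)}) ` F"

text \<open>
  The first two moves remove a monogon, respectively a bigon one of whose sides passes over the
  other; the inverse moves are covered by taking the equivalence closure.  In the third move the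
  sides of the triangle are segments of a top strand (through \<open>c\<close>, \<open>d\<close>), a middle strand
  (through \<open>c\<close>, \<open>e\<close>) and a bottom strand (through \<open>d\<close>, \<open>e\<close>); pushing one of them across the
  crossing of the other two reverses the order of the two passages on each strand.
\<close>

inductive reidemeister :: "code \<Rightarrow> code \<Rightarrow> bool" where
  same:
    "reidemeister D D'"
    if "link_diagram D" "link_diagram D'" "same_diagram D D'"
| R1:
    "reidemeister D D'"
    if "link_diagram D" "link_diagram D'"
      "F \<in> faces D" "card F = 1" "sides D F = {{(c, Over), (c, Under)}}"
      "D' = remove_crossings {c} D"
| R2:
    "reidemeister D D'"
    if "link_diagram D" "link_diagram D'" "c \<noteq> d"
      "F \<in> faces D" "card F = 2"
      "sides D F = {{(c, Over), (d, Over)}, {(c, Under), (d, Under)}}"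
      "D' = remove_crossings {c, d} D"
| R3:
    "reidemeister D D'"
    if "link_diagram D" "link_diagram D'" "distinct [c, d, e]"
      "F \<in> faces D" "card F = 3"
      "sides D F = {{(c, Over), (d, Over)}, {(c, Under), (e, Over)}, {(d, Under), (e, Under)}}"
      "D' = map (map (transpose (c, Over) (d, Over) \<circ> transpose (c, Under) (e, Over) \<circ>
                      transpose (d, Under) (e, Under))) D"


section \<open>Colorings and the invariant\<close>

text \<open>A semi-arc is named after the passage it leads to; a component without crossings is a single
  closed semi-arc.\<close>

datatype semi_arc = Into passage | Circle nat

definition semi_arcs :: "code \<Rightarrow> semi_arc set" where
  "semi_arcs D = Into ` passages D \<union> Circle ` {i. i < length D \<and> D ! i = []}"

definition incoming :: "(semi_arc \<Rightarrow> 'x) \<Rightarrow> passage \<Rightarrow> 'x" where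
  "incoming C p = C (Into p)"

definition outgoing :: "code \<Rightarrow> (semi_arc \<Rightarrow> 'x) \<Rightarrow> passage \<Rightarrow> 'x" where
  "outgoing D C p = C (Into (next_passage D p))"

definition colorings ::
  "'x set \<Rightarrow> ('x \<times> 'x \<Rightarrow> 'x \<times> 'x) \<Rightarrow> code \<Rightarrow> (semi_arc \<Rightarrow> 'x) set" where
  "colorings X \<sigma> D =
     {C \<in> semi_arcs D \<rightarrow>\<^sub>E X.
        \<forall>c \<in> crossings D.
          (case sign_of c of
             Positive \<Rightarrow>
               (outgoing D C (c, Over), outgoing D C (c, Under)) =
                 \<sigma> (incoming C (c, Under), incoming C (c, Over))
           | Negative \<Rightarrow>
               (outgoing D C (c, Under), outgoing D C (c, Over)) =
                 inv_into (X \<times> X) \<sigma> (incoming C (c, Over), incoming C (c, Under)))}"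

definition boltzmann_weight ::
  "'x set \<Rightarrow> ('x \<times> 'x \<Rightarrow> 'x \<times> 'x) \<Rightarrow> ('h, 'm) monoid_scheme \<Rightarrow> ('x \<times> 'x \<Rightarrow> 'h)
     \<Rightarrow> (semi_arc \<Rightarrow> 'x) \<Rightarrow> crossing \<Rightarrow> 'h" where
  "boltzmann_weight X \<sigma> H f C c =
     (case sign_of c of
        Positive \<Rightarrow> f (incoming C (c, Under), incoming C (c, Over))
      | Negative \<Rightarrow>
          inv\<^bsub>H\<^esub> (f (inv_into (X \<times> X) \<sigma> (incoming C (c, Over), incoming C (c, Under)))))"

text \<open>The base point of the \<open>i\<close>-th component lies on the semi-arc leading to the passage number
  \<open>b i\<close> of that component (counted from 0, modulo the number of passages).\<close>

definition Psi ::
  "'x set \<Rightarrow> ('x \<times> 'x \<Rightarrow> 'x \<times> 'x) \<Rightarrow> ('h, 'm) monoid_scheme \<Rightarrow> ('x \<times> 'x \<Rightarrow> 'h)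
     \<Rightarrow> code \<Rightarrow> (nat \<Rightarrow> nat) \<Rightarrow> (semi_arc \<Rightarrow> 'x) \<Rightarrow> nat \<Rightarrow> 'h" where
  "Psi X \<sigma> H f D b C i =
     foldr (\<otimes>\<^bsub>H\<^esub>)
       [boltzmann_weight X \<sigma> H f C c. (c, t) \<leftarrow> rotate (b i) (D ! i), t = Under] \<one>\<^bsub>H\<^esub>"

definition conj_class :: "('h, 'm) monoid_scheme \<Rightarrow> 'h \<Rightarrow> 'h set" where
  "conj_class H h = {g \<otimes>\<^bsub>H\<^esub> h \<otimes>\<^bsub>H\<^esub> inv\<^bsub>H\<^esub> g | g. g \<in> carrier H}"

definition conj_invariant ::
  "'x set \<Rightarrow> ('x \<times> 'x \<Rightarrow> 'x \<times> 'x) \<Rightarrow> ('h, 'm) monoid_scheme \<Rightarrow> ('x \<times> 'x \<Rightarrow> 'h)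
     \<Rightarrow> code \<Rightarrow> (nat \<Rightarrow> nat) \<Rightarrow> 'h set set" where
  "conj_invariant X \<sigma> H f D b =
     {conj_class H (Psi X \<sigma> H f D b C i) | i C. i < length D \<and> C \<in> colorings X \<sigma> D}"

end

theory Submission
  imports Defs
begin

text \<open>
  Why the invariant is well defined.  Moving a base point rotates the word of weights read along a
  component, which conjugates its product.  A Reidemeister move touches only pairs of consecutive
  passages: one pair of passages of the same crossing for the first move, one pair on each of the
  two strands for the second, one on each of the three strands for the third.  Only the semi-arcs
  inside these pairs change; all others survive, the two ends of a pair being glued when the pair
  is removed.  Hence a move preserves the invariant as soon as two local conditions hold.

  \<^item> The colors of the surviving semi-arcs determine those of the interior ones, on either side of the
    move, and the two sides allow the same colors on the surviving semi-arcs.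

  \<^item> The product of the two weights of each pair is the same before and after the move.

  The second condition is enough although \<open>H\<close> is not abelian: one can put the base point where it
  does not separate a pair, and then the two words have equal products
  (\<open>conj_class_product_along_pairs\<close>).  The reduction to the local conditions is
  \<open>removal_invariant\<close> for the first two moves and \<open>relabelling_invariant\<close> for the third move and for a
  change of the names of the crossings.

  For the first move the local conditions are that the fixed points of \<open>\<sigma>\<close> are the pairs
  \<open>(x, s x)\<close> and that \<open>f\<close> is trivial on them.  For the second they say that one color on each of the
  two strands at a crossing determines the two others, in whichever direction the strands are run through
  (\<open>crosses_unique\<close>, \<open>ex_crosses\<close>); the two weights are inverse to each other.

  For the third move, the two sides together have six crossings and twelve semi-arcs
  (\<open>hexagon\<close>); these are the faces and the edges of a cube, each side of the move consisting of the
  faces around one of two opposite corners.  For the positive braid \<open>\<sigma>\<^sub>1 \<sigma>\<^sub>2 \<sigma>\<^sub>1\<close> the conditions are the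
  Yang-Baxter equation and the two cocycle conditions.  Other orientations of the strands amount to
  other pairs of opposite corners of the same cube, so they only permute the names of the semi-arcs
  (\<open>hexagon_flip_top\<close>, \<open>hexagon_flip_middle\<close>, \<open>hexagon_flip_bottom\<close>), and the general case follows from
  the positive one.  That the signs of the crossings fit the orientations of the three strands is
  forced by the triangle being a face (\<open>trigon_face\<close>).
\<close>

section \<open>Crossings in a birack\<close>

locale birack_on =
  fixes X :: "'x set" and \<sigma> :: "'x \<times> 'x \<Rightarrow> 'x \<times> 'x"
  assumes birack: "birack X \<sigma>"
begin

lemma bij_\<sigma>: "bij_betw \<sigma> (X \<times> X) (X \<times> X)"
  using birack by (simp add: birack_def ybe_solution_def)

lemma \<sigma>_closed:
  assumes "\<sigma> (x, y) = (z, w)" "x \<in> X" "y \<in> X"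
  shows "z \<in> X" "w \<in> X"
  using bij_betw_apply[OF bij_\<sigma>, of "(x, y)"] assms by auto

lemma \<sigma>_cancel:
  assumes "\<sigma> (x, y) = zw" "\<sigma> (x', y') = zw" "x \<in> X" "y \<in> X" "x' \<in> X" "y' \<in> X"
  shows "x = x'" "y = y'"
  using inj_onD[OF bij_betw_imp_inj_on[OF bij_\<sigma>], of "(x, y)" "(x', y')"] assms by auto

lemma ex_inputs:
  assumes "z \<in> X" "w \<in> X"
  obtains x y where "x \<in> X" "y \<in> X" "\<sigma> (x, y) = (z, w)"
proof -
  have "(z, w) \<in> \<sigma> ` (X \<times> X)"
    using bij_\<sigma> assms by (simp add: bij_betw_def)
  then obtain xy where "xy \<in> X \<times> X" "\<sigma> xy = (z, w)"
    by (metis imageE)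
  then show thesis
    by (cases xy) (auto intro: that)
qed

lemma left_unique:
  assumes "\<sigma> (x, y) = (z, w)" "\<sigma> (x, y') = (z, w')" "x \<in> X" "y \<in> X" "y' \<in> X"
  shows "y = y'"
proof -
  have "z \<in> X"
    using \<sigma>_closed assms by blast
  then have "\<exists>!y. y \<in> X \<and> fst (\<sigma> (x, y)) = z"
    using birack assms(3) unfolding birack_def by blast
  then show ?thesis
    using assms(1,2,4,5) by (elim ex1E) (metis fst_conv)
qed

lemma ex_left:
  assumes "x \<in> X" "z \<in> X"
  obtains y w where "y \<in> X" "w \<in> X" "\<sigma> (x, y) = (z, w)"
proof -
  obtain y where y: "y \<in> X" "fst (\<sigma> (x, y)) = z"
    using birack assms unfolding birack_def by blast
  then obtain w where "\<sigma> (x, y) = (z, w)"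
    by (cases "\<sigma> (x, y)") auto
  with y(1) show thesis
    using that \<sigma>_closed(2) assms(1) by metis
qed

lemma right_unique:
  assumes "\<sigma> (x, y) = (z, w)" "\<sigma> (x', y) = (z', w)" "x \<in> X" "x' \<in> X" "y \<in> X"
  shows "x = x'"
proof -
  have "w \<in> X"
    using \<sigma>_closed assms by blast
  then have "\<exists>!x. x \<in> X \<and> snd (\<sigma> (x, y)) = w"
    using birack assms(5) unfolding birack_def by blast
  then show ?thesis
    using assms(1-4) by (elim ex1E) (metis snd_conv)
qed

lemma ex_right:
  assumes "y \<in> X" "w \<in> X"
  obtains x z where "x \<in> X" "z \<in> X" "\<sigma> (x, y) = (z, w)"
proof -
  obtain x where x: "x \<in> X" "snd (\<sigma> (x, y)) = w"
    using birack assms unfolding birack_def by blast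
  then obtain z where "\<sigma> (x, y) = (z, w)"
    by (cases "\<sigma> (x, y)") auto
  with x(1) show thesis
    using that \<sigma>_closed(1) assms(1) by metis
qed

lemma ybe:
  assumes "\<sigma> (x2, x3) = (u, v)" "\<sigma> (x1, u) = (z1, w)" "\<sigma> (w, v) = (z2, z3)"
    and "\<sigma> (x1, x2) = (p, q)" "\<sigma> (q, x3) = (r, t3)" "\<sigma> (p, r) = (t1, t2)"
    and "x1 \<in> X" "x2 \<in> X" "x3 \<in> X"
  shows "z1 = t1" "z2 = t2" "z3 = t3"
proof -
  have "\<forall>t \<in> X \<times> X \<times> X.
      map_prod id \<sigma> ((\<lambda>(x, y, z). case \<sigma> (x, y) of (x', y') \<Rightarrow> (x', y', z)) (map_prod id \<sigma> t)) =
      (\<lambda>(x, y, z). case \<sigma> (x, y) of (x', y') \<Rightarrow> (x', y', z))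
        (map_prod id \<sigma> ((\<lambda>(x, y, z). case \<sigma> (x, y) of (x', y') \<Rightarrow> (x', y', z)) t))"
    using birack unfolding birack_def ybe_solution_def Let_def by blast
  from bspec[OF this, of "(x1, x2, x3)"] show "z1 = t1" "z2 = t2" "z3 = t3"
    using assms by auto
qed

text \<open>
  The colors at a crossing whose under-strand joins \<open>x\<close> to \<open>x'\<close> and whose over-strand joins \<open>y\<close> to
  \<open>y'\<close>.  The flags \<open>u\<close> and \<open>v\<close> tell whether these strands run from the first color to the second when
  the crossing is oriented as a positive one.  A negative crossing is a positive one with both
  strands reversed; so, read along the orientation of the diagram, both flags are the sign.
\<close>

definition crosses :: "bool \<Rightarrow> bool \<Rightarrow> 'x \<Rightarrow> 'x \<Rightarrow> 'x \<Rightarrow> 'x \<Rightarrow> bool" where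
  "crosses u v x x' y y' \<longleftrightarrow>
     \<sigma> (if u then x else x', if v then y else y') = (if v then y' else y, if u then x' else x)"

lemma crosses_reverse:
  "crosses (\<not> u) (\<not> v) x' x y' y = crosses u v x x' y y'"
  "crosses (\<not> u) v x' x y y' = crosses u v x x' y y'"
  "crosses u (\<not> v) x x' y' y = crosses u v x x' y y'"
  by (auto simp: crosses_def)

text \<open>
  For the four values of the flags this is, in turn, that \<open>\<sigma>\<close> is a function, the two uniqueness
  conditions in the definition of a birack, and the injectivity of \<open>\<sigma>\<close>.
\<close>

lemma crosses_unique:
  assumes "crosses u v x x1 y y1" "crosses u v x x2 y y2"
    and "{x, x1, x2, y, y1, y2} \<subseteq> X"
  shows "x1 = x2" "y1 = y2"
proof -
  have "x1 = x2 \<and> y1 = y2"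
  proof (cases u; cases v)
    assume "u" "v"
    then show ?thesis
      using assms by (simp add: crosses_def)
  next
    assume "u" "\<not> v"
    then have "\<sigma> (x, y1) = (y, x1)" "\<sigma> (x, y2) = (y, x2)"
      using assms by (simp_all add: crosses_def)
    moreover from this have "y1 = y2"
      using left_unique assms(3) by blast
    ultimately show ?thesis
      by simp
  next
    assume "\<not> u" "v"
    then have "\<sigma> (x1, y) = (y1, x)" "\<sigma> (x2, y) = (y2, x)"
      using assms by (simp_all add: crosses_def)
    moreover from this have "x1 = x2"
      using right_unique assms(3) by blast
    ultimately show ?thesis
      by simp
  next
    assume "\<not> u" "\<not> v"
    then show ?thesis
      using assms \<sigma>_cancel[of x1 y1 "(y, x)" x2 y2] by (simp add: crosses_def)
  qed
  then show "x1 = x2" "y1 = y2"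
    by simp_all
qed

lemma ex_crosses:
  assumes "x \<in> X" "y \<in> X"
  obtains x' y' where "x' \<in> X" "y' \<in> X" "crosses u v x x' y y'"
proof (cases u; cases v)
  assume "u" "v"
  obtain y' x' where "\<sigma> (x, y) = (y', x')"
    by fastforce
  moreover from this have "y' \<in> X" "x' \<in> X"
    using \<sigma>_closed assms by blast+
  ultimately show thesis
    using that \<open>u\<close> \<open>v\<close> by (simp add: crosses_def)
next
  assume "u" "\<not> v"
  obtain y' x' where "y' \<in> X" "x' \<in> X" "\<sigma> (x, y') = (y, x')"
    using ex_left[OF assms] .
  then show thesis
    using that \<open>u\<close> \<open>\<not> v\<close> by (simp add: crosses_def)
next
  assume "\<not> u" "v"
  obtain x' y' where "x' \<in> X" "y' \<in> X" "\<sigma> (x', y) = (y', x)"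
    using ex_right[OF assms(2,1)] .
  then show thesis
    using that \<open>\<not> u\<close> \<open>v\<close> by (simp add: crosses_def)
next
  assume "\<not> u" "\<not> v"
  obtain x' y' where "x' \<in> X" "y' \<in> X" "\<sigma> (x', y') = (y, x)"
    using ex_inputs[OF assms(2,1)] .
  then show thesis
    using that \<open>\<not> u\<close> \<open>\<not> v\<close> by (simp add: crosses_def)
qed

text \<open>
  The two sides of the third Reidemeister move.  The top, the middle and the bottom strand carry
  the colors \<open>a0 a1 a2\<close>, \<open>m0 m1 m2\<close> and \<open>b0 b1 b2\<close> before the move and \<open>a0 a' a2\<close>, \<open>m0 m' m2\<close> and
  \<open>b0 b' b2\<close> after it.  The flag of a strand at a crossing is its direction multiplied by the sign of
  the crossing; around a triangular face this product depends only on the other strand of the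
  crossing.  So one flag for each strand suffices: \<open>T\<close> is the flag of whichever strand
  crosses the top strand, and similarly for \<open>M\<close> and \<open>B\<close>.
\<close>

definition hexagon ::
  "bool \<Rightarrow> bool \<Rightarrow> bool \<Rightarrow> 'x \<Rightarrow> 'x \<Rightarrow> 'x \<Rightarrow> 'x \<Rightarrow> 'x \<Rightarrow> 'x \<Rightarrow> 'x \<Rightarrow> 'x \<Rightarrow> 'x \<Rightarrow> 'x \<Rightarrow> 'x \<Rightarrow> 'x \<Rightarrow> bool"
where
  "hexagon T M B a0 a1 a2 a' m0 m1 m2 m' b0 b1 b2 b' \<longleftrightarrow>
     crosses T M m0 m1 a0 a1 \<and> crosses T B b0 b1 a1 a2 \<and> crosses M B b1 b2 m1 m2 \<and>
     crosses M B b0 b' m0 m' \<and> crosses T B b' b2 a0 a' \<and> crosses T M m' m2 a' a2 \<and>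
     {a0, a1, a2, a', m0, m1, m2, m', b0, b1, b2, b'} \<subseteq> X"

text \<open>
  Changing a flag exchanges the roles of some of the crossings before and after the move: here only
  those of the middle and the bottom strand trade places.  The six crossings as a whole stay the same.
\<close>

lemma hexagon_flip_top:
  "hexagon (\<not> T) M B a0 a1 a2 a' m0 m1 m2 m' b0 b1 b2 b' \<longleftrightarrow>
   hexagon T M B a0 a1 a2 a' m1 m0 m' m2 b1 b0 b' b2"
  by (auto simp: hexagon_def crosses_reverse)

lemma hexagon_flip_middle:
  "hexagon T (\<not> M) B a0 a1 a2 a' m0 m1 m2 m' b0 b1 b2 b' \<longleftrightarrow>
   hexagon T M B a1 a0 a' a2 m0 m1 m2 m' b' b2 b1 b0"
  by (auto simp: hexagon_def crosses_reverse)

lemma hexagon_flip_bottom: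
  "hexagon T M (\<not> B) a0 a1 a2 a' m0 m1 m2 m' b0 b1 b2 b' \<longleftrightarrow>
   hexagon T M B a' a2 a1 a0 m' m2 m1 m0 b0 b1 b2 b'"
  by (auto simp: hexagon_def crosses_reverse)

definition completable :: "bool \<Rightarrow> bool \<Rightarrow> bool \<Rightarrow> bool" where
  "completable T M B \<longleftrightarrow> (\<forall>a0\<in>X. \<forall>m0\<in>X. \<forall>b0\<in>X.
     \<exists>a1 a2 a' m1 m2 m' b1 b2 b'. hexagon T M B a0 a1 a2 a' m0 m1 m2 m' b0 b1 b2 b')"

lemma completableE:
  assumes "completable T M B" "a0 \<in> X" "m0 \<in> X" "b0 \<in> X"
  obtains a1 a2 a' m1 m2 m' b1 b2 b' where "hexagon T M B a0 a1 a2 a' m0 m1 m2 m' b0 b1 b2 b'"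
  using assms(1)[unfolded completable_def, rule_format, OF assms(2-4)]
  by (elim exE) (rule that)

lemma completable_positive: "completable True True True"
  unfolding completable_def
proof (intro ballI)
  fix a0 m0 b0 assume X: "a0 \<in> X" "m0 \<in> X" "b0 \<in> X"
  obtain m1 a1 where F1: "crosses True True m0 m1 a0 a1" "m1 \<in> X" "a1 \<in> X"
    using ex_crosses X by metis
  obtain b1 a2 where F2: "crosses True True b0 b1 a1 a2" "b1 \<in> X" "a2 \<in> X"
    using ex_crosses X F1 by metis
  obtain b2 m2 where F3: "crosses True True b1 b2 m1 m2" "b2 \<in> X" "m2 \<in> X"
    using ex_crosses F1 F2 by metis
  obtain b' m' where G1: "crosses True True b0 b' m0 m'" "b' \<in> X" "m' \<in> X"
    using ex_crosses X by metis
  obtain t a' where G2: "crosses True True b' t a0 a'" "t \<in> X" "a' \<in> X"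
    using ex_crosses X G1 by metis
  obtain t1 t2 where G3: "crosses True True m' t1 a' t2"
    using ex_crosses G1 G2 by metis
  have "a2 = t2" "m2 = t1" "b2 = t"
    using ybe[of m0 a0 a1 m1 b0 a2 b1 m2 b2 m' b' a' t t2 t1] F1 F2 F3 G1 G2 G3 X
    by (simp_all add: crosses_def)
  then have "hexagon True True True a0 a1 a2 a' m0 m1 m2 m' b0 b1 b2 b'"
    using F1 F2 F3 G1 G2 G3 X by (simp add: hexagon_def)
  then show "\<exists>a1 a2 a' m1 m2 m' b1 b2 b'. hexagon True True True a0 a1 a2 a' m0 m1 m2 m' b0 b1 b2 b'"
    by (intro exI)
qed

text \<open>
  Two crossings on one side of the move lead from the given colors to those where a hexagon with the
  other flag starts.  By uniqueness that hexagon runs back through the given colors.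
\<close>

lemma completable_flip_top:
  assumes "completable T M B"
  shows "completable (\<not> T) M B"
  unfolding completable_def
proof (intro ballI)
  fix a0 m0 b0 assume X: "a0 \<in> X" "m0 \<in> X" "b0 \<in> X"
  obtain m1 a1 where 1: "crosses (\<not> T) M m0 m1 a0 a1" "m1 \<in> X" "a1 \<in> X"
    using ex_crosses X by metis
  obtain b1 a2 where 2: "crosses (\<not> T) B b0 b1 a1 a2" "b1 \<in> X" "a2 \<in> X"
    using ex_crosses X 1 by metis
  obtain c1 c2 a' n0 m' m2 d0 b' b2 where h: "hexagon T M B a0 c1 c2 a' m1 n0 m' m2 b1 d0 b' b2"
    by (rule completableE[OF assms X(1) 1(2) 2(2)])
  have "c1 = a1" "n0 = m0"
    using crosses_unique[of T M m1 m0 a0 a1 n0 c1] h 1 X by (auto simp: hexagon_def crosses_reverse)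
  moreover from this have "c2 = a2" "d0 = b0"
    using crosses_unique[of T B b1 b0 a1 a2 d0 c2] h 2 X by (auto simp: hexagon_def crosses_reverse)
  ultimately have "hexagon (\<not> T) M B a0 a1 a2 a' m0 m1 m2 m' b0 b1 b2 b'"
    using h by (simp add: hexagon_flip_top)
  then show "\<exists>a1 a2 a' m1 m2 m' b1 b2 b'. hexagon (\<not> T) M B a0 a1 a2 a' m0 m1 m2 m' b0 b1 b2 b'"
    by (intro exI)
qed

lemma completable_flip_middle:
  assumes "completable T M B"
  shows "completable T (\<not> M) B"
  unfolding completable_def
proof (intro ballI)
  fix a0 m0 b0 assume X: "a0 \<in> X" "m0 \<in> X" "b0 \<in> X"
  obtain m1 a1 where 1: "crosses T (\<not> M) m0 m1 a0 a1" "m1 \<in> X" "a1 \<in> X"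
    using ex_crosses X by metis
  obtain b' m' where 2: "crosses (\<not> M) B b0 b' m0 m'" "b' \<in> X" "m' \<in> X"
    using ex_crosses X 1 by metis
  obtain c0 a' a2 n1 m2 n' b2 b1 d0 where h: "hexagon T M B a1 c0 a' a2 m0 n1 m2 n' b' b2 b1 d0"
    by (rule completableE[OF assms 1(3) X(2) 2(2)])
  have "c0 = a0" "n1 = m1"
    using crosses_unique[of T M m0 m1 a1 a0 n1 c0] h 1 X by (auto simp: hexagon_def crosses_reverse)
  moreover have "d0 = b0" "n' = m'"
    using crosses_unique[of M B b' b0 m0 m' d0 n'] h 2 X by (auto simp: hexagon_def crosses_reverse)
  ultimately have "hexagon T (\<not> M) B a0 a1 a2 a' m0 m1 m2 m' b0 b1 b2 b'"
    using h by (simp add: hexagon_flip_middle)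
  then show "\<exists>a1 a2 a' m1 m2 m' b1 b2 b'. hexagon T (\<not> M) B a0 a1 a2 a' m0 m1 m2 m' b0 b1 b2 b'"
    by (intro exI)
qed

lemma completable_flip_bottom:
  assumes "completable T M B"
  shows "completable T M (\<not> B)"
  unfolding completable_def
proof (intro ballI)
  fix a0 m0 b0 assume X: "a0 \<in> X" "m0 \<in> X" "b0 \<in> X"
  obtain b' m' where 1: "crosses M (\<not> B) b0 b' m0 m'" "b' \<in> X" "m' \<in> X"
    using ex_crosses X by metis
  obtain b2 a' where 2: "crosses T (\<not> B) b' b2 a0 a'" "b2 \<in> X" "a' \<in> X"
    using ex_crosses X 1 by metis
  obtain a2 a1 c0 m2 m1 n0 b1 d2 d' where h: "hexagon T M B a' a2 a1 c0 m' m2 m1 n0 b0 b1 d2 d'"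
    by (rule completableE[OF assms 2(3) 1(3) X(3)])
  have "n0 = m0" "d' = b'"
    using crosses_unique[of M B b0 b' m' m0 d' n0] h 1 X by (auto simp: hexagon_def crosses_reverse)
  moreover from this have "c0 = a0" "d2 = b2"
    using crosses_unique[of T B b' b2 a' a0 d2 c0] h 2 X by (auto simp: hexagon_def crosses_reverse)
  ultimately have "hexagon T M (\<not> B) a0 a1 a2 a' m0 m1 m2 m' b0 b1 b2 b'"
    using h by (simp add: hexagon_flip_bottom)
  then show "\<exists>a1 a2 a' m1 m2 m' b1 b2 b'. hexagon T M (\<not> B) a0 a1 a2 a' m0 m1 m2 m' b0 b1 b2 b'"
    by (intro exI)
qed

lemma completable: "completable T M B"
proof -
  have "completable T True True"
    using completable_positive completable_flip_top[of True True True] by (cases T) auto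
  then have "completable T M True"
    using completable_flip_middle[of T True True] by (cases M) auto
  then show ?thesis
    using completable_flip_bottom[of T M True] by (cases B) auto
qed

text \<open>
  The three changes of flags generate all eight orientations from the positive one, the only one
  that the Yang-Baxter equation and the cocycle conditions speak about directly.
\<close>

lemma hexagon_induct [consumes 1, case_names positive flip_top flip_middle flip_bottom]:
  assumes "hexagon T M B a0 a1 a2 a' m0 m1 m2 m' b0 b1 b2 b'"
    and positive: "\<And>a0 a1 a2 a' m0 m1 m2 m' b0 b1 b2 b'.
      hexagon True True True a0 a1 a2 a' m0 m1 m2 m' b0 b1 b2 b' \<Longrightarrow>
      P True True True a0 a1 a2 a' m0 m1 m2 m' b0 b1 b2 b'"
    and flip_top: "\<And>T M B a0 a1 a2 a' m0 m1 m2 m' b0 b1 b2 b'.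
      hexagon T M B a0 a1 a2 a' m0 m1 m2 m' b0 b1 b2 b' \<Longrightarrow>
      P T M B a0 a1 a2 a' m0 m1 m2 m' b0 b1 b2 b' \<Longrightarrow>
      P (\<not> T) M B a0 a1 a2 a' m1 m0 m' m2 b1 b0 b' b2"
    and flip_middle: "\<And>T M B a0 a1 a2 a' m0 m1 m2 m' b0 b1 b2 b'.
      hexagon T M B a0 a1 a2 a' m0 m1 m2 m' b0 b1 b2 b' \<Longrightarrow>
      P T M B a0 a1 a2 a' m0 m1 m2 m' b0 b1 b2 b' \<Longrightarrow>
      P T (\<not> M) B a1 a0 a' a2 m0 m1 m2 m' b' b2 b1 b0"
    and flip_bottom: "\<And>T M B a0 a1 a2 a' m0 m1 m2 m' b0 b1 b2 b'.
      hexagon T M B a0 a1 a2 a' m0 m1 m2 m' b0 b1 b2 b' \<Longrightarrow>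
      P T M B a0 a1 a2 a' m0 m1 m2 m' b0 b1 b2 b' \<Longrightarrow>
      P T M (\<not> B) a' a2 a1 a0 m' m2 m1 m0 b0 b1 b2 b'"
  shows "P T M B a0 a1 a2 a' m0 m1 m2 m' b0 b1 b2 b'"
proof -
  have 1: "P T True True a0 a1 a2 a' m0 m1 m2 m' b0 b1 b2 b'"
    if "hexagon T True True a0 a1 a2 a' m0 m1 m2 m' b0 b1 b2 b'"
    for T a0 a1 a2 a' m0 m1 m2 m' b0 b1 b2 b'
    using that positive flip_top[of True True True, simplified] hexagon_flip_top[of True, simplified]
    by (cases T) simp_all
  have 2: "P T M True a0 a1 a2 a' m0 m1 m2 m' b0 b1 b2 b'"
    if "hexagon T M True a0 a1 a2 a' m0 m1 m2 m' b0 b1 b2 b'"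
    for T M a0 a1 a2 a' m0 m1 m2 m' b0 b1 b2 b'
    using that 1 flip_middle[of T True True, simplified] hexagon_flip_middle[of T True, simplified]
    by (cases M) simp_all
  show ?thesis
    using assms(1) 2 flip_bottom[of T M True, simplified] hexagon_flip_bottom[of T M True, simplified]
    by (cases B) simp_all
qed

lemma ex_hexagon:
  assumes "crosses T M m0 m1 a0 a1" "crosses T B b0 b1 a1 a2" "crosses M B b1 b2 m1 m2"
    and X: "{a0, a1, a2, m0, m1, m2, b0, b1, b2} \<subseteq> X"
  shows "\<exists>a' m' b'. hexagon T M B a0 a1 a2 a' m0 m1 m2 m' b0 b1 b2 b'"
proof -
  obtain c1 c2 a' n1 n2 m' d1 d2 b' where h: "hexagon T M B a0 c1 c2 a' m0 n1 n2 m' b0 d1 d2 b'"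
    using X by (auto intro: completableE[OF completable[of T M B], of a0 m0 b0])
  have "c1 = a1" "n1 = m1"
    using crosses_unique[of T M m0 m1 a0 a1 n1 c1] h assms by (auto simp: hexagon_def)
  moreover from this have "c2 = a2" "d1 = b1"
    using crosses_unique[of T B b0 b1 a1 a2 d1 c2] h assms by (auto simp: hexagon_def)
  moreover from calculation have "d2 = b2" "n2 = m2"
    using crosses_unique[of M B b1 b2 m1 m2 d2 n2] h assms by (auto simp: hexagon_def)
  ultimately show ?thesis
    using h by blast
qed

lemma hexagon_unique:
  assumes "hexagon T M B a0 a1 a2 a' m0 m1 m2 m' b0 b1 b2 b'"
    and "crosses M B b0 b m0 m" "crosses T B b b2 a0 a" "{a, m, b} \<subseteq> X"
  shows "a = a'" "m = m'" "b = b'"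
proof -
  show "m = m'" "b = b'"
    using crosses_unique[of M B b0 b m0 m b' m'] assms by (auto simp: hexagon_def)
  then show "a = a'"
    using crosses_unique[of T B b b2 a0 a b2 a'] assms by (auto simp: hexagon_def)
qed

end

section \<open>Weights around a triangle\<close>

locale cocycle_on = birack_on X \<sigma> + group H
  for X :: "'x set" and \<sigma> :: "'x \<times> 'x \<Rightarrow> 'x \<times> 'x" and H :: "('h, 'm) monoid_scheme" +
  fixes f :: "'x \<times> 'x \<Rightarrow> 'h"
  assumes cocycle: "braid_cocycle X \<sigma> H f"
begin

lemma f_carrier: "x \<in> X \<Longrightarrow> y \<in> X \<Longrightarrow> f (x, y) \<in> carrier H"
  using cocycle by (auto simp: braid_cocycle_def)

lemma f_ybe:
  assumes "\<sigma> (x2, x3) = (u, v)" "\<sigma> (x1, u) = (z1, w)"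
    and "\<sigma> (x1, x2) = (p, q)" "\<sigma> (q, x3) = (r, z3)" "{x1, x2, x3} \<subseteq> X"
  shows "f (x1, u) \<otimes>\<^bsub>H\<^esub> f (w, v) = f (x1, x2) \<otimes>\<^bsub>H\<^esub> f (q, x3)" "f (p, r) = f (x2, x3)"
  using cocycle assms unfolding braid_cocycle_def Let_def
  by (metis (no_types, lifting) fst_conv insert_subset snd_conv)+

definition signed :: "bool \<Rightarrow> 'h \<Rightarrow> 'h" where
  "signed e h = (if e then h else inv\<^bsub>H\<^esub> h)"

definition weight :: "bool \<Rightarrow> bool \<Rightarrow> 'x \<Rightarrow> 'x \<Rightarrow> 'x \<Rightarrow> 'x \<Rightarrow> 'h" where
  "weight u v x x' y y' = f (if u then x else x', if v then y else y')"

lemma weight_reverse: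
  "weight (\<not> u) (\<not> v) x' x y' y = weight u v x x' y y'"
  "weight (\<not> u) v x' x y y' = weight u v x x' y y'"
  "weight u (\<not> v) x x' y' y = weight u v x x' y y'"
  by (auto simp: weight_def)

lemma weight_carrier [simp]:
  "{x, x', y, y'} \<subseteq> X \<Longrightarrow> weight u v x x' y y' \<in> carrier H"
  using f_carrier by (auto simp: weight_def)

text \<open>
  The middle strand passes under only at its crossing with the top strand.  In the positive case the
  equality of the weights there is the second cocycle condition.
\<close>

lemma hexagon_weight_middle:
  assumes "hexagon T M B a0 a1 a2 a' m0 m1 m2 m' b0 b1 b2 b'"
  shows "weight T M m0 m1 a0 a1 = weight T M m' m2 a' a2"
  using assms
proof (induction rule: hexagon_induct)
  case (positive a0 a1 a2 a' m0 m1 m2 m' b0 b1 b2 b')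
  then show ?case
    using f_ybe(2)[of m0 a0 a1 m1 b0 a2 b1 m' b' a' b2]
    by (simp add: hexagon_def crosses_def weight_def)
qed (simp_all add: weight_reverse)

lemma signed_carrier [simp]: "h \<in> carrier H \<Longrightarrow> signed e h \<in> carrier H"
  by (simp add: signed_def)

lemma signed_not: "h \<in> carrier H \<Longrightarrow> signed (\<not> e) h = inv\<^bsub>H\<^esub> signed e h"
  by (simp add: signed_def)

text \<open>
  The effect of changing a flag on the weight relation for the bottom strand: the two weights with
  exponent \<open>e\<close>, one on each side of the move, change their exponents, and the crossings with weights
  \<open>h\<close> and \<open>k\<close> trade places.
\<close>

lemma signed_swap:
  assumes "signed e g \<otimes>\<^bsub>H\<^esub> h = k \<otimes>\<^bsub>H\<^esub> signed e l"
    and "g \<in> carrier H" "h \<in> carrier H" "k \<in> carrier H" "l \<in> carrier H"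
  shows "signed (\<not> e) g \<otimes>\<^bsub>H\<^esub> k = h \<otimes>\<^bsub>H\<^esub> signed (\<not> e) l"
proof -
  have "signed e g \<otimes>\<^bsub>H\<^esub> (h \<otimes>\<^bsub>H\<^esub> inv\<^bsub>H\<^esub> signed e l) = k"
    using assms by (metis inv_closed inv_solve_right m_assoc m_closed signed_carrier)
  then show ?thesis
    using assms by (simp add: signed_not inv_solve_left')
qed

text \<open>
  The bottom strand passes under at two crossings, whose weights are read here in the direction from
  \<open>b0\<close> to \<open>b2\<close>.  Relative to that direction the exponents are the flags \<open>T\<close> and \<open>M\<close>.  In the positive
  case this is the first cocycle condition.
\<close>

lemma hexagon_weight_bottom:
  assumes "hexagon T M B a0 a1 a2 a' m0 m1 m2 m' b0 b1 b2 b'"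
  shows "signed T (weight T B b0 b1 a1 a2) \<otimes>\<^bsub>H\<^esub> signed M (weight M B b1 b2 m1 m2) =
    signed M (weight M B b0 b' m0 m') \<otimes>\<^bsub>H\<^esub> signed T (weight T B b' b2 a0 a')"
  using assms
proof (induction rule: hexagon_induct)
  case (positive a0 a1 a2 a' m0 m1 m2 m' b0 b1 b2 b')
  then show ?case
    using f_ybe(1)[of m0 a0 a1 m1 b0 a2 b1 m' b' a' b2]
    by (simp add: hexagon_def crosses_def weight_def signed_def)
next
  case (flip_top T M B a0 a1 a2 a' m0 m1 m2 m' b0 b1 b2 b')
  then show ?case
    unfolding weight_reverse by (intro signed_swap) (auto simp: hexagon_def)
next
  case (flip_middle T M B a0 a1 a2 a' m0 m1 m2 m' b0 b1 b2 b')
  then show ?case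
    unfolding weight_reverse by (intro signed_swap[symmetric]) (auto simp: hexagon_def)
next
  case (flip_bottom T M B a0 a1 a2 a' m0 m1 m2 m' b0 b1 b2 b')
  then show ?case
    by (simp add: weight_reverse)
qed

end

section \<open>Successive passages\<close>

lemma cycle_of_list_Cons:
  assumes "distinct (x # y # zs)"
  shows "cycle_of_list (x # y # zs) x = y"
  using assms by (simp add: id_outside_supp)

lemma cycle_of_list_nth:
  assumes "distinct K" "i < length K"
  shows "cycle_of_list K (K ! i) = K ! (Suc i mod length K)"
proof -
  have "map (cycle_of_list K) K = rotate (Suc 0) K"
    using cyclic_rotation[OF assms(1), of "Suc 0"] by simp
  from arg_cong[OF this, of "\<lambda>xs. xs ! i"] show ?thesis
    using assms by (simp only: nth_map nth_rotate) simp
qed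

lemma cycle_of_list_funpow_nth:
  assumes "distinct K" "i < length K"
  shows "(cycle_of_list K ^^ j) (K ! i) = K ! ((i + j) mod length K)"
proof (induction j)
  case (Suc j)
  have "(i + j) mod length K < length K"
    using assms(2) by (intro mod_less_divisor) auto
  then show ?case
    using Suc assms by (simp add: cycle_of_list_nth mod_Suc_eq)
qed (use assms in simp)

lemma cycle_of_list_in_set:
  assumes "distinct K" "p \<in> set K"
  shows "cycle_of_list K p \<in> set K"
  using cycle_permutes[of K] assms(2) by (simp add: permutes_in_image)

lemma next_passage_component:
  assumes "distinct (concat D)" "K \<in> set D" "p \<in> set K"
  shows "next_passage D p = cycle_of_list K p"
  using assms
proof (induction D)
  case (Cons L D)
  show ?case
  proof (cases "K = L")
    case True
    have "p \<notin> set (concat D)"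
      using Cons.prems True by auto
    then have "foldr cycle_of_list D p = p"
      by (induction D) (auto simp: id_outside_supp)
    then show ?thesis
      using True by (simp add: next_passage_def)
  next
    case False
    then have "K \<in> set D"
      using Cons.prems by simp
    with Cons have *: "next_passage D p = cycle_of_list K p"
      by simp
    have "cycle_of_list K p \<in> set K"
      using Cons.prems \<open>K \<in> set D\<close>
      by (intro cycle_of_list_in_set) (auto simp: distinct_concat_iff)
    then have "cycle_of_list K p \<notin> set L"
      using Cons.prems \<open>K \<in> set D\<close> by auto
    then show ?thesis
      using * by (simp add: next_passage_def id_outside_supp)
  qed
qed simp

lemma next_passage_permutes: "next_passage D permutes passages D"
proof (induction D)
  case Nil
  then show ?case
    by (simp add: next_passage_def permutes_def)
next
  case (Cons K D)
  have "next_passage (K # D) = cycle_of_list K \<circ> next_passage D"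
    by (auto simp: next_passage_def)
  moreover have "cycle_of_list K permutes passages (K # D)" "next_passage D permutes passages (K # D)"
    by (rule permutes_subset[OF cycle_permutes], simp add: passages_def)
      (rule permutes_subset[OF Cons], simp add: passages_def)
  ultimately show ?case
    by (simp only: permutes_compose)
qed

lemma inj_next_passage: "inj (next_passage D)"
  by (rule permutes_inj[OF next_passage_permutes])

lemma next_passage_in_passages [simp]:
  "next_passage D p \<in> passages D \<longleftrightarrow> p \<in> passages D"
  using next_passage_permutes by (rule permutes_in_image)

lemma funpow_next_in_passages [simp]:
  "(next_passage D ^^ k) p \<in> passages D \<longleftrightarrow> p \<in> passages D"
  by (induction k) simp_all

lemma opposite_cases:
  assumes "fst (opposite D h) = q"
  shows "snd h = Outgoing \<and> next_passage D (fst h) = q \<and> opposite D h = (q, Incoming) \<or>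
    snd h = Incoming \<and> next_passage D q = fst h \<and> opposite D h = (q, Outgoing)"
proof (cases h)
  case (Pair p t)
  have *: "next_passage D (inv_into UNIV (next_passage D) p) = p"
    by (rule surj_f_inv_f[OF permutes_surj[OF next_passage_permutes]])
  show ?thesis
  proof (cases t)
    case Incoming
    then have "q = inv_into UNIV (next_passage D) p"
      using assms Pair by simp
    then show ?thesis
      using * Pair Incoming by simp
  next
    case Outgoing
    then show ?thesis
      using assms Pair by simp
  qed
qed

lemma component_of_passage:
  assumes "p \<in> passages D"
  obtains i where "i < length D" "p \<in> set (D ! i)"
proof -
  obtain K where "K \<in> set D" "p \<in> set K"
    using assms by (auto simp: passages_def)
  then show thesis
    using that by (auto simp: in_set_conv_nth[of K D])
qed

lemma component_passages: "i < length D \<Longrightarrow> set (D ! i) \<subseteq> passages D"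
  unfolding passages_def set_concat by (intro Union_upper imageI nth_mem)

lemma component_unique:
  assumes "distinct (concat D)" "i < length D" "j < length D" "p \<in> set (D ! i)" "p \<in> set (D ! j)"
  shows "i = j"
proof (rule ccontr)
  assume "i \<noteq> j"
  then have *: "i < j \<or> j < i" by auto
  have "set (D ! i) \<inter> set (D ! j) = {}" if "i < j" "j < length D" for i j
  proof -
    have "D = take j D @ D ! j # drop (Suc j) D"
      using that by (simp add: id_take_nth_drop)
    then have "distinct (concat (take j D) @ D ! j @ concat (drop (Suc j) D))"
      using assms(1) by (metis concat.simps(2) concat_append)
    then have "set (concat (take j D)) \<inter> set (D ! j) = {}"
      by auto
    moreover have "D ! i \<in> set (take j D)"
      using that by (auto simp: in_set_conv_nth intro!: exI[of _ i])
    ultimately show ?thesis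
      by auto
  qed
  then show False
    using * assms by blast
qed

lemma next_passage_nth:
  assumes "distinct (concat D)" "i < length D" "j < length (D ! i)"
  shows "(next_passage D ^^ k) (D ! i ! j) = D ! i ! ((j + k) mod length (D ! i))"
proof (induction k)
  case (Suc k)
  let ?m = "(j + k) mod length (D ! i)"
  have "?m < length (D ! i)"
    using assms(3) by (intro mod_less_divisor) auto
  moreover have "distinct (D ! i)"
    using assms by (simp add: distinct_concat_iff)
  ultimately show ?case
    using Suc assms next_passage_component[OF assms(1), of "D ! i" "D ! i ! ?m"]
    by (simp add: cycle_of_list_nth mod_Suc_eq)
qed (use assms in simp)

lemma next_passage_in_component:
  assumes "distinct (concat D)" "i < length D"
  shows "next_passage D p \<in> set (D ! i) \<longleftrightarrow> p \<in> set (D ! i)"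
proof -
  have 1: "next_passage D q \<in> set (D ! k)" if "q \<in> set (D ! k)" "k < length D" for q k
  proof -
    have "distinct (D ! k)"
      using assms that by (simp add: distinct_concat_iff)
    then show ?thesis
      using next_passage_component[OF assms(1), of "D ! k" q] cycle_of_list_in_set that by simp
  qed
  show ?thesis
  proof
    assume nxt: "next_passage D p \<in> set (D ! i)"
    then have "next_passage D p \<in> passages D"
      using assms by (auto simp: passages_def)
    then have "p \<in> passages D"
      by simp
    then obtain k where k: "k < length D" "p \<in> set (D ! k)"
      by (rule component_of_passage)
    with 1[OF k(2,1)] nxt show "p \<in> set (D ! i)"
      using component_unique assms by metis
  qed (use 1 assms in blast)
qed

lemma component_reachable:
  assumes "distinct (concat D)" "i < length D" "p \<in> set (D ! i)" "q \<in> set (D ! i)"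
  obtains k where "(next_passage D ^^ k) p = q"
proof -
  obtain j where j: "j < length (D ! i)" "D ! i ! j = p"
    using assms(3) by (auto simp: in_set_conv_nth)
  obtain l where l: "l < length (D ! i)" "D ! i ! l = q"
    using assms(4) by (auto simp: in_set_conv_nth)
  have "(next_passage D ^^ (length (D ! i) - j + l)) p = q"
    using next_passage_nth[OF assms(1,2) j(1), of "length (D ! i) - j + l"] j l by simp
  then show thesis
    by (rule that)
qed

lemma filter_rotate: "\<exists>k. filter P (rotate n xs) = rotate k (filter P xs)"
proof (induction n)
  case 0
  then show ?case
    by (metis id_apply rotate0)
next
  case (Suc n)
  have *: "\<exists>k. filter P (rotate1 ys) = rotate k (filter P ys)" for ys
  proof (cases ys)
    case (Cons y zs)
    have "filter P (rotate1 ys) = rotate (if P y then 1 else 0) (filter P ys)"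
      using Cons by simp
    then show ?thesis
      by blast
  qed simp
  obtain k l where "filter P (rotate n xs) = rotate k (filter P xs)"
      "filter P (rotate1 (rotate n xs)) = rotate l (filter P (rotate n xs))"
    using Suc * by blast
  then show ?case
    by (simp add: rotate_rotate) blast
qed

lemma rotate_to_front:
  assumes "p \<in> set K"
  obtains n xs where "rotate n K = p # xs"
proof -
  obtain ys zs where "K = ys @ p # zs"
    using assms by (meson split_list)
  then have "rotate (length ys) K = p # (zs @ ys)"
    by (simp add: rotate_append)
  then show thesis
    by (rule that)
qed

text \<open>
  Deleting entries from a cyclic list turns its successor function into the map of first return to
  the remaining entries.
\<close>

lemma cycle_of_list_filter:
  assumes "distinct K" "r \<in> set K" "P r"
  obtains k where "cycle_of_list (filter P K) r = (cycle_of_list K ^^ Suc k) r"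
    and "\<And>j. j < k \<Longrightarrow> \<not> P ((cycle_of_list K ^^ Suc j) r)"
proof -
  obtain n xs where n: "rotate n K = r # xs"
    using rotate_to_front assms(2) .
  obtain m where m: "filter P (rotate n K) = rotate m (filter P K)"
    using filter_rotate by blast
  have dist: "distinct (r # xs)"
    using assms(1) n by (metis distinct_rotate)
  have K: "cycle_of_list K = cycle_of_list (r # xs)"
    using cycle_of_list_rotate_independent[OF assms(1), of n] n by simp
  have F: "cycle_of_list (filter P K) = cycle_of_list (r # filter P xs)"
    using cycle_of_list_rotate_independent[of "filter P K" m] m n assms by simp
  have step: "(cycle_of_list (r # xs) ^^ Suc j) r = (xs @ [r]) ! j" if "j \<le> length xs" for j
    using cycle_of_list_funpow_nth[OF dist, of 0 "Suc j"] that
    by (cases "j = length xs") (auto simp: nth_append simp del: funpow.simps)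
  obtain ys z zs where xs: "xs @ [r] = ys @ z # zs" "\<forall>y \<in> set ys. \<not> P y" "P z"
    using split_list_first_prop[of "xs @ [r]" P] assms(3) by auto
  have len: "length ys \<le> length xs"
    using arg_cong[OF xs(1), of length] by simp
  have "cycle_of_list (r # filter P xs) r = z"
  proof (cases "filter P xs")
    case Nil
    then have "filter P (xs @ [r]) = [r]"
      using assms(3) by simp
    then have "z = r"
      using xs by (metis append_self_conv2 filter.simps(2) filter_False filter_append list.inject)
    then show ?thesis
      using Nil by simp
  next
    case (Cons y ws)
    have "filter P (xs @ [r]) = z # filter P zs"
      using xs by simp
    then have "y = z"
      using Cons by simp
    moreover have "distinct (r # y # ws)"
      using dist Cons by (metis distinct.simps(2) distinct_filter filter_is_subset subsetD)
    ultimately show ?thesis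
      using Cons cycle_of_list_Cons[of r y ws] by simp
  qed
  moreover have "(cycle_of_list K ^^ Suc (length ys)) r = z"
    using step[OF len] K xs(1) by simp
  moreover have "\<not> P ((cycle_of_list K ^^ Suc j) r)" if "j < length ys" for j
    using step[of j] that len K xs by (simp add: nth_append del: funpow.simps)
  ultimately show thesis
    using that[of "length ys"] F by simp
qed

section \<open>Pairs of consecutive passages and their removal\<close>

definition component :: "code \<Rightarrow> passage \<Rightarrow> nat" where
  "component D p = (THE i. i < length D \<and> p \<in> set (D ! i))"

lemma component_eq:
  assumes "distinct (concat D)" "i < length D" "p \<in> set (D ! i)"
  shows "component D p = i"
  unfolding component_def
  by (rule the_equality) (use assms(2,3) component_unique[OF assms(1) _ assms(2) _ assms(3)] in blast)+

lemma component_next: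
  assumes "distinct (concat D)" "p \<in> passages D"
  shows "component D (next_passage D p) = component D p"
proof -
  obtain i where "i < length D" "p \<in> set (D ! i)"
    using assms(2) by (rule component_of_passage)
  then show ?thesis
    using assms(1) by (simp add: component_eq next_passage_in_component)
qed

text \<open>
  The passages in \<open>P\<close> are the first ones of disjoint pairs of consecutive passages; these pairs are the
  part of the diagram touched by a move.
\<close>

locale adjacent_pairs =
  fixes D :: code and P :: "passage set"
  assumes distinct: "distinct (concat D)"
    and first: "P \<subseteq> passages D"
    and disjoint: "P \<inter> next_passage D ` P = {}"
begin

abbreviation nx :: "passage \<Rightarrow> passage" where "nx \<equiv> next_passage D"

text \<open>
  A semi-arc is named after the passage it leads to, so the one inside the pair of \<open>p\<close> is
  \<open>Into (nx p)\<close>.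
\<close>

definition entries :: "semi_arc set" where
  "entries = semi_arcs D - Into ` nx ` P"

lemma Into_entries: "Into p \<in> entries \<longleftrightarrow> p \<in> passages D \<and> p \<notin> nx ` P"
  by (auto simp: entries_def semi_arcs_def)

lemma Into_next_entries: "p \<in> passages D \<Longrightarrow> p \<notin> P \<Longrightarrow> Into (nx p) \<in> entries"
  using inj_next_passage[of D] by (auto simp: Into_entries dest: injD)

lemma Circle_entries: "Circle i \<in> entries \<longleftrightarrow> i < length D \<and> D ! i = []"
  by (auto simp: entries_def semi_arcs_def)

lemma second_passages: "nx ` P \<subseteq> passages D"
  using first by auto

lemma second_not_first: "p \<in> P \<Longrightarrow> nx p \<notin> P"
  using disjoint by auto

text \<open>
  The color is the same before and after each pair, so that the pair can be deleted from its strand.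
\<close>

definition straight :: "(semi_arc \<Rightarrow> 'x) \<Rightarrow> bool" where
  "straight C \<longleftrightarrow> (\<forall>p \<in> P. C (Into p) = C (Into (nx (nx p))))"

end

locale removal = adjacent_pairs +
  fixes A :: "crossing set"
  assumes removed: "{p \<in> passages D. fst p \<in> A} = P \<union> nx ` P"
begin

abbreviation D' :: code where "D' \<equiv> remove_crossings A D"

lemma removed_iff: "p \<in> passages D \<Longrightarrow> fst p \<in> A \<longleftrightarrow> p \<in> P \<or> p \<in> nx ` P"
  using removed by blast

lemma passages_removed: "passages D' = {p \<in> passages D. fst p \<notin> A}"
  by (auto simp: passages_def remove_crossings_def)

lemma distinct_removed: "distinct (concat D')"
proof -
  have "concat D' = filter (\<lambda>p. fst p \<notin> A) (concat D)"
    by (simp add: remove_crossings_def filter_concat)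
  then show ?thesis
    using distinct by simp
qed

lemma remaining_entry: "p \<in> passages D \<Longrightarrow> fst p \<notin> A \<Longrightarrow> Into p \<in> entries"
  using removed_iff by (auto simp: Into_entries)

lemma next_remaining_entry: "p \<in> passages D \<Longrightarrow> fst p \<notin> A \<Longrightarrow> Into (nx p) \<in> entries"
  using removed_iff Into_next_entries by blast

text \<open>
  When crossings are removed, a semi-arc becomes part of the one that leads to the next remaining
  passage, or, if no passage of its component remains, of the circle to which the component shrinks.
\<close>

definition survives :: "passage \<Rightarrow> bool" where
  "survives p \<longleftrightarrow> (\<exists>k. fst ((nx ^^ k) p) \<notin> A)"

definition landing :: "passage \<Rightarrow> passage" where
  "landing p = (nx ^^ (LEAST k. fst ((nx ^^ k) p) \<notin> A)) p"

fun collapse :: "semi_arc \<Rightarrow> semi_arc" where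
  "collapse (Into p) = (if survives p then Into (landing p) else Circle (component D p))"
| "collapse (Circle i) = Circle i"

lemma collapse_remaining: "fst p \<notin> A \<Longrightarrow> collapse (Into p) = Into p"
  by (auto simp: survives_def landing_def intro: exI[of _ 0])

lemma collapse_removed:
  assumes "p \<in> passages D" "fst p \<in> A"
  shows "collapse (Into p) = collapse (Into (nx p))"
proof -
  have shift: "(nx ^^ k) (nx p) = (nx ^^ Suc k) p" for k
    by (simp add: funpow_swap1)
  have "survives p \<longleftrightarrow> survives (nx p)"
  proof
    assume "survives p"
    then obtain k where k: "fst ((nx ^^ k) p) \<notin> A"
      by (auto simp: survives_def)
    with assms(2) obtain j where "k = Suc j"
      by (cases k) auto
    with k show "survives (nx p)"
      unfolding survives_def shift by blast
  next
    assume "survives (nx p)"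
    then show "survives p"
      unfolding survives_def shift by blast
  qed
  moreover have "landing p = landing (nx p)" if "survives p"
  proof -
    have "(LEAST k. fst ((nx ^^ k) p) \<notin> A) = Suc (LEAST k. fst ((nx ^^ Suc k) p) \<notin> A)"
      using that assms(2) unfolding survives_def by (elim exE, intro Least_Suc) simp_all
    then show ?thesis
      by (simp only: landing_def shift)
  qed
  ultimately show ?thesis
    using assms distinct by (simp add: component_next)
qed

lemma collapse_in_semi_arcs:
  assumes "a \<in> semi_arcs D"
  shows "collapse a \<in> semi_arcs D'"
proof (cases a)
  case (Into p)
  then have p: "p \<in> passages D"
    using assms by (auto simp: semi_arcs_def)
  show ?thesis
  proof (cases "survives p")
    case True
    then have "fst (landing p) \<notin> A"
      unfolding survives_def landing_def by (rule LeastI_ex)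
    moreover have "landing p \<in> passages D"
      using p by (simp add: landing_def)
    ultimately show ?thesis
      using Into True by (simp add: semi_arcs_def passages_removed)
  next
    case False
    obtain i where i: "i < length D" "p \<in> set (D ! i)"
      using p by (rule component_of_passage)
    have "fst q \<in> A" if "q \<in> set (D ! i)" for q
      using component_reachable[OF distinct i that] False unfolding survives_def by metis
    then have "D' ! i = []"
      using i by (simp add: remove_crossings_def)
    moreover have "component D p = i" "length D' = length D"
      using i distinct by (simp_all add: component_eq remove_crossings_def)
    ultimately show ?thesis
      using Into False i by (simp add: semi_arcs_def)
  qed
next
  case (Circle i)
  then show ?thesis
    using assms by (auto simp: semi_arcs_def remove_crossings_def)
qed

lemma collapse_onto:
  assumes "b \<in> semi_arcs D'"
  obtains a where "a \<in> entries" "collapse a = b"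
proof (cases b)
  case (Into p)
  then have "p \<in> passages D" "fst p \<notin> A"
    using assms by (auto simp: semi_arcs_def passages_removed)
  then show thesis
    using that[of "Into p"] remaining_entry collapse_remaining Into by simp
next
  case (Circle i)
  then have "i < length D" "filter (\<lambda>p. fst p \<notin> A) (D ! i) = []"
    using assms by (auto simp: semi_arcs_def remove_crossings_def)
  then have i: "i < length D" "\<forall>p \<in> set (D ! i). fst p \<in> A"
    unfolding filter_empty_conv by blast+
  show thesis
  proof (cases "D ! i = []")
    case True
    then show thesis
      using that[of "Circle i"] i Circle by (simp add: Circle_entries)
  next
    case False
    then obtain q where q: "q \<in> set (D ! i)"
      using list.set_sel(1) by blast
    have comp: "p \<in> passages D" if "p \<in> set (D ! i)" for p
      using that i by (auto simp: passages_def)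
    obtain p where p: "p \<in> P" "p \<in> set (D ! i)"
    proof (cases "q \<in> P")
      case False
      then obtain p where "p \<in> P" "q = nx p"
        using removed_iff[of q] q i(2) comp by blast
      then show thesis
        using that q next_passage_in_component[OF distinct i(1)] by simp
    qed (use q that in simp)
    have "(nx ^^ k) p \<in> set (D ! i)" for k
      using p(2) by (induction k) (simp_all add: next_passage_in_component[OF distinct i(1)])
    then have "\<not> survives p"
      using i(2) by (simp add: survives_def)
    moreover have "component D p = i"
      using component_eq[OF distinct i(1) p(2)] .
    moreover have "Into p \<in> entries"
      using p disjoint comp by (auto simp: Into_entries)
    ultimately show thesis
      using that[of "Into p"] Circle by simp
  qed
qed

lemma collapse_next:
  assumes "p \<in> passages D'"
  shows "collapse (Into (nx p)) = Into (next_passage D' p)"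
proof -
  have p: "p \<in> passages D" "fst p \<notin> A"
    using assms by (auto simp: passages_removed)
  then obtain i where i: "i < length D" "p \<in> set (D ! i)"
    by (blast elim: component_of_passage)
  let ?K = "D ! i" and ?P = "\<lambda>p. fst p \<notin> A"
  have K: "distinct ?K" "?K \<in> set D"
    using i distinct by (auto simp: distinct_concat_iff)
  have pow: "(cycle_of_list ?K ^^ k) p = (nx ^^ k) p" for k
  proof (induction k)
    case (Suc k)
    have "(nx ^^ k) p \<in> set ?K"
      using i(2) by (induction k) (simp_all add: next_passage_in_component[OF distinct i(1)])
    then show ?case
      using Suc next_passage_component[OF distinct K(2)] by simp
  qed simp
  obtain k where k: "cycle_of_list (filter ?P ?K) p = (nx ^^ Suc k) p"
      "\<And>j. j < k \<Longrightarrow> fst ((nx ^^ Suc j) p) \<in> A"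
    using cycle_of_list_filter[of ?K p ?P] K i p unfolding pow by metis
  have "filter ?P ?K \<in> set D'" "p \<in> set (filter ?P ?K)"
    using K(2) i p by (simp_all add: remove_crossings_def)
  then have next': "next_passage D' p = (nx ^^ Suc k) p"
    using next_passage_component[OF distinct_removed] k(1) by simp
  have "collapse (Into ((nx ^^ Suc j) p)) = Into ((nx ^^ Suc k) p)" if "j \<le> k" for j
    using that
  proof (induction j rule: inc_induct)
    case base
    have "(nx ^^ Suc k) p \<in> passages D'"
      using assms next_passage_in_passages[of D' p] unfolding next' by blast
    then show ?case
      using collapse_remaining by (auto simp: passages_removed)
  next
    case (step j)
    then show ?case
      using collapse_removed[of "(nx ^^ Suc j) p"] k(2)[of j] p(1) by simp
  qed
  from this[of 0] show ?thesis
    using next' by simp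
qed

text \<open>
  Starting outside a pair one meets the removed passages pair by pair, and across a pair the color
  stays the same.
\<close>

lemma straight_walk:
  assumes "straight C" "q \<in> passages D" "q \<notin> nx ` P" "(nx ^^ k) q \<notin> nx ` P"
    and "\<And>j. j < k \<Longrightarrow> fst ((nx ^^ j) q) \<in> A"
  shows "C (Into q) = C (Into ((nx ^^ k) q))"
  using assms(2-)
proof (induction k arbitrary: q rule: less_induct)
  case (less k)
  show ?case
  proof (cases "k = 0")
    case False
    then have "q \<in> P"
      using less.prems removed_iff[of q] by force
    then have "k \<noteq> 1"
      using less.prems(3) by auto
    with False obtain j where k: "k = Suc (Suc j)"
      by (metis One_nat_def not0_implies_Suc)
    have shift: "(nx ^^ i) (nx (nx q)) = (nx ^^ Suc (Suc i)) q" for i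
      by (simp add: funpow_swap1)
    have "C (Into (nx (nx q))) = C (Into ((nx ^^ j) (nx (nx q))))"
    proof (rule less.IH)
      show "nx (nx q) \<notin> nx ` P"
        using second_not_first[OF \<open>q \<in> P\<close>] by (simp add: inj_image_mem_iff[OF inj_next_passage])
      show "(nx ^^ j) (nx (nx q)) \<notin> nx ` P"
        using less.prems(3) unfolding k shift .
      show "fst ((nx ^^ i) (nx (nx q))) \<in> A" if "i < j" for i
        using less.prems(4)[of "Suc (Suc i)"] that unfolding k shift by simp
    qed (use k less.prems in simp_all)
    then show ?thesis
      using assms(1) \<open>q \<in> P\<close> unfolding straight_def k shift by simp
  qed simp
qed

text \<open>
  Therefore a straight coloring induces a coloring of the semi-arcs of the smaller diagram.  If all
  passages of a component are removed, a walk along the component reaches every other entry of it.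
\<close>

lemma straight_collapse:
  assumes "straight C" "a \<in> entries" "b \<in> entries" "collapse a = collapse b"
  shows "C a = C b"
proof -
  have circle: "Circle (component D p) \<notin> entries" if p: "p \<in> passages D" for p
  proof -
    obtain i where "i < length D" "p \<in> set (D ! i)"
      using p by (rule component_of_passage)
    then show ?thesis
      using component_eq[OF distinct] by (auto simp: Circle_entries)
  qed
  have land: "C (Into p) = C (Into (landing p))" if "Into p \<in> entries" "survives p" for p
  proof -
    have "fst (landing p) \<notin> A"
      using that(2) unfolding survives_def landing_def by (rule LeastI_ex)
    then have "landing p \<notin> nx ` P"
      using removed second_passages by blast
    then show ?thesis
      using that(1) straight_walk[OF assms(1), of p "LEAST k. fst ((nx ^^ k) p) \<notin> A"] not_less_Least
      unfolding landing_def Into_entries by blast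
  qed
  show ?thesis
  proof (cases a)
    case (Circle i)
    then show ?thesis
      using assms circle by (cases b) (auto simp: Into_entries split: if_splits)
  next
    case a: (Into p)
    show ?thesis
    proof (cases b)
      case (Circle i)
      then show ?thesis
        using assms circle[of p] a by (auto simp: Into_entries split: if_splits)
    next
      case b: (Into q)
      show ?thesis
      proof (cases "survives p")
        case True
        then have "survives q" "landing p = landing q"
          using assms(4) a b by (auto split: if_splits)
        then show ?thesis
          using land True assms a b by metis
      next
        case False
        then have "component D p = component D q"
          using assms(4) a b by (auto split: if_splits)
        moreover have pq: "p \<in> passages D" "q \<in> passages D" "p \<notin> nx ` P" "q \<notin> nx ` P"
          using assms a b by (auto simp: Into_entries)
        ultimately obtain i where "i < length D" "p \<in> set (D ! i)" "q \<in> set (D ! i)"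
          using component_eq[OF distinct] by (metis component_of_passage)
        then obtain k where "(nx ^^ k) p = q"
          using component_reachable[OF distinct] by metis
        then show ?thesis
          using straight_walk[OF assms(1), of p k] False pq a b by (simp add: survives_def)
      qed
    qed
  qed
qed

lemma collapse_pair:
  assumes "p \<in> P"
  shows "collapse (Into p) = collapse (Into (nx (nx p)))"
proof -
  have "p \<in> passages D" "fst p \<in> A" "fst (nx p) \<in> A"
    using assms first removed by auto
  then show ?thesis
    using collapse_removed[of p] collapse_removed[of "nx p"] by (simp del: collapse.simps)
qed

end

section \<open>Products along a component\<close>

context group
begin

definition product_along :: "('p \<Rightarrow> 'a) \<Rightarrow> 'p list \<Rightarrow> 'a" where
  "product_along g ps = foldr (\<lambda>p h. g p \<otimes> h) ps \<one>"

lemma product_along_simps [simp]: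
  "product_along g [] = \<one>"
  "product_along g (p # ps) = g p \<otimes> product_along g ps"
  by (simp_all add: product_along_def)

lemma product_along_carrier [simp]:
  "(\<And>p. p \<in> set ps \<Longrightarrow> g p \<in> carrier G) \<Longrightarrow> product_along g ps \<in> carrier G"
  by (induction ps) auto

lemma product_along_append:
  "(\<And>p. p \<in> set ps \<union> set qs \<Longrightarrow> g p \<in> carrier G) \<Longrightarrow>
   product_along g (ps @ qs) = product_along g ps \<otimes> product_along g qs"
  by (induction ps) (auto simp: m_assoc)

lemma product_along_filter:
  assumes "\<And>p. p \<in> set ps \<Longrightarrow> g p \<in> carrier G"
  shows "product_along g (filter P ps) = product_along (\<lambda>p. if P p then g p else \<one>) ps"
  using assms by (induction ps) auto

lemma product_along_map: "product_along g (map r ps) = product_along (g \<circ> r) ps"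
  by (induction ps) auto

lemma product_along_cong:
  "(\<And>p. p \<in> set ps \<Longrightarrow> g p = h p) \<Longrightarrow> product_along g ps = product_along h ps"
  by (induction ps) auto

lemma conj_class_commute:
  assumes "a \<in> carrier G" "b \<in> carrier G"
  shows "conj_class G (a \<otimes> b) = conj_class G (b \<otimes> a)"
proof -
  have *: "conj_class G (a \<otimes> b) \<subseteq> conj_class G (b \<otimes> a)"
    if "a \<in> carrier G" "b \<in> carrier G" for a b
  proof
    fix h assume "h \<in> conj_class G (a \<otimes> b)"
    then obtain g where g: "g \<in> carrier G" "h = g \<otimes> (a \<otimes> b) \<otimes> inv g"
      by (auto simp: conj_class_def)
    have "h = (g \<otimes> a) \<otimes> (b \<otimes> a) \<otimes> inv (g \<otimes> a)"
      using that g by (simp add: inv_mult_group m_assoc) (simp flip: m_assoc)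
    then show "h \<in> conj_class G (b \<otimes> a)"
      using that g unfolding conj_class_def by blast
  qed
  show ?thesis
    using * assms by blast
qed

lemma conj_class_product_along_rotate:
  assumes "\<And>p. p \<in> set ps \<Longrightarrow> g p \<in> carrier G"
  shows "conj_class G (product_along g (rotate n ps)) = conj_class G (product_along g ps)"
proof (induction n)
  case (Suc n)
  have "conj_class G (product_along g (rotate1 qs)) = conj_class G (product_along g qs)"
    if "set qs = set ps" for qs
  proof (cases qs)
    case (Cons q qs')
    then have "g q \<in> carrier G" "\<And>p. p \<in> set qs' \<Longrightarrow> g p \<in> carrier G"
      using assms that by auto
    moreover from this have "product_along g (qs' @ [q]) = product_along g qs' \<otimes> g q"
      using product_along_append[of qs' "[q]" g] by force
    ultimately show ?thesis
      using Cons conj_class_commute[of "g q" "product_along g qs'"] by simp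
  qed simp
  from this[of "rotate n ps"] Suc show ?case
    by simp
qed simp

text \<open>
  The word starts and ends between pairs, so that each pair contributes two neighboring factors, which
  can be replaced together.
\<close>

lemma product_along_pairs:
  assumes "successively (\<lambda>p q. q = nx p) ps" "inj nx" "P \<inter> nx ` P = {}"
    and "ps \<noteq> [] \<Longrightarrow> hd ps \<notin> nx ` P" "ps \<noteq> [] \<Longrightarrow> last ps \<notin> P"
    and "\<And>p. p \<in> set ps \<Longrightarrow> p \<in> P \<Longrightarrow> g p \<otimes> g (nx p) = h p \<otimes> h (nx p)"
    and "\<And>p. p \<in> set ps \<Longrightarrow> p \<notin> P \<Longrightarrow> p \<notin> nx ` P \<Longrightarrow> g p = h p"
    and "\<And>p. p \<in> set ps \<Longrightarrow> g p \<in> carrier G \<and> h p \<in> carrier G"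
  shows "product_along g ps = product_along h ps"
  using assms(1,4-)
proof (induction "length ps" arbitrary: ps rule: less_induct)
  case less
  show ?case
  proof (cases ps)
    case (Cons p qs)
    show ?thesis
    proof (cases "p \<in> P")
      case True
      then obtain q rs where qs: "qs = q # rs"
        using less.prems(3) Cons by (cases qs) auto
      have q: "q = nx p"
        using less.prems(1) Cons qs by simp
      then have "q \<notin> P"
        using True assms(3) by auto
      have "product_along g rs = product_along h rs"
      proof (rule less.hyps)
        show "length rs < length ps"
          using Cons qs by simp
        show "successively (\<lambda>p q. q = nx p) rs"
          using less.prems(1) Cons qs by (cases rs) auto
        show "hd rs \<notin> nx ` P" if "rs \<noteq> []"
          using less.prems(1) Cons qs that \<open>q \<notin> P\<close> assms(2) by (cases rs) (auto dest: injD)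
        show "last rs \<notin> P" if "rs \<noteq> []"
          using less.prems(3) Cons qs that by simp
      qed (use less.prems(4-) Cons qs in auto)
      moreover have "g p \<otimes> g q = h p \<otimes> h q"
        using less.prems(4)[of p] True q Cons by simp
      moreover have "product_along k ps = (k p \<otimes> k q) \<otimes> product_along k rs"
        if "k = g \<or> k = h" for k
        using that less.prems(6) Cons qs by (auto simp: m_assoc)
      ultimately show ?thesis
        by metis
    next
      case False
      have "product_along g qs = product_along h qs"
      proof (rule less.hyps)
        show "length qs < length ps"
          using Cons by simp
        show "successively (\<lambda>p q. q = nx p) qs"
          using less.prems(1) Cons by (cases qs) auto
        show "hd qs \<notin> nx ` P" if "qs \<noteq> []"
          using less.prems(1) Cons that False assms(2) by (cases qs) (auto dest: injD)
        show "last qs \<notin> P" if "qs \<noteq> []"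
          using less.prems(3) Cons that by simp
      qed (use less.prems(4-) Cons in auto)
      moreover have "g p = h p"
        using less.prems(2) less.prems(5)[of p] False Cons by simp
      ultimately show ?thesis
        using Cons by simp
    qed
  qed simp
qed

text \<open>
  A cyclic word can be cut open just before an entry that is not the second one of a pair, and then no
  pair is cut.  Where to cut does not matter for the conjugacy class.
\<close>

lemma conj_class_product_along_pairs:
  assumes K: "distinct K" "\<And>p. p \<in> set K \<Longrightarrow> nx p = cycle_of_list K p"
    and nx: "inj nx" "P \<inter> nx ` P = {}" "\<And>p. nx p \<in> set K \<longleftrightarrow> p \<in> set K"
    and pair: "\<And>p. p \<in> set K \<Longrightarrow> p \<in> P \<Longrightarrow> g p \<otimes> g (nx p) = h p \<otimes> h (nx p)"
    and other: "\<And>p. p \<in> set K \<Longrightarrow> p \<notin> P \<Longrightarrow> p \<notin> nx ` P \<Longrightarrow> g p = h p"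
    and carrier: "\<And>p. p \<in> set K \<Longrightarrow> g p \<in> carrier G \<and> h p \<in> carrier G"
  shows "conj_class G (product_along g K) = conj_class G (product_along h K)"
proof (cases "\<exists>q \<in> set K. q \<notin> nx ` P")
  case True
  then obtain q n ps where q: "q \<notin> nx ` P" and ps: "rotate n K = q # ps"
    by (meson rotate_to_front)
  define L where "L = rotate n K"
  have L: "set L = set K" "distinct L" "L \<noteq> []" "hd L = q"
    using K(1) by (simp_all only: L_def set_rotate distinct_rotate) (simp_all add: ps)
  have nx_L: "nx p = cycle_of_list L p" if "p \<in> set L" for p
    using K that L(1) cycle_of_list_rotate_independent[of K n] by (simp add: L_def)
  \<comment> \<open>the successor of the last entry is the first one, which is not the second one of a pair\<close>
  have "last L \<notin> P"
  proof
    assume "last L \<in> P"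
    moreover have "nx (last L) = q"
      using L nx_L[OF last_in_set[OF L(3)]] cycle_of_list_nth[OF L(2), of "length L - 1"]
      by (simp add: last_conv_nth hd_conv_nth)
    ultimately show False
      using q by blast
  qed
  moreover have "successively (\<lambda>p q. q = nx p) L"
    using L(2) nx_L by (auto simp: successively_conv_nth cycle_of_list_nth)
  ultimately have "product_along g L = product_along h L"
    using L q by (intro product_along_pairs[OF _ nx(1,2)]) (simp_all add: pair other carrier)
  moreover have "conj_class G (product_along k L) = conj_class G (product_along k K)"
    if "k = g \<or> k = h" for k
    using that carrier unfolding L_def by (intro conj_class_product_along_rotate) auto
  ultimately show ?thesis
    by metis
next
  case False
  have "K = []"
  proof (rule ccontr)
    assume "K \<noteq> []"
    then obtain q where "q \<in> set K"
      by (meson list.set_sel(1))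
    then obtain p where "p \<in> P" "q = nx p"
      using False by blast
    then have "p \<in> set K"
      using nx(3) \<open>q \<in> set K\<close> by simp
    then show False
      using False nx(2) \<open>p \<in> P\<close> by blast
  qed
  then show ?thesis
    by simp
qed

end

section \<open>Colorings and weights\<close>

context adjacent_pairs
begin

lemma colors_eqI:
  assumes "C1 \<in> semi_arcs D \<rightarrow>\<^sub>E X" "C2 \<in> semi_arcs D \<rightarrow>\<^sub>E X"
    and "\<And>a. a \<in> entries \<Longrightarrow> C1 a = C2 a"
    and "\<And>p. p \<in> P \<Longrightarrow> C1 (Into (nx p)) = C2 (Into (nx p))"
  shows "C1 = C2"
proof (rule PiE_ext[OF assms(1,2)])
  fix a assume "a \<in> semi_arcs D"
  then consider "a \<in> entries" | p where "p \<in> P" "a = Into (nx p)"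
    unfolding entries_def by blast
  then show "C1 a = C2 a"
    using assms(3,4) by cases simp_all
qed

end

context birack_on
begin

definition colored :: "(passage \<Rightarrow> 'x) \<Rightarrow> (passage \<Rightarrow> 'x) \<Rightarrow> crossing \<Rightarrow> bool" where
  "colored i u c \<longleftrightarrow>
     crosses (sign_of c = Positive) (sign_of c = Positive)
       (i (c, Under)) (u (c, Under)) (i (c, Over)) (u (c, Over))"

lemma inv_\<sigma>_iff:
  assumes "{x, y, z, w} \<subseteq> X"
  shows "(x, y) = inv_into (X \<times> X) \<sigma> (z, w) \<longleftrightarrow> \<sigma> (x, y) = (z, w)"
proof
  assume "(x, y) = inv_into (X \<times> X) \<sigma> (z, w)"
  then show "\<sigma> (x, y) = (z, w)"
    using bij_betw_inv_into_right[OF bij_\<sigma>, of "(z, w)"] assms by simp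
next
  assume "\<sigma> (x, y) = (z, w)"
  then show "(x, y) = inv_into (X \<times> X) \<sigma> (z, w)"
    using bij_betw_inv_into_left[OF bij_\<sigma>, of "(x, y)"] assms by simp
qed

lemma incoming_in_X:
  "C \<in> semi_arcs D \<rightarrow>\<^sub>E X \<Longrightarrow> p \<in> passages D \<Longrightarrow> incoming C p \<in> X"
  by (auto simp: incoming_def semi_arcs_def)

lemma outgoing_in_X:
  "C \<in> semi_arcs D \<rightarrow>\<^sub>E X \<Longrightarrow> p \<in> passages D \<Longrightarrow> outgoing D C p \<in> X"
  using next_passage_in_passages[of D p] by (auto simp: outgoing_def semi_arcs_def simp del: next_passage_in_passages)

lemma strands_in_passages:
  assumes "gauss_code D" "c \<in> crossings D"
  shows "(c, t) \<in> passages D"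
  using assms by (cases t) (auto simp: gauss_code_def)

lemma colorings_iff:
  assumes "gauss_code D"
  shows "C \<in> colorings X \<sigma> D \<longleftrightarrow>
    C \<in> semi_arcs D \<rightarrow>\<^sub>E X \<and> (\<forall>c \<in> crossings D. colored (incoming C) (outgoing D C) c)"
proof -
  have "(case sign_of c of
      Positive \<Rightarrow> (outgoing D C (c, Over), outgoing D C (c, Under)) =
        \<sigma> (incoming C (c, Under), incoming C (c, Over))
    | Negative \<Rightarrow> (outgoing D C (c, Under), outgoing D C (c, Over)) =
        inv_into (X \<times> X) \<sigma> (incoming C (c, Over), incoming C (c, Under))) \<longleftrightarrow>
    colored (incoming C) (outgoing D C) c"
    if "C \<in> semi_arcs D \<rightarrow>\<^sub>E X" "c \<in> crossings D" for c
    using that inv_\<sigma>_iff strands_in_passages[OF assms] incoming_in_X outgoing_in_X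
    by (cases "sign_of c") (auto simp: colored_def crosses_def)
  then show ?thesis
    unfolding colorings_def by blast
qed

lemma coloringD:
  assumes "gauss_code D" "C \<in> colorings X \<sigma> D"
  shows "C \<in> semi_arcs D \<rightarrow>\<^sub>E X"
    and "c \<in> crossings D \<Longrightarrow> colored (incoming C) (outgoing D C) c"
  using assms colorings_iff by blast+

end

context cocycle_on
begin

text \<open>
  Over-passages get the weight \<open>\<one>\<close>, so that the invariant is a product over all passages of a
  component.
\<close>

definition passage_weight :: "(passage \<Rightarrow> 'x) \<Rightarrow> (passage \<Rightarrow> 'x) \<Rightarrow> passage \<Rightarrow> 'h" where
  "passage_weight i u = (\<lambda>(c, t). case t of
     Under \<Rightarrow> signed (sign_of c = Positive)
       (weight (sign_of c = Positive) (sign_of c = Positive)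
         (i (c, Under)) (u (c, Under)) (i (c, Over)) (u (c, Over)))
   | Over \<Rightarrow> \<one>\<^bsub>H\<^esub>)"

lemma passage_weight_simps [simp]:
  "passage_weight i u (c, Over) = \<one>\<^bsub>H\<^esub>"
  "passage_weight i u (c, Under) = signed (sign_of c = Positive)
     (weight (sign_of c = Positive) (sign_of c = Positive)
       (i (c, Under)) (u (c, Under)) (i (c, Over)) (u (c, Over)))"
  by (simp_all add: passage_weight_def)

lemma passage_weight_cong:
  assumes "\<And>t. i (fst p, t) = i' (fst p, t)" "\<And>t. u (fst p, t) = u' (fst p, t)"
  shows "passage_weight i u p = passage_weight i' u' p"
  using assms by (cases p) (simp add: passage_weight_def split: strand.split)

lemma passage_weight_carrier:
  assumes "\<And>t. i (fst p, t) \<in> X" "\<And>t. u (fst p, t) \<in> X"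
  shows "passage_weight i u p \<in> carrier H"
  using assms by (cases p) (simp add: passage_weight_def split: strand.split)

lemma coloring_weight_carrier:
  assumes "gauss_code D" "C \<in> colorings X \<sigma> D" "p \<in> passages D"
  shows "passage_weight (incoming C) (outgoing D C) p \<in> carrier H"
proof -
  have "(fst p, t) \<in> passages D" for t
    using assms(3) by (intro strands_in_passages[OF assms(1)]) (auto simp: crossings_def)
  then show ?thesis
    using coloringD(1)[OF assms(1,2)] by (intro passage_weight_carrier incoming_in_X outgoing_in_X)
qed

lemma Psi_product:
  assumes D: "gauss_code D" and C: "C \<in> colorings X \<sigma> D" and i: "i < length D"
  shows "Psi X \<sigma> H f D b C i =
    product_along (passage_weight (incoming C) (outgoing D C)) (rotate (b i) (D ! i))"
proof -
  have *: "boltzmann_weight X \<sigma> H f C c = passage_weight (incoming C) (outgoing D C) (c, Under)"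
    if c: "c \<in> crossings D" for c
  proof (cases "sign_of c")
    case Positive
    then show ?thesis
      by (simp add: boltzmann_weight_def signed_def weight_def)
  next
    case Negative
    have X: "{incoming C (c, Over), incoming C (c, Under),
        outgoing D C (c, Over), outgoing D C (c, Under)} \<subseteq> X"
      using incoming_in_X outgoing_in_X strands_in_passages[OF D c] coloringD(1)[OF D C] by auto
    have "\<sigma> (outgoing D C (c, Under), outgoing D C (c, Over)) =
        (incoming C (c, Over), incoming C (c, Under))"
      using coloringD(2)[OF D C c] Negative by (simp add: colored_def crosses_def)
    then have "(outgoing D C (c, Under), outgoing D C (c, Over)) =
        inv_into (X \<times> X) \<sigma> (incoming C (c, Over), incoming C (c, Under))"
      using X by (simp add: inv_\<sigma>_iff)
    then show ?thesis
      using Negative by (simp add: boltzmann_weight_def signed_def weight_def)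
  qed
  have "foldr (\<otimes>\<^bsub>H\<^esub>) [boltzmann_weight X \<sigma> H f C c. (c, t) \<leftarrow> ps, t = Under] \<one>\<^bsub>H\<^esub> =
      product_along (passage_weight (incoming C) (outgoing D C)) ps"
    if "set ps \<subseteq> passages D" for ps
    using that
  proof (induction ps)
    case (Cons p ps)
    obtain c t where p: "p = (c, t)"
      by fastforce
    have c: "c \<in> crossings D"
      using Cons.prems p by (force simp: crossings_def)
    have "product_along (passage_weight (incoming C) (outgoing D C)) ps \<in> carrier H"
      using Cons.prems coloring_weight_carrier[OF D C] by (intro product_along_carrier) auto
    with Cons *[OF c] p show ?case
      by (cases t) simp_all
  qed simp
  moreover have "set (rotate (b i) (D ! i)) \<subseteq> passages D"
    using component_passages[OF i] by simp
  ultimately show ?thesis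
    by (simp add: Psi_def)
qed

definition component_class :: "code \<Rightarrow> (semi_arc \<Rightarrow> 'x) \<Rightarrow> nat \<Rightarrow> 'h set" where
  "component_class D C i =
     conj_class H (product_along (passage_weight (incoming C) (outgoing D C)) (D ! i))"

lemma conj_class_Psi:
  assumes "gauss_code D" "C \<in> colorings X \<sigma> D" "i < length D"
  shows "conj_class H (Psi X \<sigma> H f D b C i) = component_class D C i"
proof -
  have "set (D ! i) \<subseteq> passages D"
    using assms(3) by (rule component_passages)
  then show ?thesis
    unfolding Psi_product[OF assms] component_class_def
    using coloring_weight_carrier[OF assms(1,2)]
    by (intro conj_class_product_along_rotate) auto
qed

text \<open>
  In contrast to the invariant itself this relation keeps track of the components and of the colorings, and
  it is an equivalence relation.
\<close>

definition same_invariant :: "code \<Rightarrow> code \<Rightarrow> bool" where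
  "same_invariant D D' \<longleftrightarrow> length D' = length D \<and>
     (\<exists>\<Phi>. bij_betw \<Phi> (colorings X \<sigma> D) (colorings X \<sigma> D') \<and>
       (\<forall>C \<in> colorings X \<sigma> D. \<forall>i < length D. component_class D' (\<Phi> C) i = component_class D C i))"

lemma same_invariant_refl: "same_invariant D D"
  unfolding same_invariant_def by (intro conjI exI[of _ id]) simp_all

lemma same_invariant_sym:
  assumes "same_invariant D D'"
  shows "same_invariant D' D"
proof -
  obtain \<Phi> where len: "length D' = length D"
    and \<Phi>: "bij_betw \<Phi> (colorings X \<sigma> D) (colorings X \<sigma> D')"
    and eq: "\<And>C i. C \<in> colorings X \<sigma> D \<Longrightarrow> i < length D \<Longrightarrow>
        component_class D' (\<Phi> C) i = component_class D C i"
    using assms by (auto simp: same_invariant_def)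
  have "bij_betw (inv_into (colorings X \<sigma> D) \<Phi>) (colorings X \<sigma> D') (colorings X \<sigma> D)"
    using \<Phi> by (rule bij_betw_inv_into)
  moreover have "component_class D (inv_into (colorings X \<sigma> D) \<Phi> C) i = component_class D' C i"
    if "C \<in> colorings X \<sigma> D'" "i < length D'" for C i
    using eq[of "inv_into (colorings X \<sigma> D) \<Phi> C" i] that len \<Phi>
    by (simp add: bij_betw_def inv_into_into f_inv_into_f)
  ultimately show ?thesis
    using len unfolding same_invariant_def by auto
qed

lemma same_invariant_trans:
  assumes "same_invariant D D'" "same_invariant D' D''"
  shows "same_invariant D D''"
proof -
  obtain \<Phi> where 1: "length D' = length D" "bij_betw \<Phi> (colorings X \<sigma> D) (colorings X \<sigma> D')"
    "\<And>C i. C \<in> colorings X \<sigma> D \<Longrightarrow> i < length D \<Longrightarrow>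
        component_class D' (\<Phi> C) i = component_class D C i"
    using assms(1) by (auto simp: same_invariant_def)
  obtain \<Psi> where 2: "length D'' = length D'" "bij_betw \<Psi> (colorings X \<sigma> D') (colorings X \<sigma> D'')"
    "\<And>C i. C \<in> colorings X \<sigma> D' \<Longrightarrow> i < length D' \<Longrightarrow>
        component_class D'' (\<Psi> C) i = component_class D' C i"
    using assms(2) by (auto simp: same_invariant_def)
  have "bij_betw (\<Psi> \<circ> \<Phi>) (colorings X \<sigma> D) (colorings X \<sigma> D'')"
    using 1 2 by (blast intro: bij_betw_trans)
  moreover have "\<forall>C \<in> colorings X \<sigma> D. \<forall>i < length D.
      component_class D'' ((\<Psi> \<circ> \<Phi>) C) i = component_class D C i"
    using 1 2 bij_betw_apply[OF 1(2)] by simp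
  ultimately show ?thesis
    using 1(1) 2(1) unfolding same_invariant_def by auto
qed

text \<open>
  A move is described by a relation between colorings, namely equality away from the move; unique
  existence on both sides turns it into a bijection.
\<close>

lemma same_invariantI:
  assumes "length D' = length D"
    and "\<And>C. C \<in> colorings X \<sigma> D \<Longrightarrow> \<exists>!C'. C' \<in> colorings X \<sigma> D' \<and> R C C'"
    and "\<And>C'. C' \<in> colorings X \<sigma> D' \<Longrightarrow> \<exists>!C. C \<in> colorings X \<sigma> D \<and> R C C'"
    and "\<And>C C' i. C \<in> colorings X \<sigma> D \<Longrightarrow> C' \<in> colorings X \<sigma> D' \<Longrightarrow> R C C' \<Longrightarrow> i < length D \<Longrightarrow>
      component_class D' C' i = component_class D C i"
  shows "same_invariant D D'"
proof -
  define \<Phi> where "\<Phi> C = (THE C'. C' \<in> colorings X \<sigma> D' \<and> R C C')" for C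
  have \<Phi>: "\<Phi> C \<in> colorings X \<sigma> D' \<and> R C (\<Phi> C)" if "C \<in> colorings X \<sigma> D" for C
    unfolding \<Phi>_def using assms(2)[OF that] by (rule theI')
  have "inj_on \<Phi> (colorings X \<sigma> D)"
  proof (rule inj_onI)
    fix C1 C2
    assume C: "C1 \<in> colorings X \<sigma> D" "C2 \<in> colorings X \<sigma> D" "\<Phi> C1 = \<Phi> C2"
    have "\<exists>!C. C \<in> colorings X \<sigma> D \<and> R C (\<Phi> C1)"
      using \<Phi>[OF C(1)] assms(3) by blast
    then show "C1 = C2"
      using \<Phi>[OF C(1)] \<Phi>[OF C(2)] C by (elim ex1E) metis
  qed
  moreover have "\<Phi> ` colorings X \<sigma> D = colorings X \<sigma> D'"
  proof (intro equalityI subsetI)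
    fix C' assume C': "C' \<in> colorings X \<sigma> D'"
    obtain C where C: "C \<in> colorings X \<sigma> D" "R C C'"
      using assms(3)[OF C'] by blast
    have "\<Phi> C = C'"
      using \<Phi>[OF C(1)] assms(2)[OF C(1)] C' C(2) by (elim ex1E) metis
    then show "C' \<in> \<Phi> ` colorings X \<sigma> D"
      using C(1) by blast
  qed (use \<Phi> in auto)
  ultimately show ?thesis
    unfolding same_invariant_def using assms(1,4) \<Phi>
    by (intro conjI exI[of _ \<Phi>]) (auto simp: bij_betw_def)
qed

lemma same_invariant_conclusion:
  assumes "same_invariant D D'" "gauss_code D" "gauss_code D'"
  shows "length D' = length D"
    and "\<exists>\<Phi>. bij_betw \<Phi> (colorings X \<sigma> D) (colorings X \<sigma> D') \<and>
      (\<forall>b b'. \<forall>C \<in> colorings X \<sigma> D. \<forall>i < length D.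
        conj_class H (Psi X \<sigma> H f D' b' (\<Phi> C) i) = conj_class H (Psi X \<sigma> H f D b C i))"
    and "conj_invariant X \<sigma> H f D' b' = conj_invariant X \<sigma> H f D b"
proof -
  obtain \<Phi> where len: "length D' = length D"
    and \<Phi>: "bij_betw \<Phi> (colorings X \<sigma> D) (colorings X \<sigma> D')"
    and eq: "\<And>C i. C \<in> colorings X \<sigma> D \<Longrightarrow> i < length D \<Longrightarrow>
        component_class D' (\<Phi> C) i = component_class D C i"
    using assms(1) by (auto simp: same_invariant_def)
  have Psi: "conj_class H (Psi X \<sigma> H f D' b' (\<Phi> C) i) = conj_class H (Psi X \<sigma> H f D b C i)"
    if "C \<in> colorings X \<sigma> D" "i < length D" for b b' C i
    using eq[OF that] that len bij_betw_apply[OF \<Phi>] assms(2,3) by (simp add: conj_class_Psi)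
  show "length D' = length D"
    by (rule len)
  show "\<exists>\<Phi>. bij_betw \<Phi> (colorings X \<sigma> D) (colorings X \<sigma> D') \<and>
      (\<forall>b b'. \<forall>C \<in> colorings X \<sigma> D. \<forall>i < length D.
        conj_class H (Psi X \<sigma> H f D' b' (\<Phi> C) i) = conj_class H (Psi X \<sigma> H f D b C i))"
    using \<Phi> Psi by blast
  have colorings: "colorings X \<sigma> D' = \<Phi> ` colorings X \<sigma> D"
    using \<Phi> by (simp add: bij_betw_def)
  have "conj_invariant X \<sigma> H f D' b' =
      {conj_class H (Psi X \<sigma> H f D' b' (\<Phi> C) i) | i C. i < length D \<and> C \<in> colorings X \<sigma> D}"
    unfolding conj_invariant_def len colorings by blast
  also have "\<dots> = conj_invariant X \<sigma> H f D b"
    unfolding conj_invariant_def using Psi by blast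
  finally show "conj_invariant X \<sigma> H f D' b' = conj_invariant X \<sigma> H f D b" .
qed

end

section \<open>Moves that remove crossings\<close>

context adjacent_pairs
begin

lemma conj_class_pairs:
  assumes "group G" "i < length D"
    and "\<And>p. p \<in> P \<Longrightarrow> g p \<otimes>\<^bsub>G\<^esub> g (nx p) = h p \<otimes>\<^bsub>G\<^esub> h (nx p)"
    and "\<And>p. p \<in> passages D \<Longrightarrow> p \<notin> P \<Longrightarrow> p \<notin> nx ` P \<Longrightarrow> g p = h p"
    and "\<And>p. p \<in> passages D \<Longrightarrow> g p \<in> carrier G \<and> h p \<in> carrier G"
  shows "conj_class G (group.product_along G g (D ! i)) = conj_class G (group.product_along G h (D ! i))"
proof (rule group.conj_class_product_along_pairs[OF assms(1), where nx = nx and P = P])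
  have K: "D ! i \<in> set D" "set (D ! i) \<subseteq> passages D"
    using assms(2) component_passages by auto
  show "distinct (D ! i)"
    using distinct K(1) by (simp add: distinct_concat_iff)
  show "nx p = cycle_of_list (D ! i) p" if "p \<in> set (D ! i)" for p
    using next_passage_component[OF distinct K(1) that] .
  show "nx p \<in> set (D ! i) \<longleftrightarrow> p \<in> set (D ! i)" for p
    using next_passage_in_component[OF distinct assms(2)] .
  show "g p = h p" if "p \<in> set (D ! i)" "p \<notin> P" "p \<notin> nx ` P" for p
    using assms(4) that K(2) by blast
  show "g p \<in> carrier G \<and> h p \<in> carrier G" if "p \<in> set (D ! i)" for p
    using assms(5) that K(2) by blast
qed (use assms(3) inj_next_passage disjoint in simp_all)

end

context cocycle_on
begin

text \<open>
  Local criterion for the first two moves.  After the removal a coloring \<open>C'\<close> spreads over the entries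
  of the larger diagram as \<open>C' \<circ> collapse\<close>, and the hypothesis on the interior colors extends it uniquely
  to the pairs.  For the weights, the smaller diagram is viewed as the larger one with weight \<open>\<one>\<close> on the
  removed passages.
\<close>

lemma removal_invariant:
  assumes "removal D P A" and D: "gauss_code D"
    and straight: "\<And>C. C \<in> colorings X \<sigma> D \<Longrightarrow> adjacent_pairs.straight D P C"
    and interior: "\<And>C. C \<in> semi_arcs D \<rightarrow>\<^sub>E X \<Longrightarrow> adjacent_pairs.straight D P C \<Longrightarrow>
      \<exists>!C1. C1 \<in> semi_arcs D \<rightarrow>\<^sub>E X \<and> (\<forall>a \<in> adjacent_pairs.entries D P. C1 a = C a) \<and>
        (\<forall>c \<in> A. colored (incoming C1) (outgoing D C1) c)"
    and trivial: "\<And>C p. C \<in> colorings X \<sigma> D \<Longrightarrow> p \<in> P \<Longrightarrow>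
      passage_weight (incoming C) (outgoing D C) p \<otimes>\<^bsub>H\<^esub>
      passage_weight (incoming C) (outgoing D C) (next_passage D p) = \<one>\<^bsub>H\<^esub>"
    and A: "A \<subseteq> crossings D"
  shows "same_invariant D (remove_crossings A D)"
proof -
  interpret removal D P A by fact
  have crossings': "crossings D' = crossings D - A"
    unfolding crossings_def passages_removed by (auto simp: image_iff)
  have D': "gauss_code D'"
    using distinct_removed D unfolding gauss_code_def crossings' passages_removed by auto
  define R where "R C C' \<longleftrightarrow> (\<forall>a \<in> entries. C a = C' (collapse a))" for C C' :: "semi_arc \<Rightarrow> 'x"
  have same_colors: "incoming C p = incoming C' p" "outgoing D C p = outgoing D' C' p"
    if "R C C'" "p \<in> passages D'" for C C' p
  proof -
    have p: "p \<in> passages D" "fst p \<notin> A"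
      using that(2) by (simp_all add: passages_removed)
    show "incoming C p = incoming C' p"
      using that(1) remaining_entry[OF p] collapse_remaining[OF p(2)]
      by (simp add: R_def incoming_def del: collapse.simps)
    show "outgoing D C p = outgoing D' C' p"
      using that(1) next_remaining_entry[OF p] collapse_next[OF that(2)]
      by (simp add: R_def outgoing_def del: collapse.simps)
  qed
  have same_colored: "colored (incoming C) (outgoing D C) c \<longleftrightarrow> colored (incoming C') (outgoing D' C') c"
    if "R C C'" "c \<in> crossings D'" for C C' c
    using same_colors[OF that(1) strands_in_passages[OF D' that(2)]] by (simp add: colored_def)
  show ?thesis
  proof (rule same_invariantI[where R = R])
    show "length D' = length D"
      by (simp add: remove_crossings_def)
  next
    fix C assume C: "C \<in> colorings X \<sigma> D"
    have CX: "C \<in> semi_arcs D \<rightarrow>\<^sub>E X"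
      using coloringD(1)[OF D C] .
    define pick where "pick b = (SOME a. a \<in> entries \<and> collapse a = b)" for b
    have pick: "pick b \<in> entries \<and> collapse (pick b) = b" if "b \<in> semi_arcs D'" for b
      unfolding pick_def by (rule someI_ex) (use collapse_onto[OF that] in blast)
    define C' where "C' = restrict (\<lambda>b. C (pick b)) (semi_arcs D')"
    have R: "R C C'"
      unfolding R_def
    proof
      fix a assume a: "a \<in> entries"
      then have "collapse a \<in> semi_arcs D'"
        using collapse_in_semi_arcs by (simp add: entries_def)
      then show "C a = C' (collapse a)"
        using straight_collapse[OF straight[OF C] a] pick by (simp add: C'_def)
    qed
    have "C' \<in> semi_arcs D' \<rightarrow>\<^sub>E X"
      using pick CX by (auto simp: C'_def entries_def)
    then have "C' \<in> colorings X \<sigma> D'"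
      using same_colored[OF R] coloringD(2)[OF D C] by (simp add: colorings_iff[OF D'] crossings')
    moreover have "C'' = C'" if "C'' \<in> colorings X \<sigma> D'" "R C C''" for C''
    proof (rule PiE_ext[OF coloringD(1)[OF D' that(1)] \<open>C' \<in> semi_arcs D' \<rightarrow>\<^sub>E X\<close>])
      fix b assume "b \<in> semi_arcs D'"
      then show "C'' b = C' b"
        using pick R that(2) unfolding R_def by metis
    qed
    ultimately show "\<exists>!C'. C' \<in> colorings X \<sigma> D' \<and> R C C'"
      using R by blast
  next
    fix C' assume C': "C' \<in> colorings X \<sigma> D'"
    define C0 where "C0 = restrict (\<lambda>a. C' (collapse a)) (semi_arcs D)"
    have C0: "C0 \<in> semi_arcs D \<rightarrow>\<^sub>E X"
      using collapse_in_semi_arcs coloringD(1)[OF D' C'] by (auto simp: C0_def)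
    have "straight C0"
      unfolding straight_def
    proof
      fix p assume p: "p \<in> P"
      then have "Into p \<in> semi_arcs D" "Into (nx (nx p)) \<in> semi_arcs D"
        using first by (auto simp: semi_arcs_def)
      then show "C0 (Into p) = C0 (Into (nx (nx p)))"
        using collapse_pair[OF p] by (simp add: C0_def del: collapse.simps)
    qed
    have R_iff: "R C C' \<longleftrightarrow> (\<forall>a \<in> entries. C a = C0 a)" for C
      by (auto simp: R_def C0_def entries_def)
    have iff: "C \<in> colorings X \<sigma> D \<and> R C C' \<longleftrightarrow>
        C \<in> semi_arcs D \<rightarrow>\<^sub>E X \<and> (\<forall>a \<in> entries. C a = C0 a) \<and>
        (\<forall>c \<in> A. colored (incoming C) (outgoing D C) c)" for C
      using same_colored[of C C'] coloringD(2)[OF D' C'] A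
      unfolding colorings_iff[OF D] R_iff[symmetric] crossings' by blast
    show "\<exists>!C. C \<in> colorings X \<sigma> D \<and> R C C'"
      unfolding iff by (rule interior[OF C0 \<open>straight C0\<close>])
  next
    fix C C' i
    assume C: "C \<in> colorings X \<sigma> D" and C': "C' \<in> colorings X \<sigma> D'" and "R C C'" and i: "i < length D"
    let ?g = "passage_weight (incoming C) (outgoing D C)"
    let ?g' = "passage_weight (incoming C') (outgoing D' C')"
    \<comment> \<open>the weights of the smaller diagram, extended by one to the removed passages\<close>
    let ?h = "\<lambda>p. if fst p \<notin> A then ?g' p else \<one>\<^bsub>H\<^esub>"
    have g': "?g p = ?g' p" "?g' p \<in> carrier H" if "p \<in> passages D" "fst p \<notin> A" for p
    proof -
      have p: "p \<in> passages D'"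
        using that by (simp add: passages_removed)
      then have "(fst p, t) \<in> passages D'" for t
        using strands_in_passages[OF D'] by (auto simp: crossings_def)
      then show "?g p = ?g' p"
        using same_colors[OF \<open>R C C'\<close>] by (intro passage_weight_cong) blast+
      show "?g' p \<in> carrier H"
        using coloring_weight_carrier[OF D' C' p] .
    qed
    have comp: "set (D ! i) \<subseteq> passages D"
      using i by (rule component_passages)
    have "product_along ?g' (D' ! i) = product_along ?g' (filter (\<lambda>p. fst p \<notin> A) (D ! i))"
      using i by (simp add: remove_crossings_def)
    also have "\<dots> = product_along ?h (D ! i)"
    proof -
      have "product_along ?g' (filter (\<lambda>p. fst p \<notin> A) (D ! i)) =
          product_along ?h (filter (\<lambda>p. fst p \<notin> A) (D ! i))"
        by (rule product_along_cong) simp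
      also have "\<dots> = product_along (\<lambda>p. if fst p \<notin> A then ?h p else \<one>\<^bsub>H\<^esub>) (D ! i)"
        using comp g' by (intro product_along_filter) auto
      also have "\<dots> = product_along ?h (D ! i)"
        by (rule product_along_cong) simp
      finally show ?thesis .
    qed
    finally have *: "product_along ?g' (D' ! i) = product_along ?h (D ! i)" .
    show "component_class D' C' i = component_class D C i"
      unfolding component_class_def *
    proof (rule conj_class_pairs[OF group_axioms i, symmetric])
      fix p assume p: "p \<in> P"
      then have "fst p \<in> A" "fst (nx p) \<in> A"
        using removed by auto
      then show "?g p \<otimes>\<^bsub>H\<^esub> ?g (nx p) = ?h p \<otimes>\<^bsub>H\<^esub> ?h (nx p)"
        using trivial[OF C p] by simp
    next
      fix p assume p: "p \<in> passages D"
      then show "?g p \<in> carrier H \<and> ?h p \<in> carrier H"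
        using coloring_weight_carrier[OF D C p] g' by simp
      assume "p \<notin> P" "p \<notin> nx ` P"
      then show "?g p = ?h p"
        using g'(1)[OF p] removed_iff[OF p] by simp
    qed
  qed
qed

end

section \<open>Moves that rename passages\<close>

locale relabelling = adjacent_pairs +
  fixes D' :: code and \<rho> :: "passage \<Rightarrow> passage"
  assumes distinct': "distinct (concat D')"
    and inj_\<rho>: "inj_on \<rho> (passages D)"
    and relabelled: "list_all2 (\<lambda>K K'. \<exists>n. K' = rotate n (map \<rho> K)) D D'"
begin

lemma length_relabelled: "length D' = length D"
  using relabelled by (simp add: list_all2_lengthD)

lemma nth_relabelled:
  assumes "i < length D"
  obtains n where "D' ! i = rotate n (map \<rho> (D ! i))"
  using relabelled assms by (auto simp: list_all2_conv_all_nth)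

lemma set_relabelled: "i < length D \<Longrightarrow> set (D' ! i) = \<rho> ` set (D ! i)"
  by (erule nth_relabelled) simp

lemma passages_relabelled: "passages D' = \<rho> ` passages D"
proof (intro equalityI subsetI)
  fix q assume "q \<in> passages D'"
  then obtain i where "i < length D'" "q \<in> set (D' ! i)"
    by (rule component_of_passage)
  then have "i < length D" "q \<in> \<rho> ` set (D ! i)"
    using set_relabelled length_relabelled by simp_all
  then show "q \<in> \<rho> ` passages D"
    using image_mono[OF component_passages[of i D]] by (metis subsetD)
next
  fix q assume "q \<in> \<rho> ` passages D"
  then obtain p where p: "p \<in> passages D" "q = \<rho> p"
    by blast
  obtain i where "i < length D" "p \<in> set (D ! i)"
    using p(1) by (rule component_of_passage)
  then have "q \<in> set (D' ! i)" "i < length D'"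
    using set_relabelled length_relabelled p(2) by simp_all
  then show "q \<in> passages D'"
    using component_passages[of i D'] by (metis subsetD)
qed

lemma next_relabelled:
  assumes "p \<in> passages D"
  shows "next_passage D' (\<rho> p) = \<rho> (nx p)"
proof -
  obtain i where i: "i < length D" "p \<in> set (D ! i)"
    using assms by (rule component_of_passage)
  obtain n where n: "D' ! i = rotate n (map \<rho> (D ! i))"
    using i(1) by (rule nth_relabelled)
  have K: "D ! i \<in> set D" "D' ! i \<in> set D'" "\<rho> p \<in> set (D' ! i)"
    using i length_relabelled by (simp_all add: set_relabelled)
  have "distinct (D ! i)" "distinct (D' ! i)"
    using K distinct distinct' by (simp_all add: distinct_concat_iff)
  then have d: "distinct (D ! i)" "distinct (map \<rho> (D ! i))"
    unfolding n by simp_all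
  obtain j where j: "j < length (D ! i)" "p = D ! i ! j"
    using i(2) by (auto simp: in_set_conv_nth)
  have "next_passage D' (\<rho> p) = cycle_of_list (map \<rho> (D ! i)) (\<rho> p)"
    using next_passage_component[OF distinct' K(2,3)]
      cycle_of_list_rotate_independent[OF d(2), of n] n by simp
  also have "\<dots> = \<rho> (cycle_of_list (D ! i) p)"
  proof -
    have "Suc j mod length (D ! i) < length (D ! i)"
      using j(1) by (intro mod_less_divisor) auto
    then show ?thesis
      using cycle_of_list_nth[OF d(2), of j] cycle_of_list_nth[OF d(1), of j] j by simp
  qed
  also have "\<dots> = \<rho> (nx p)"
    using next_passage_component[OF distinct K(1) i(2)] by simp
  finally show ?thesis .
qed

text \<open>
  The third move exchanges the two passages of each pair.  So after the move the place of a passage in the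
  list is that of another passage before the move; \<open>\<rho>\<close> sends the old passage in a place to the new one, and
  \<open>origin\<close> the new one to the old one.
\<close>

definition origin :: "passage \<Rightarrow> passage" where
  "origin = inv_into (passages D) \<rho>"

lemma origin_\<rho>: "p \<in> passages D \<Longrightarrow> origin (\<rho> p) = p"
  by (simp add: origin_def inj_\<rho>)

lemma \<rho>_origin: "p \<in> passages D' \<Longrightarrow> \<rho> (origin p) = p" "p \<in> passages D' \<Longrightarrow> origin p \<in> passages D"
  unfolding origin_def passages_relabelled by (simp_all add: f_inv_into_f inv_into_into)

fun relabel :: "semi_arc \<Rightarrow> semi_arc" where
  "relabel (Into p) = Into (\<rho> p)"
| "relabel (Circle i) = Circle i"

lemma relabel_bij: "bij_betw relabel (semi_arcs D) (semi_arcs D')"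
proof (rule bij_betwI')
  have inj: "\<rho> p = \<rho> q \<longleftrightarrow> p = q" if "p \<in> passages D" "q \<in> passages D" for p q
    using inj_\<rho> that by (meson inj_onD)
  show "relabel a = relabel b \<longleftrightarrow> a = b" if "a \<in> semi_arcs D" "b \<in> semi_arcs D" for a b
    using that inj by (cases a; cases b) (simp_all add: semi_arcs_def image_iff)
  have nil: "D' ! i = [] \<longleftrightarrow> D ! i = []" if "i < length D" for i
    using set_relabelled[OF that] by (metis image_is_empty set_empty)
  show "relabel a \<in> semi_arcs D'" if "a \<in> semi_arcs D" for a
    using that nil by (cases a) (auto simp: semi_arcs_def passages_relabelled length_relabelled)
  show "\<exists>a \<in> semi_arcs D. b = relabel a" if b: "b \<in> semi_arcs D'" for b
  proof (cases b)
    case (Into p)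
    then have "p \<in> passages D'"
      using b by (auto simp: semi_arcs_def)
    then show ?thesis
      using Into \<rho>_origin by (intro bexI[of _ "Into (origin p)"]) (simp_all add: semi_arcs_def)
  next
    case (Circle i)
    then show ?thesis
      using b nil by (intro bexI[of _ "Circle i"]) (auto simp: semi_arcs_def length_relabelled)
  qed
qed

text \<open>
  Reading a coloring of the new diagram on the semi-arcs in the same place of the old one makes
  colorings of both diagrams functions on the same set.
\<close>

definition pull :: "(semi_arc \<Rightarrow> 'x) \<Rightarrow> semi_arc \<Rightarrow> 'x" where
  "pull C' = restrict (C' \<circ> relabel) (semi_arcs D)"

lemma pull_bij:
  "bij_betw pull (semi_arcs D' \<rightarrow>\<^sub>E X) (semi_arcs D \<rightarrow>\<^sub>E X)"
proof (rule bij_betw_byWitness)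
  let ?inv = "inv_into (semi_arcs D) relabel"
  let ?push = "\<lambda>C. restrict (C \<circ> ?inv) (semi_arcs D')"
  have 1: "?inv (relabel a) = a" if "a \<in> semi_arcs D" for a
    using bij_betw_inv_into_left[OF relabel_bij that] .
  have 2: "relabel (?inv b) = b" if "b \<in> semi_arcs D'" for b
    using bij_betw_inv_into_right[OF relabel_bij that] .
  have 3: "relabel a \<in> semi_arcs D'" if "a \<in> semi_arcs D" for a
    using bij_betw_apply[OF relabel_bij that] .
  have 4: "?inv b \<in> semi_arcs D" if "b \<in> semi_arcs D'" for b
    using bij_betw_apply[OF bij_betw_inv_into[OF relabel_bij] that] .
  show "\<forall>C' \<in> semi_arcs D' \<rightarrow>\<^sub>E X. ?push (pull C') = C'"
  proof
    fix C' assume C': "C' \<in> semi_arcs D' \<rightarrow>\<^sub>E X"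
    show "?push (pull C') = C'"
    proof
      fix b show "?push (pull C') b = C' b"
        using 2 4 PiE_arb[OF C'] by (cases "b \<in> semi_arcs D'") (simp_all add: pull_def)
    qed
  qed
  show "\<forall>C \<in> semi_arcs D \<rightarrow>\<^sub>E X. pull (?push C) = C"
  proof
    fix C assume C: "C \<in> semi_arcs D \<rightarrow>\<^sub>E X"
    show "pull (?push C) = C"
    proof
      fix a show "pull (?push C) a = C a"
        using 1 3 PiE_arb[OF C] by (cases "a \<in> semi_arcs D") (simp_all add: pull_def)
    qed
  qed
  show "pull ` (semi_arcs D' \<rightarrow>\<^sub>E X) \<subseteq> semi_arcs D \<rightarrow>\<^sub>E X"
  proof (rule image_subsetI)
    fix C' assume C': "C' \<in> semi_arcs D' \<rightarrow>\<^sub>E X"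
    show "pull C' \<in> semi_arcs D \<rightarrow>\<^sub>E X"
      unfolding pull_def restrict_PiE_iff using 3 PiE_mem[OF C'] by simp
  qed
  show "?push ` (semi_arcs D \<rightarrow>\<^sub>E X) \<subseteq> semi_arcs D' \<rightarrow>\<^sub>E X"
  proof (rule image_subsetI)
    fix C assume C: "C \<in> semi_arcs D \<rightarrow>\<^sub>E X"
    show "?push C \<in> semi_arcs D' \<rightarrow>\<^sub>E X"
      unfolding restrict_PiE_iff using 4 PiE_mem[OF C] by simp
  qed
qed

lemma pull_incoming: "p \<in> passages D' \<Longrightarrow> incoming C' p = incoming (pull C') (origin p)"
  using \<rho>_origin by (simp add: pull_def incoming_def semi_arcs_def)

lemma pull_outgoing: "p \<in> passages D' \<Longrightarrow> outgoing D' C' p = outgoing D (pull C') (origin p)"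
  using \<rho>_origin next_relabelled[of "origin p"] by (simp add: pull_def outgoing_def semi_arcs_def)

end

context cocycle_on
begin

text \<open>
  Local criterion for the third move.  In terms of the semi-arcs of the old diagram the new one has the
  same successor function, but other passages meet at a crossing; this is what the composition with
  \<open>origin\<close> expresses.
\<close>

lemma relabelling_invariant:
  assumes "relabelling D P D' \<rho>" and D: "gauss_code D" and D': "gauss_code D'"
  defines "pulled C \<equiv> C \<in> semi_arcs D \<rightarrow>\<^sub>E X \<and>
    (\<forall>c \<in> crossings D'. colored (incoming C \<circ> relabelling.origin D \<rho>)
      (outgoing D C \<circ> relabelling.origin D \<rho>) c)"
  defines "agree C1 C2 \<equiv> \<forall>a \<in> adjacent_pairs.entries D P. C1 a = C2 a"
  assumes forth: "\<And>C. C \<in> colorings X \<sigma> D \<Longrightarrow> \<exists>!C''. pulled C'' \<and> agree C C''"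
    and pulled_back: "\<And>C''. pulled C'' \<Longrightarrow> \<exists>!C. C \<in> colorings X \<sigma> D \<and> agree C C''"
    and weight_pair: "\<And>C C'' p. C \<in> colorings X \<sigma> D \<Longrightarrow> pulled C'' \<Longrightarrow> agree C C'' \<Longrightarrow> p \<in> P \<Longrightarrow>
      passage_weight (incoming C) (outgoing D C) p \<otimes>\<^bsub>H\<^esub>
      passage_weight (incoming C) (outgoing D C) (next_passage D p) =
      passage_weight (incoming C'' \<circ> relabelling.origin D \<rho>) (outgoing D C'' \<circ> relabelling.origin D \<rho>) (\<rho> p) \<otimes>\<^bsub>H\<^esub>
      passage_weight (incoming C'' \<circ> relabelling.origin D \<rho>) (outgoing D C'' \<circ> relabelling.origin D \<rho>)
        (\<rho> (next_passage D p))"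
    and weight_other: "\<And>C C'' p. C \<in> colorings X \<sigma> D \<Longrightarrow> pulled C'' \<Longrightarrow> agree C C'' \<Longrightarrow>
      p \<in> passages D \<Longrightarrow> p \<notin> P \<Longrightarrow> p \<notin> next_passage D ` P \<Longrightarrow>
      passage_weight (incoming C) (outgoing D C) p =
      passage_weight (incoming C'' \<circ> relabelling.origin D \<rho>) (outgoing D C'' \<circ> relabelling.origin D \<rho>) (\<rho> p)"
  shows "same_invariant D D'"
proof -
  interpret relabelling D P D' \<rho> by fact
  have strands: "(c, t) \<in> passages D'" if "c \<in> crossings D'" for c t
    using strands_in_passages[OF D' that] .
  have pulled_iff: "C' \<in> colorings X \<sigma> D' \<longleftrightarrow> pulled (pull C')" if C': "C' \<in> semi_arcs D' \<rightarrow>\<^sub>E X" for C'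
  proof -
    have "colored (incoming C') (outgoing D' C') c \<longleftrightarrow>
        colored (incoming (pull C') \<circ> relabelling.origin D \<rho>) (outgoing D (pull C') \<circ> relabelling.origin D \<rho>) c"
      if "c \<in> crossings D'" for c
      using strands[OF that] by (simp add: colored_def pull_incoming pull_outgoing)
    moreover have "pull C' \<in> semi_arcs D \<rightarrow>\<^sub>E X"
      using bij_betw_apply[OF pull_bij C'] .
    ultimately show ?thesis
      using C' by (simp add: colorings_iff[OF D'] pulled_def)
  qed
  have pull_col: "\<exists>!C'. C' \<in> colorings X \<sigma> D' \<and> pull C' = C''" if "pulled C''" for C''
  proof -
    have "C'' \<in> pull ` (semi_arcs D' \<rightarrow>\<^sub>E X)"
      using that bij_betw_imp_surj_on[OF pull_bij, of X] by (simp add: pulled_def)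
    then obtain C' where C': "C' \<in> semi_arcs D' \<rightarrow>\<^sub>E X" "pull C' = C''"
      by (metis imageE)
    show ?thesis
    proof (rule ex1I[of _ C'])
      show "C' \<in> colorings X \<sigma> D' \<and> pull C' = C''"
        using C' that pulled_iff by simp
      show "C1 = C'" if "C1 \<in> colorings X \<sigma> D' \<and> pull C1 = C''" for C1
        using that C' coloringD(1)[OF D', of C1]
          inj_onD[OF bij_betw_imp_inj_on[OF pull_bij, of X], of C1 C'] by simp
    qed
  qed
  show ?thesis
  proof (rule same_invariantI[where R = "\<lambda>C C'. agree C (pull C')"])
    show "length D' = length D"
      by (rule length_relabelled)
  next
    fix C assume C: "C \<in> colorings X \<sigma> D"
    obtain C'' where C'': "pulled C''" "agree C C''"
      and unique: "\<And>C1. pulled C1 \<Longrightarrow> agree C C1 \<Longrightarrow> C1 = C''"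
      using forth[OF C] by blast
    have "C' \<in> colorings X \<sigma> D' \<and> agree C (pull C') \<longleftrightarrow> C' \<in> colorings X \<sigma> D' \<and> pull C' = C''" for C'
      using C'' unique pulled_iff coloringD(1)[OF D'] by blast
    then show "\<exists>!C'. C' \<in> colorings X \<sigma> D' \<and> agree C (pull C')"
      using pull_col[OF C''(1)] by simp
  next
    fix C' assume "C' \<in> colorings X \<sigma> D'"
    then show "\<exists>!C. C \<in> colorings X \<sigma> D \<and> agree C (pull C')"
      using pulled_back pulled_iff coloringD(1)[OF D'] by blast
  next
    fix C C' i
    assume C: "C \<in> colorings X \<sigma> D" and C': "C' \<in> colorings X \<sigma> D'" and agree: "agree C (pull C')"
      and i: "i < length D"
    have pulled: "pulled (pull C')"
      using C' pulled_iff coloringD(1)[OF D'] by blast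
    let ?g = "passage_weight (incoming C) (outgoing D C)"
    let ?g' = "passage_weight (incoming C') (outgoing D' C')"
    let ?h = "passage_weight (incoming (pull C') \<circ> relabelling.origin D \<rho>)
      (outgoing D (pull C') \<circ> relabelling.origin D \<rho>)"
    have h: "?g' p = ?h p" if "p \<in> passages D'" for p
    proof -
      have "(fst p, t) \<in> passages D'" for t
        using that strands by (auto simp: crossings_def)
      then show ?thesis
        by (intro passage_weight_cong) (simp_all add: pull_incoming pull_outgoing)
    qed
    have comp: "set (D ! i) \<subseteq> passages D" "set (D' ! i) \<subseteq> passages D'"
      using i component_passages length_relabelled by simp_all
    obtain n where n: "D' ! i = rotate n (map \<rho> (D ! i))"
      using i by (rule nth_relabelled)
    have "conj_class H (product_along ?g' (D' ! i)) = conj_class H (product_along ?g' (map \<rho> (D ! i)))"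
      unfolding n using comp(2) coloring_weight_carrier[OF D' C']
      by (intro conj_class_product_along_rotate) (auto simp: n)
    also have "product_along ?g' (map \<rho> (D ! i)) = product_along (?h \<circ> \<rho>) (D ! i)"
      unfolding product_along_map
    proof (rule product_along_cong)
      fix p assume "p \<in> set (D ! i)"
      then have "\<rho> p \<in> passages D'"
        using comp(1) by (auto simp only: passages_relabelled)
      then show "(?g' \<circ> \<rho>) p = (?h \<circ> \<rho>) p"
        using h by simp
    qed
    also have "conj_class H (product_along (?h \<circ> \<rho>) (D ! i)) = conj_class H (product_along ?g (D ! i))"
    proof (rule conj_class_pairs[OF group_axioms i, symmetric])
      show "?g p \<otimes>\<^bsub>H\<^esub> ?g (nx p) = (?h \<circ> \<rho>) p \<otimes>\<^bsub>H\<^esub> (?h \<circ> \<rho>) (nx p)" if "p \<in> P" for p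
        using weight_pair[OF C pulled agree that] by simp
      show "?g p = (?h \<circ> \<rho>) p" if "p \<in> passages D" "p \<notin> P" "p \<notin> nx ` P" for p
        using weight_other[OF C pulled agree that] by simp
      show "?g p \<in> carrier H \<and> (?h \<circ> \<rho>) p \<in> carrier H" if p: "p \<in> passages D" for p
      proof -
        have "\<rho> p \<in> passages D'"
          using p by (simp add: passages_relabelled)
        then show ?thesis
          using coloring_weight_carrier[OF D C p] coloring_weight_carrier[OF D' C', of "\<rho> p"] h by simp
      qed
    qed
    finally show "component_class D' C' i = component_class D C i"
      unfolding component_class_def .
  qed
qed

end

section \<open>Change of names and the first move\<close>

lemma moved_in_passages: "next_passage D p \<noteq> p \<Longrightarrow> p \<in> passages D"
  using permutes_not_in[OF next_passage_permutes] by blast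

lemma passages_of_crossings:
  assumes "gauss_code D" "A \<subseteq> crossings D"
  shows "{p \<in> passages D. fst p \<in> A} = A \<times> {Over, Under}"
  using assms unfolding gauss_code_def by auto

context adjacent_pairs
begin

text \<open>
  The passage \<open>p\<close> can be recovered from the semi-arc inside its pair because the successor function is
  injective; so \<open>z\<close> prescribes the interior colors independently of each other.
\<close>

definition fill :: "(semi_arc \<Rightarrow> 'x) \<Rightarrow> (passage \<Rightarrow> 'x) \<Rightarrow> semi_arc \<Rightarrow> 'x" where
  "fill C z a = (if a \<in> entries \<or> a \<notin> semi_arcs D then C a else z (SOME p. p \<in> P \<and> a = Into (nx p)))"

lemma fill_entry: "a \<in> entries \<Longrightarrow> fill C z a = C a"
  by (simp add: fill_def)

lemma fill_second:
  assumes "p \<in> P"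
  shows "fill C z (Into (nx p)) = z p"
proof -
  have "Into (nx p) \<notin> entries" "Into (nx p) \<in> semi_arcs D"
    using assms first by (auto simp: Into_entries semi_arcs_def)
  moreover have "(SOME q. q \<in> P \<and> Into (nx p) = Into (nx q)) = p"
    using assms inj_eq[OF inj_next_passage[of D]] by (intro some_equality) simp_all
  ultimately show ?thesis
    by (simp add: fill_def)
qed

lemma fill_in:
  assumes "C \<in> semi_arcs D \<rightarrow>\<^sub>E X" "\<And>p. p \<in> P \<Longrightarrow> z p \<in> X"
  shows "fill C z \<in> semi_arcs D \<rightarrow>\<^sub>E X"
proof (rule PiE_I)
  fix a assume a: "a \<in> semi_arcs D"
  then consider "a \<in> entries" | p where "p \<in> P" "a = Into (nx p)"
    unfolding entries_def by blast
  then show "fill C z a \<in> X"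
    using assms PiE_mem[OF assms(1) a] by cases (simp_all add: fill_entry fill_second)
next
  fix a assume "a \<notin> semi_arcs D"
  then show "fill C z a = undefined"
    using PiE_arb[OF assms(1)] by (simp add: fill_def)
qed

lemma first_entry: "p \<in> P \<Longrightarrow> Into p \<in> entries"
  using first disjoint by (auto simp: Into_entries)

lemma after_entry: "p \<in> P \<Longrightarrow> Into (nx (nx p)) \<in> entries"
  using first second_not_first[of p] by (auto simp: Into_entries inj_image_mem_iff[OF inj_next_passage])

lemma pair_colors:
  assumes "\<And>a. a \<in> entries \<Longrightarrow> C1 a = C a" "p \<in> P"
  shows "incoming C1 p = C (Into p)" "outgoing D C1 p = C1 (Into (nx p))"
    "incoming C1 (nx p) = C1 (Into (nx p))" "outgoing D C1 (nx p) = C (Into (nx (nx p)))"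
  using assms first_entry after_entry by (auto simp: incoming_def outgoing_def)

lemma straightI:
  assumes "\<And>p. p \<in> P \<Longrightarrow> outgoing D C (nx p) = incoming C p"
  shows "straight C"
  using assms by (auto simp: straight_def incoming_def outgoing_def)

lemma ex1_interior:
  assumes C: "C \<in> semi_arcs D \<rightarrow>\<^sub>E X" and z: "\<And>p. p \<in> P \<Longrightarrow> z p \<in> X" and Q: "Q (fill C z)"
    and unique: "\<And>C1 p. C1 \<in> semi_arcs D \<rightarrow>\<^sub>E X \<Longrightarrow> (\<And>a. a \<in> entries \<Longrightarrow> C1 a = C a) \<Longrightarrow> Q C1 \<Longrightarrow>
      p \<in> P \<Longrightarrow> C1 (Into (nx p)) = z p"
  shows "\<exists>!C1. C1 \<in> semi_arcs D \<rightarrow>\<^sub>E X \<and> (\<forall>a \<in> entries. C1 a = C a) \<and> Q C1"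
proof (rule ex1I[of _ "fill C z"])
  have fill: "fill C z \<in> semi_arcs D \<rightarrow>\<^sub>E X"
    using C z by (rule fill_in)
  then show "fill C z \<in> semi_arcs D \<rightarrow>\<^sub>E X \<and> (\<forall>a \<in> entries. fill C z a = C a) \<and> Q (fill C z)"
    using Q by (simp add: fill_entry)
  fix C1 assume C1: "C1 \<in> semi_arcs D \<rightarrow>\<^sub>E X \<and> (\<forall>a \<in> entries. C1 a = C a) \<and> Q C1"
  show "C1 = fill C z"
  proof (rule colors_eqI[OF _ fill])
    show "C1 (Into (nx p)) = fill C z (Into (nx p))" if "p \<in> P" for p
      using unique[of C1 p] C1 that by (simp add: fill_second)
  qed (use C1 in \<open>simp_all add: fill_entry\<close>)
qed

end

context cocycle_on
begin

text \<open>
  Nothing is touched, so this is the case without pairs of the criterion for renaming.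
\<close>

lemma same_diagram_invariant:
  assumes D: "gauss_code D" and D': "gauss_code D'" and same: "same_diagram D D'"
  shows "same_invariant D D'"
proof -
  obtain g where g: "inj_on g (crossings D)" "\<And>c. c \<in> crossings D \<Longrightarrow> sign_of (g c) = sign_of c"
    and codes: "list_all2 (\<lambda>K K'. \<exists>n. K' = rotate n (map (map_prod g id) K)) D D'"
    using same by (auto simp: same_diagram_def)
  let ?\<rho> = "map_prod g (id :: strand \<Rightarrow> strand)"
  have rel: "relabelling D {} D' ?\<rho>"
  proof
    show "inj_on ?\<rho> (passages D)"
      using g(1) D unfolding gauss_code_def by (simp add: map_prod_inj_on)
  qed (use D D' codes in \<open>simp_all add: gauss_code_def\<close>)
  interpret relabelling D "{}" D' ?\<rho> by (rule rel)
  have passage: "(c, t) \<in> passages D" if "c \<in> crossings D" for c t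
    using strands_in_passages[OF D that] .
  have crossings': "crossings D' = g ` crossings D"
    unfolding crossings_def passages_relabelled by (force simp: image_iff)
  have origin: "origin (g c, t) = (c, t)" if "c \<in> crossings D" for c t
    using origin_\<rho>[OF passage[OF that, of t]] by simp
  have weights: "passage_weight (incoming C) (outgoing D C) p =
      passage_weight (incoming C \<circ> origin) (outgoing D C \<circ> origin) (?\<rho> p)" if "p \<in> passages D" for C p
  proof -
    obtain c t where p: "p = (c, t)" "c \<in> crossings D"
      using \<open>p \<in> passages D\<close> by (cases p) (force simp: crossings_def)
    then show ?thesis
      using g(2)[OF p(2)] origin[OF p(2)] by (cases t) simp_all
  qed
  have pulled_iff: "C \<in> semi_arcs D \<rightarrow>\<^sub>E X \<and>
      (\<forall>c \<in> crossings D'. colored (incoming C \<circ> origin) (outgoing D C \<circ> origin) c) \<longleftrightarrow>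
      C \<in> colorings X \<sigma> D" for C
    unfolding colorings_iff[OF D] crossings' by (simp add: colored_def origin g(2))
  have agree_iff: "C = C''" if "C \<in> colorings X \<sigma> D" "C'' \<in> colorings X \<sigma> D" "\<forall>a \<in> entries. C a = C'' a" for C C''
    using that coloringD(1)[OF D] by (intro colors_eqI[of C X C'']) simp_all
  show ?thesis
  proof (rule relabelling_invariant[OF rel D D'], unfold pulled_iff)
    show "\<exists>!C''. C'' \<in> colorings X \<sigma> D \<and> (\<forall>a \<in> entries. C a = C'' a)" if "C \<in> colorings X \<sigma> D" for C
    proof (rule ex1I[of _ C])
      show "C'' = C" if "C'' \<in> colorings X \<sigma> D \<and> (\<forall>a \<in> entries. C a = C'' a)" for C''
        using agree_iff[of C C''] that \<open>C \<in> colorings X \<sigma> D\<close> by simp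
    qed (use that in simp)
    show "\<exists>!C. C \<in> colorings X \<sigma> D \<and> (\<forall>a \<in> entries. C a = C'' a)" if "C'' \<in> colorings X \<sigma> D" for C''
    proof (rule ex1I[of _ C''])
      show "C = C''" if "C \<in> colorings X \<sigma> D \<and> (\<forall>a \<in> entries. C a = C'' a)" for C
        using agree_iff[of C C''] that \<open>C'' \<in> colorings X \<sigma> D\<close> by simp
    qed (use that in simp)
    show "passage_weight (incoming C) (outgoing D C) p =
        passage_weight (incoming C'' \<circ> origin) (outgoing D C'' \<circ> origin) (?\<rho> p)"
      if "C \<in> colorings X \<sigma> D" "C'' \<in> colorings X \<sigma> D" "\<forall>a \<in> entries. C a = C'' a" "p \<in> passages D" for C C'' p
      using agree_iff[OF that(1-3)] weights[OF that(4), of C] by (simp only:)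
  qed simp
qed

end

lemma monogon_sides:
  assumes "card F = 1" "sides D F = {{(c, Over), (c, Under)}}"
  obtains p where "{p, next_passage D p} = {(c, Over), (c, Under)}"
proof -
  obtain h where "F = {h}"
    using assms(1) by (auto simp: card_1_singleton_iff)
  then have "{fst h, fst (opposite D h)} = {(c, Over), (c, Under)}"
    using assms(2) by (simp add: sides_def)
  moreover have "next_passage D (fst h) = fst (opposite D h) \<or> next_passage D (fst (opposite D h)) = fst h"
    using opposite_cases[of D h "fst (opposite D h)"] by blast
  ultimately show thesis
    using that[of "fst h"] that[of "fst (opposite D h)"]
    by (elim disjE) (simp_all add: insert_commute)
qed

locale biquandle_cocycle = cocycle_on +
  fixes s
  assumes biquandle: "biquandle X \<sigma> s" and type_I: "type_I X s H f"
begin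

lemma fixed_iff:
  assumes "x \<in> X" "y \<in> X"
  shows "\<sigma> (x, y) = (x, y) \<longleftrightarrow> y = s x"
proof -
  have "(x, y) \<in> {(x, y) \<in> X \<times> X. \<sigma> (x, y) = (x, y)} \<longleftrightarrow> (x, y) \<in> {(x, s x) |x. x \<in> X}"
    using biquandle by (simp add: biquandle_def)
  then show ?thesis
    using assms by auto
qed

lemma s_bij: "bij_betw s X X"
  using biquandle by (simp add: biquandle_def)

text \<open>
  By the uniqueness in a birack the fixed point \<open>(z, s z)\<close> is the only pair with first entry \<open>z\<close> whose
  first entry is preserved by \<open>\<sigma>\<close>.
\<close>

lemma kink_left:
  assumes "\<sigma> (z, a) = (z, b)" "z \<in> X" "a \<in> X"
  shows "a = s z" "b = s z"
proof -
  have "s z \<in> X"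
    using s_bij assms(2) by (rule bij_betw_apply)
  then have "\<sigma> (z, s z) = (z, s z)"
    using assms by (simp add: fixed_iff)
  then show "a = s z" "b = s z"
    using left_unique[OF assms(1) \<open>\<sigma> (z, s z) = (z, s z)\<close>] assms \<open>s z \<in> X\<close> by simp_all
qed

lemma kink_right:
  assumes "\<sigma> (a, z) = (b, z)" "z \<in> X" "a \<in> X"
  shows "z = s a" "b = a"
proof -
  obtain x where x: "x \<in> X" "z = s x"
    using assms(2) bij_betw_imp_surj_on[OF s_bij] by blast
  then have "\<sigma> (x, z) = (x, z)"
    using assms(2) by (simp add: fixed_iff)
  then have "a = x"
    using right_unique[OF assms(1), of x x] assms x by simp
  then show "z = s a" "b = a"
    using \<open>\<sigma> (x, z) = (x, z)\<close> x assms by simp_all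
qed

lemma signed_one [simp]: "signed e \<one>\<^bsub>H\<^esub> = \<one>\<^bsub>H\<^esub>"
  by (simp add: signed_def)

lemma f_fixed: "x \<in> X \<Longrightarrow> f (x, s x) = \<one>\<^bsub>H\<^esub>"
  using type_I by (simp add: type_I_def)

text \<open>
  A kink with inner color \<open>z\<close>, entered with color \<open>y\<close> and left with color \<open>y'\<close>.  In the first statement the
  over-passage comes first, in the second the under-passage.  In all four cases \<open>\<sigma>\<close> preserves one of
  its entries, so that its argument is a fixed point, where \<open>f\<close> is trivial.
\<close>

lemma kink_crossing:
  assumes "{y, z, y'} \<subseteq> X"
  shows "crosses e e z y' y z \<Longrightarrow> y' = y \<and> weight e e z y' y z = \<one>\<^bsub>H\<^esub>"
    and "crosses e e y z z y' \<Longrightarrow> y' = y \<and> weight e e y z z y' = \<one>\<^bsub>H\<^esub>"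
proof -
  show "y' = y \<and> weight e e z y' y z = \<one>\<^bsub>H\<^esub>" if "crosses e e z y' y z"
    using assms that kink_left[of z y y'] kink_right[of y' z y] f_fixed
    by (cases e) (simp_all add: crosses_def weight_def)
  show "y' = y \<and> weight e e y z z y' = \<one>\<^bsub>H\<^esub>" if "crosses e e y z z y'"
    using assms that kink_left[of z y' y] kink_right[of y z y'] f_fixed
    by (cases e) (simp_all add: crosses_def weight_def)
qed

lemma ex1_kink:
  assumes "y \<in> X"
  shows "\<exists>!z. z \<in> X \<and> crosses e e z y y z" "\<exists>!z. z \<in> X \<and> crosses e e y z z y"
proof -
  have 1: "\<exists>!z. z \<in> X \<and> \<sigma> (y, z) = (y, z)"
    using assms bij_betw_apply[OF s_bij assms] by (auto simp: fixed_iff)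
  have "\<exists>!z. z \<in> X \<and> y = s z"
    using bij_betw_imp_surj_on[OF s_bij] bij_betw_imp_inj_on[OF s_bij] assms
    by (metis imageE inj_onD)
  then have 2: "\<exists>!z. z \<in> X \<and> \<sigma> (z, y) = (z, y)"
    using assms by (simp add: fixed_iff cong: conj_cong)
  show "\<exists>!z. z \<in> X \<and> crosses e e z y y z" "\<exists>!z. z \<in> X \<and> crosses e e y z z y"
    using 1 2 by (cases e; simp add: crosses_def)+
qed

lemma R1_invariant:
  assumes D: "gauss_code D" and p: "{p, next_passage D p} = {(c, Over), (c, Under)}"
  shows "same_invariant D (remove_crossings {c} D)"
proof -
  have moved: "next_passage D p \<noteq> p"
    using p by (auto simp: doubleton_eq_iff)
  then have passage: "p \<in> passages D"
    by (rule moved_in_passages)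
  have c: "c \<in> crossings D"
  proof -
    have "c = fst p"
      using p by (auto simp: doubleton_eq_iff)
    then show ?thesis
      using passage by (simp add: crossings_def)
  qed
  have rem: "removal D {p} {c}"
  proof
    have "{c} \<times> {Over, Under} = {(c, Over), (c, Under)}"
      by auto
    also have "\<dots> = {p} \<union> next_passage D ` {p}"
      unfolding p[symmetric] by (simp add: insert_commute)
    finally have "{c} \<times> {Over, Under} = {p} \<union> next_passage D ` {p}" .
    then show "{q \<in> passages D. fst q \<in> {c}} = {p} \<union> next_passage D ` {p}"
      using passages_of_crossings[OF D, of "{c}"] c by simp
    show "distinct (concat D)"
      using D by (simp add: gauss_code_def)
    show "{p} \<inter> next_passage D ` {p} = {}"
      using moved by simp
  qed (use passage in simp)
  interpret removal D "{p}" "{c}" by (rule rem)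
  let ?e = "sign_of c = Positive"
  have over_under: "p = (c, Over) \<and> nx p = (c, Under) \<or> p = (c, Under) \<and> nx p = (c, Over)"
    using p by (auto simp: doubleton_eq_iff)
  define over where "over \<longleftrightarrow> p = (c, Over)"
  have colored_iff: "colored (incoming C) (outgoing D C) c \<longleftrightarrow>
      (if over then crosses ?e ?e (incoming C (nx p)) (outgoing D C (nx p)) (incoming C p) (outgoing D C p)
       else crosses ?e ?e (incoming C p) (outgoing D C p) (incoming C (nx p)) (outgoing D C (nx p)))" for C
    using over_under by (auto simp: colored_def over_def)
  have weight_eq: "passage_weight (incoming C) (outgoing D C) (c, Under) = signed ?e
      (if over then weight ?e ?e (incoming C (nx p)) (outgoing D C (nx p)) (incoming C p) (outgoing D C p)
       else weight ?e ?e (incoming C p) (outgoing D C p) (incoming C (nx p)) (outgoing D C (nx p)))" for C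
    using over_under by (auto simp: over_def)
  have inner: "incoming C (nx p) = outgoing D C p" for C :: "semi_arc \<Rightarrow> 'a"
    by (simp add: incoming_def outgoing_def)
  show ?thesis
  proof (rule removal_invariant[OF rem D])
    fix C assume C: "C \<in> colorings X \<sigma> D"
    have CX: "{incoming C p, outgoing D C p, outgoing D C (nx p)} \<subseteq> X"
      using incoming_in_X outgoing_in_X coloringD(1)[OF D C] passage by simp
    have col: "colored (incoming C) (outgoing D C) c"
      using coloringD(2)[OF D C c] .
    show "straight C"
      using kink_crossing[OF CX, of ?e] col unfolding colored_iff inner
      by (intro straightI) (cases over, simp_all)
    fix q assume "q \<in> {p}"
    have "passage_weight (incoming C) (outgoing D C) (c, Under) = \<one>\<^bsub>H\<^esub>"
      using kink_crossing[OF CX, of ?e, THEN conjunct2] col unfolding weight_eq colored_iff inner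
      by (cases over) simp_all
    then show "passage_weight (incoming C) (outgoing D C) q \<otimes>\<^bsub>H\<^esub>
        passage_weight (incoming C) (outgoing D C) (nx q) = \<one>\<^bsub>H\<^esub>"
      using over_under \<open>q \<in> {p}\<close> by auto
  next
    fix C assume C: "C \<in> semi_arcs D \<rightarrow>\<^sub>E X" "straight C"
    let ?y = "C (Into p)"
    have y: "?y \<in> X"
      using C(1) passage by (auto simp: semi_arcs_def)
    have after: "C (Into (nx (nx p))) = ?y"
      using C(2) by (simp add: straight_def)
    let ?kink = "\<lambda>z. if over then crosses ?e ?e z ?y ?y z else crosses ?e ?e ?y z z ?y"
    have kink: "colored (incoming C1) (outgoing D C1) c \<longleftrightarrow> ?kink (C1 (Into (nx p)))"
      if "\<And>a. a \<in> entries \<Longrightarrow> C1 a = C a" for C1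
      using pair_colors[where ?C1.0 = C1 and C = C and p = p, OF that] after unfolding colored_iff by simp
    have "\<exists>!z. z \<in> X \<and> ?kink z"
      using ex1_kink[OF y, of ?e] by (cases over) simp_all
    then obtain z where z: "z \<in> X" "?kink z" and unique: "\<forall>z'. z' \<in> X \<and> ?kink z' \<longrightarrow> z' = z"
      by (elim ex1E conjE)
    show "\<exists>!C1. C1 \<in> semi_arcs D \<rightarrow>\<^sub>E X \<and> (\<forall>a \<in> entries. C1 a = C a) \<and>
        (\<forall>c \<in> {c}. colored (incoming C1) (outgoing D C1) c)"
    proof (rule ex1_interior[where z = "\<lambda>_. z", OF C(1) z(1)])
      show "\<forall>c \<in> {c}. colored (incoming (fill C (\<lambda>_. z))) (outgoing D (fill C (\<lambda>_. z))) c"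
        using kink[of "fill C (\<lambda>_. z)", OF fill_entry] z(2) fill_second[of p C "\<lambda>_. z"] by (simp only: singleton_iff ball_simps)
      fix C1 q
      assume C1: "C1 \<in> semi_arcs D \<rightarrow>\<^sub>E X" "\<And>a. a \<in> entries \<Longrightarrow> C1 a = C a"
        "\<forall>c \<in> {c}. colored (incoming C1) (outgoing D C1) c" "q \<in> {p}"
      have "C1 (Into (nx p)) \<in> X"
        using C1(1) passage by (intro PiE_mem[of C1 "semi_arcs D"]) (auto simp: semi_arcs_def)
      then show "C1 (Into (nx q)) = z"
        using kink[OF C1(2)] C1(3,4) unique by simp
    qed
  qed (use c in simp)
qed

end

section \<open>The second move\<close>

text \<open>
  The position of two passages in a move is given by the crossings they belong to; which of them
  comes first is up to the orientation of their strand, recorded by \<open>b\<close>.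
\<close>

definition joined :: "code \<Rightarrow> bool \<Rightarrow> passage \<Rightarrow> passage \<Rightarrow> bool" where
  "joined D b p q \<longleftrightarrow> (if b then next_passage D p = q else next_passage D q = p)"

lemma face_side:
  assumes "F \<in> faces D" "sides D F = S" "h \<in> F"
  shows "{fst h, fst (opposite D h)} \<in> S"
    and "fst (opposite D h) = q \<Longrightarrow> joined D (snd h = Outgoing) (fst h) q"
proof -
  show "{fst h, fst (opposite D h)} \<in> S"
    using assms(2,3) by (auto simp: sides_def)
  show "joined D (snd h = Outgoing) (fst h) q" if "fst (opposite D h) = q"
    using opposite_cases[OF that] by (auto simp: joined_def)
qed

text \<open>
  At the corner of a face the boundary turns to the other strand of the crossing.  Whether it follows the
  orientation of the sides before and after the corner is linked by the sign of the crossing.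
\<close>

lemma face_corner:
  assumes "F \<in> faces D" "h \<in> F" "fst (opposite D h) = (c, t)"
  shows "\<exists>h' \<in> F. fst h' = other_strand (c, t) \<and>
    (snd h' = Outgoing \<longleftrightarrow> (snd h = Outgoing) \<noteq> ((sign_of c = Positive) = (t = Over)))"
proof
  obtain x where F: "F = orbit (rotate_ccw \<circ> opposite D) x"
    using assms(1) by (metis faces_def imageE)
  show "(rotate_ccw \<circ> opposite D) h \<in> F"
    using assms(2) unfolding F by (rule orbit.step)
  have tip: "snd (opposite D h) = Outgoing \<longleftrightarrow> snd h \<noteq> Outgoing"
    using opposite_cases[OF assms(3)] by auto
  obtain n e where c: "c = (n, e)"
    by fastforce
  obtain u where u: "opposite D h = ((c, t), u)"
    using assms(3) by (cases "opposite D h") simp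
  have "fst (rotate_ccw ((c, t), u)) = other_strand (c, t) \<and>
    (snd (rotate_ccw ((c, t), u)) = Outgoing \<longleftrightarrow> (u = Outgoing) = ((sign_of c = Positive) = (t = Over)))"
    unfolding c by (cases e; cases t; cases u; simp)
  then show "fst ((rotate_ccw \<circ> opposite D) h) = other_strand (c, t) \<and>
    (snd ((rotate_ccw \<circ> opposite D) h) = Outgoing \<longleftrightarrow>
      (snd h = Outgoing) \<noteq> ((sign_of c = Positive) = (t = Over)))"
    using tip u by auto
qed

lemma face_corner_over:
  assumes "F \<in> faces D" "h \<in> F" "fst (opposite D h) = (c, Over)"
  shows "\<exists>h' \<in> F. fst h' = (c, Under) \<and>
    (snd h' = Outgoing \<longleftrightarrow> (snd h = Outgoing) \<noteq> (sign_of c = Positive))"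
  using face_corner[OF assms] by simp

lemma face_corner_under:
  assumes "F \<in> faces D" "h \<in> F" "fst (opposite D h) = (c, Under)"
  shows "\<exists>h' \<in> F. fst h' = (c, Over) \<and>
    (snd h' = Outgoing \<longleftrightarrow> (snd h = Outgoing) = (sign_of c = Positive))"
  using face_corner[OF assms] by simp

lemma bigon_card:
  assumes "card F = 2" "h1 \<in> F" "h2 \<in> F" "h \<in> F" "fst h1 \<noteq> fst h2" "fst h = fst h1"
  shows "h = h1"
proof -
  have finite: "finite F"
    using assms(1) by (metis card.infinite zero_neq_numeral)
  have "h1 \<noteq> h2"
    using assms(5) by blast
  then have "card {h1, h2} = 2"
    by simp
  then have "{h1, h2} = F"
    using assms(1-3) finite by (intro card_subset_eq) simp_all
  then show ?thesis
    using assms(4-6) by auto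
qed

lemma bigon_corner:
  assumes "c \<noteq> d" "F \<in> faces D" "card F = 2"
    and sides: "sides D F = {{(c, Over), (d, Over)}, {(c, Under), (d, Under)}}"
    and h: "h \<in> F" "fst h = (c, Over)"
  shows "\<exists>t b. joined D t (c, Over) (d, Over) \<and> joined D b (c, Under) (d, Under) \<and>
    (sign_of c = Positive) \<noteq> (sign_of d = Positive)"
proof -
  note side = face_side[OF assms(2) sides]
  have o1: "fst (opposite D h) = (d, Over)"
    using side(1)[OF h(1)] h(2) by (auto simp: doubleton_eq_iff)
  obtain h2 where h2: "h2 \<in> F" "fst h2 = (d, Under)"
    "snd h2 = Outgoing \<longleftrightarrow> (snd h = Outgoing) \<noteq> (sign_of d = Positive)"
    using face_corner_over[OF assms(2) h(1) o1] by blast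
  have o2: "fst (opposite D h2) = (c, Under)"
    using side(1)[OF h2(1)] h2(2) by (auto simp: doubleton_eq_iff)
  obtain h3 where h3: "h3 \<in> F" "fst h3 = (c, Over)"
    "snd h3 = Outgoing \<longleftrightarrow> (snd h2 = Outgoing) = (sign_of c = Positive)"
    using face_corner_under[OF assms(2) h2(1) o2] by blast
  have "h3 = h"
    using bigon_card[OF assms(3) h(1) h2(1) h3(1)] h h2 h3 by simp
  then have "(sign_of c = Positive) \<noteq> (sign_of d = Positive)"
    using h2(3) h3(3) by auto
  moreover have "joined D (snd h = Outgoing) (c, Over) (d, Over)"
    using side(2)[OF h(1) o1] h by simp
  moreover have "joined D (snd h2 \<noteq> Outgoing) (c, Under) (d, Under)"
    using side(2)[OF h2(1) o2] h2 by (auto simp: joined_def)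
  ultimately show ?thesis
    by blast
qed

text \<open>
  Going around the bigon, the two rules for the corners must give the initial direction again.  This
  excludes equal signs.
\<close>

lemma bigon_face:
  assumes "c \<noteq> d" "F \<in> faces D" "card F = 2"
    and sides: "sides D F = {{(c, Over), (d, Over)}, {(c, Under), (d, Under)}}"
  obtains t b where "joined D t (c, Over) (d, Over)" "joined D b (c, Under) (d, Under)"
    "(sign_of c = Positive) \<noteq> (sign_of d = Positive)"
proof -
  have "{(c, Over), (d, Over)} \<in> sides D F"
    using sides by simp
  then obtain h where h: "h \<in> F" and "{(c, Over), (d, Over)} = {fst h, fst (opposite D h)}"
    unfolding sides_def by (rule imageE)
  then consider "fst h = (c, Over)" | "fst h = (d, Over)"
    unfolding doubleton_eq_iff by metis
  then show thesis
  proof cases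
    case 1
    then show thesis
      using bigon_corner[OF assms h] that by blast
  next
    case 2
    have "sides D F = {{(d, Over), (c, Over)}, {(d, Under), (c, Under)}}"
      using sides by (simp add: insert_commute)
    from bigon_corner[OF assms(1)[symmetric] assms(2,3) this h 2]
    obtain t b where "joined D t (d, Over) (c, Over)" "joined D b (d, Under) (c, Under)"
      "(sign_of d = Positive) \<noteq> (sign_of c = Positive)"
      by blast
    then show thesis
      using that[of "\<not> t" "\<not> b"] by (simp add: joined_def)
  qed
qed

context birack_on
begin

text \<open>
  The under-strand has the colors \<open>u\<close>, \<open>w\<close>, \<open>u'\<close> and the over-strand the colors \<open>y\<close>, \<open>z\<close>, \<open>y'\<close>, along their
  orientations.  The over-strand first meets the crossing of sign \<open>e\<close>; \<open>b\<close> tells whether the under-strand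
  does so, too.
\<close>

definition bigon :: "bool \<Rightarrow> bool \<Rightarrow> 'x \<Rightarrow> 'x \<Rightarrow> 'x \<Rightarrow> 'x \<Rightarrow> 'x \<Rightarrow> 'x \<Rightarrow> bool" where
  "bigon e b u w u' y z y' \<longleftrightarrow>
     (if b then crosses e e u w y z \<and> crosses (\<not> e) (\<not> e) w u' z y'
      else crosses e e w u' y z \<and> crosses (\<not> e) (\<not> e) u w z y')"

text \<open>
  Read outward from the interior colors \<open>w\<close> and \<open>z\<close>, both crossings satisfy the same relation, which
  determines the outer colors.
\<close>

lemma bigon_straight:
  assumes "bigon e b u w u' y z y'" "{u, w, u', y, z, y'} \<subseteq> X"
  shows "u' = u" "y' = y"
proof -
  have "u' = u \<and> y' = y"
  proof (cases b)
    case True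
    then have "crosses (\<not> e) (\<not> e) w u z y" "crosses (\<not> e) (\<not> e) w u' z y'"
      using assms(1) by (simp_all add: bigon_def crosses_reverse)
    then show ?thesis
      using crosses_unique[of "\<not> e" "\<not> e" w u z y u' y'] assms(2) by simp
  next
    case False
    then have "crosses e (\<not> e) w u' z y" "crosses e (\<not> e) w u z y'"
      using assms(1) crosses_reverse(2)[of e "\<not> e" u w z y']
      by (simp_all add: bigon_def crosses_reverse)
    then show ?thesis
      using crosses_unique[of e "\<not> e" w u' z y u y'] assms(2) by simp
  qed
  then show "u' = u" "y' = y"
    by simp_all
qed

lemma bigon_iff: "bigon e b u w u y z y \<longleftrightarrow> crosses (e = b) e u w y z"
  by (cases b) (auto simp: bigon_def crosses_reverse)

end

context cocycle_on
begin

lemma R2_invariant: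
  assumes D: "gauss_code D" and "c \<noteq> d"
    and over: "next_passage D (c, Over) = (d, Over)" and under: "joined D b (c, Under) (d, Under)"
    and signs: "(sign_of c = Positive) \<noteq> (sign_of d = Positive)"
  shows "same_invariant D (remove_crossings {c, d} D)"
proof -
  define po pu where "po = (c, Over)" and "pu = (if b then (c, Under) else (d, Under))"
  let ?A = "{c, d}" and ?P = "{po, pu}"
  have next_po: "next_passage D po = (d, Over)"
    using over by (simp add: po_def)
  have next_pu: "next_passage D pu = (if b then (d, Under) else (c, Under))"
    using under by (simp add: pu_def joined_def)
  have passages: "po \<in> passages D" "pu \<in> passages D"
    using next_po next_pu \<open>c \<noteq> d\<close>
    by (auto intro!: moved_in_passages simp: po_def pu_def split: if_splits)
  have A: "?A \<subseteq> crossings D"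
  proof -
    have "(d, Over) \<in> passages D"
      using passages(1) next_po next_passage_in_passages[of D po] by simp
    then show ?thesis
      using passages(1) by (force simp: crossings_def po_def)
  qed
  have rem: "removal D ?P ?A"
  proof
    have "?A \<times> {Over, Under} = ?P \<union> next_passage D ` ?P"
      unfolding image_insert next_po next_pu by (auto simp: po_def pu_def)
    then show "{q \<in> passages D. fst q \<in> ?A} = ?P \<union> next_passage D ` ?P"
      using passages_of_crossings[OF D A] by simp
    show "distinct (concat D)"
      using D by (simp add: gauss_code_def)
    show "?P \<inter> next_passage D ` ?P = {}"
      unfolding image_insert next_po next_pu using \<open>c \<noteq> d\<close> by (auto simp: po_def pu_def)
  qed (use passages in simp)
  interpret removal D ?P ?A by (rule rem)
  let ?e = "sign_of c = Positive"
  have sign_d: "(sign_of d = Positive) = (\<not> ?e)"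
    using signs by auto
  have inner: "incoming C (nx p) = outgoing D C p" for C :: "semi_arc \<Rightarrow> 'x" and p
    by (simp add: incoming_def outgoing_def)
  have colored_iff: "colored (incoming C) (outgoing D C) c \<and> colored (incoming C) (outgoing D C) d \<longleftrightarrow>
      bigon ?e b (incoming C pu) (outgoing D C pu) (outgoing D C (nx pu))
        (incoming C po) (outgoing D C po) (outgoing D C (nx po))" for C
    using inner[of C po] inner[of C pu] next_po next_pu
    unfolding colored_def sign_d bigon_def by (auto simp: po_def pu_def)
  show ?thesis
  proof (rule removal_invariant[OF rem D])
    fix C assume C: "C \<in> colorings X \<sigma> D"
    have CX: "{incoming C pu, outgoing D C pu, outgoing D C (nx pu),
        incoming C po, outgoing D C po, outgoing D C (nx po)} \<subseteq> X"
      using incoming_in_X outgoing_in_X coloringD(1)[OF D C] passages by simp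
    have bigon: "bigon ?e b (incoming C pu) (outgoing D C pu) (outgoing D C (nx pu))
        (incoming C po) (outgoing D C po) (outgoing D C (nx po))"
      using coloringD(2)[OF D C] A colored_iff[of C] by blast
    note eq = bigon_straight[OF bigon CX]
    show "straight C"
      using eq by (intro straightI) auto
    let ?w = "weight ?e ?e (incoming C (c, Under)) (outgoing D C (c, Under))
      (incoming C (c, Over)) (outgoing D C (c, Over))"
    let ?g = "passage_weight (incoming C) (outgoing D C)"
    have w: "?w \<in> carrier H"
      using incoming_in_X outgoing_in_X coloringD(1)[OF D C] strands_in_passages[OF D] A by simp
    have gc: "?g (c, Under) = signed ?e ?w"
      by simp
    have gd: "?g (d, Under) = signed (\<not> ?e) ?w"
    proof -
      have "weight (\<not> ?e) (\<not> ?e) (incoming C (d, Under)) (outgoing D C (d, Under))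
          (incoming C (d, Over)) (outgoing D C (d, Over)) = ?w"
        using eq inner[of C po] inner[of C pu] next_po next_pu
        by (cases b) (simp_all add: po_def pu_def weight_reverse)
      then show ?thesis
        by (simp add: sign_d)
    qed
    fix p assume "p \<in> ?P"
    then consider "p = po" | "p = pu" by blast
    then show "?g p \<otimes>\<^bsub>H\<^esub> ?g (nx p) = \<one>\<^bsub>H\<^esub>"
    proof cases
      case 1
      then show ?thesis
        using next_po by (simp add: po_def)
    next
      case 2
      then have "?g p \<otimes>\<^bsub>H\<^esub> ?g (nx p) =
          (if b then signed ?e ?w \<otimes>\<^bsub>H\<^esub> signed (\<not> ?e) ?w else signed (\<not> ?e) ?w \<otimes>\<^bsub>H\<^esub> signed ?e ?w)"
        unfolding 2 next_pu by (simp only: pu_def gc[symmetric] gd[symmetric] split: if_split) simp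
      also have "\<dots> = \<one>\<^bsub>H\<^esub>"
        using w by (simp add: signed_not)
      finally show ?thesis .
    qed
  next
    fix C assume C: "C \<in> semi_arcs D \<rightarrow>\<^sub>E X" "straight C"
    let ?y = "C (Into po)" and ?u = "C (Into pu)"
    have X: "?y \<in> X" "?u \<in> X"
      using C(1) passages by (auto simp: semi_arcs_def)
    have after: "C (Into (nx (nx po))) = ?y" "C (Into (nx (nx pu))) = ?u"
      using C(2) by (simp_all add: straight_def)
    have iff: "(\<forall>k \<in> ?A. colored (incoming C1) (outgoing D C1) k) \<longleftrightarrow>
        crosses (?e = b) ?e ?u (C1 (Into (nx pu))) ?y (C1 (Into (nx po)))"
      if agree: "\<And>a. a \<in> entries \<Longrightarrow> C1 a = C a" for C1
    proof -
      have "(\<forall>k \<in> ?A. colored (incoming C1) (outgoing D C1) k) \<longleftrightarrow>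
          bigon ?e b ?u (C1 (Into (nx pu))) ?u ?y (C1 (Into (nx po))) ?y"
        using colored_iff[of C1] pair_colors[where ?C1.0 = C1 and C = C and p = po, OF agree]
          pair_colors[where ?C1.0 = C1 and C = C and p = pu, OF agree] after by simp
      then show ?thesis
        by (simp add: bigon_iff)
    qed
    obtain w z where wz: "w \<in> X" "z \<in> X" "crosses (?e = b) ?e ?u w ?y z"
      using ex_crosses[OF X(2,1)] .
    define v where "v p = (if p = po then z else w)" for p
    have "po \<noteq> pu"
      by (simp add: po_def pu_def)
    show "\<exists>!C1. C1 \<in> semi_arcs D \<rightarrow>\<^sub>E X \<and> (\<forall>a \<in> entries. C1 a = C a) \<and>
        (\<forall>k \<in> ?A. colored (incoming C1) (outgoing D C1) k)"
    proof (rule ex1_interior[where z = v, OF C(1)])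
      show "\<forall>k \<in> ?A. colored (incoming (fill C v)) (outgoing D (fill C v)) k"
        using iff[of "fill C v", OF fill_entry] fill_second[of po C v] fill_second[of pu C v]
          \<open>po \<noteq> pu\<close> wz(3) by (simp add: v_def)
      show "v p \<in> X" for p
        using wz by (simp add: v_def)
      fix C1 p
      assume C1: "C1 \<in> semi_arcs D \<rightarrow>\<^sub>E X" "\<And>a. a \<in> entries \<Longrightarrow> C1 a = C a"
        "\<forall>k \<in> ?A. colored (incoming C1) (outgoing D C1) k" "p \<in> ?P"
      have "C1 (Into (nx q)) \<in> X" if "q \<in> passages D" for q
        using C1(1) that by (intro PiE_mem[of C1 "semi_arcs D"]) (simp_all add: semi_arcs_def)
      then have "C1 (Into (nx pu)) = w" "C1 (Into (nx po)) = z"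
        using crosses_unique[of "?e = b" ?e ?u "C1 (Into (nx pu))" ?y "C1 (Into (nx po))" w z]
          iff[OF C1(2)] C1(3) wz X passages by simp_all
      then show "C1 (Into (nx p)) = v p"
        using C1(4) \<open>po \<noteq> pu\<close> by (auto simp: v_def)
    qed
  qed (rule A)
qed

end

section \<open>The third move\<close>

lemma trigon_card:
  assumes "card F = 3" "{h1, h2, h3, h4} \<subseteq> F" "fst h1 \<noteq> fst h2" "fst h1 \<noteq> fst h3" "fst h2 \<noteq> fst h3"
    and "fst h4 = fst h1"
  shows "h4 = h1"
proof -
  have "finite F"
    using assms(1) by (metis card.infinite zero_neq_numeral)
  moreover have "h1 \<noteq> h2" "h1 \<noteq> h3" "h2 \<noteq> h3"
    using assms(3-5) by blast+
  then have "card {h1, h2, h3} = 3"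
    by simp
  ultimately have "{h1, h2, h3} = F"
    using assms(1,2) by (intro card_subset_eq) simp_all
  then show ?thesis
    using assms(2-6) by auto
qed

text \<open>
  The flags \<open>t\<close>, \<open>m\<close> and \<open>b\<close> are the orientations of the three strands; each is read
  off from whether a walk around the face follows or opposes that side.  The conditions on the signs come from the three corners and say
  that the direction of a strand multiplied by the sign of a crossing depends only on the other strand
  there, as \<open>hexagon\<close> presupposes.
\<close>

lemma trigon_face:
  assumes "distinct [c, d, e]" "F \<in> faces D" "card F = 3"
    and sides: "sides D F = {{(c, Over), (d, Over)}, {(c, Under), (e, Over)}, {(d, Under), (e, Under)}}"
  obtains t m b where "joined D t (c, Over) (d, Over)" "joined D m (c, Under) (e, Over)"
    "joined D b (d, Under) (e, Under)"
    "((sign_of c = Positive) = m) = ((sign_of d = Positive) = b)"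
    "((sign_of c = Positive) = t) = ((sign_of e = Positive) = b)"
    "((sign_of d = Positive) = t) = ((sign_of e = Positive) = m)"
proof -
  note side = face_side[OF assms(2) sides]
  note neq = assms(1)[simplified]
  have joined_not: "joined D (\<not> b) p q \<longleftrightarrow> joined D b q p" for b p q
    by (simp add: joined_def)
  have "{(c, Over), (d, Over)} \<in> sides D F"
    using sides by simp
  then obtain h where h: "h \<in> F" and h_side: "{(c, Over), (d, Over)} = {fst h, fst (opposite D h)}"
    unfolding sides_def by (rule imageE)
  consider "fst h = (c, Over)" "fst (opposite D h) = (d, Over)"
    | "fst h = (d, Over)" "fst (opposite D h) = (c, Over)"
    using h_side unfolding doubleton_eq_iff by metis
  then show thesis
  proof cases
    case 1
    obtain h2 where h2: "h2 \<in> F" "fst h2 = (d, Under)"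
      "snd h2 = Outgoing \<longleftrightarrow> (snd h = Outgoing) \<noteq> (sign_of d = Positive)"
      using face_corner_over[OF assms(2) h 1(2)] by blast
    have o2: "fst (opposite D h2) = (e, Under)"
      using side(1)[OF h2(1)] h2(2) neq by (auto simp: doubleton_eq_iff)
    obtain h3 where h3: "h3 \<in> F" "fst h3 = (e, Over)"
      "snd h3 = Outgoing \<longleftrightarrow> (snd h2 = Outgoing) = (sign_of e = Positive)"
      using face_corner_under[OF assms(2) h2(1) o2] by blast
    have o3: "fst (opposite D h3) = (c, Under)"
      using side(1)[OF h3(1)] h3(2) neq by (auto simp: doubleton_eq_iff)
    obtain h4 where h4: "h4 \<in> F" "fst h4 = (c, Over)"
      "snd h4 = Outgoing \<longleftrightarrow> (snd h3 = Outgoing) = (sign_of c = Positive)"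
      using face_corner_under[OF assms(2) h3(1) o3] by blast
    have "h4 = h"
      using trigon_card[OF assms(3), of h h2 h3 h4] h h2 h3 h4 1 neq by simp
    show thesis
    proof (rule that)
      show "joined D (snd h = Outgoing) (c, Over) (d, Over)"
        using side(2)[OF h 1(2)] 1(1) by simp
      show "joined D (\<not> (snd h3 = Outgoing)) (c, Under) (e, Over)"
        using side(2)[OF h3(1) o3] h3(2) unfolding joined_not by simp
      show "joined D (snd h2 = Outgoing) (d, Under) (e, Under)"
        using side(2)[OF h2(1) o2] h2(2) by simp
    qed (use h2(3) h3(3) h4(3) \<open>h4 = h\<close> in argo)+
  next
    case 2
    obtain h2 where h2: "h2 \<in> F" "fst h2 = (c, Under)"
      "snd h2 = Outgoing \<longleftrightarrow> (snd h = Outgoing) \<noteq> (sign_of c = Positive)"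
      using face_corner_over[OF assms(2) h 2(2)] by blast
    have o2: "fst (opposite D h2) = (e, Over)"
      using side(1)[OF h2(1)] h2(2) neq by (auto simp: doubleton_eq_iff)
    obtain h3 where h3: "h3 \<in> F" "fst h3 = (e, Under)"
      "snd h3 = Outgoing \<longleftrightarrow> (snd h2 = Outgoing) \<noteq> (sign_of e = Positive)"
      using face_corner_over[OF assms(2) h2(1) o2] by blast
    have o3: "fst (opposite D h3) = (d, Under)"
      using side(1)[OF h3(1)] h3(2) neq by (auto simp: doubleton_eq_iff)
    obtain h4 where h4: "h4 \<in> F" "fst h4 = (d, Over)"
      "snd h4 = Outgoing \<longleftrightarrow> (snd h3 = Outgoing) = (sign_of d = Positive)"
      using face_corner_under[OF assms(2) h3(1) o3] by blast
    have "h4 = h"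
      using trigon_card[OF assms(3), of h h2 h3 h4] h h2 h3 h4 2 neq by simp
    show thesis
    proof (rule that)
      show "joined D (\<not> (snd h = Outgoing)) (c, Over) (d, Over)"
        using side(2)[OF h 2(2)] 2(1) unfolding joined_not by simp
      show "joined D (snd h2 = Outgoing) (c, Under) (e, Over)"
        using side(2)[OF h2(1) o2] h2(2) by simp
      show "joined D (\<not> (snd h3 = Outgoing)) (d, Under) (e, Under)"
        using side(2)[OF h3(1) o3] h3(2) unfolding joined_not by simp
    qed (use h2(3) h3(3) h4(3) \<open>h4 = h\<close> in argo)+
  qed
qed

context birack_on
begin

text \<open>
  The two sides of the move trade places when all three strands are read backwards.
\<close>

lemma hexagon_reverse:
  "hexagon (\<not> T) (\<not> M) (\<not> B) a2 a' a0 a1 m2 m' m0 m1 b2 b' b0 b1 \<longleftrightarrow>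
   hexagon T M B a0 a1 a2 a' m0 m1 m2 m' b0 b1 b2 b'"
  by (auto simp: hexagon_def crosses_reverse)

lemma ex_hexagon_backwards:
  assumes "crosses M B b0 b' m0 m'" "crosses T B b' b2 a0 a'" "crosses T M m' m2 a' a2"
    and X: "{a0, a', a2, m0, m', m2, b0, b', b2} \<subseteq> X"
  shows "\<exists>a1 m1 b1. hexagon T M B a0 a1 a2 a' m0 m1 m2 m' b0 b1 b2 b'"
proof -
  have "\<exists>a1 m1 b1. hexagon (\<not> T) (\<not> M) (\<not> B) a2 a' a0 a1 m2 m' m0 m1 b2 b' b0 b1"
    using assms by (intro ex_hexagon) (auto simp: crosses_reverse)
  then show ?thesis
    by (simp add: hexagon_reverse)
qed

lemma hexagon_unique_backwards:
  assumes "hexagon T M B a0 a1 a2 a' m0 m1 m2 m' b0 b1 b2 b'"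
    and "crosses T M m0 m a0 a" "crosses T B b0 b a a2" "{a, m, b} \<subseteq> X"
  shows "a = a1" "m = m1" "b = b1"
proof -
  show "a = a1" "m = m1"
    using crosses_unique[of T M m0 m a0 a m1 a1] assms by (auto simp: hexagon_def)
  then show "b = b1"
    using crosses_unique[of T B b0 b a1 a2 b1 a2] assms by (auto simp: hexagon_def)
qed

lemma crosses_directed:
  "crosses e e (if u then x else x') (if u then x' else x) (if v then y else y') (if v then y' else y) \<longleftrightarrow>
   crosses (e = u) (e = v) x x' y y'"
  by (cases u; cases v) (auto simp: crosses_reverse)

end

context cocycle_on
begin

lemma weight_directed:
  "weight e e (if u then x else x') (if u then x' else x) (if v then y else y') (if v then y' else y) =
   weight (e = u) (e = v) x x' y y'"
  by (cases u; cases v) (auto simp: weight_reverse)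

lemma signed_reverse:
  assumes "signed x g \<otimes>\<^bsub>H\<^esub> signed y h = signed y h' \<otimes>\<^bsub>H\<^esub> signed x g'"
    and "{g, h, g', h'} \<subseteq> carrier H"
  shows "signed (\<not> y) h \<otimes>\<^bsub>H\<^esub> signed (\<not> x) g = signed (\<not> x) g' \<otimes>\<^bsub>H\<^esub> signed (\<not> y) h'"
proof -
  have "inv\<^bsub>H\<^esub> (signed x g \<otimes>\<^bsub>H\<^esub> signed y h) = inv\<^bsub>H\<^esub> (signed y h' \<otimes>\<^bsub>H\<^esub> signed x g')"
    using assms(1) by simp
  then show ?thesis
    using assms(2) by (simp add: inv_mult_group signed_not)
qed

end

text \<open>
  The colors next to a passage, named by their position with respect to the triangle: the strand
  is read in a fixed direction, which agrees with its orientation iff \<open>b\<close> holds.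
\<close>

definition before_side :: "code \<Rightarrow> (semi_arc \<Rightarrow> 'x) \<Rightarrow> bool \<Rightarrow> passage \<Rightarrow> 'x" where
  "before_side D C b p = (if b then incoming C p else outgoing D C p)"

definition after_side :: "code \<Rightarrow> (semi_arc \<Rightarrow> 'x) \<Rightarrow> bool \<Rightarrow> passage \<Rightarrow> 'x" where
  "after_side D C b q = (if b then outgoing D C q else incoming C q)"

lemma joined_colors:
  assumes "joined D b p q"
  shows "incoming C p = (if b then before_side D C b p else after_side D C b p)"
    "outgoing D C p = (if b then after_side D C b p else before_side D C b p)"
    "incoming C q = (if b then after_side D C b p else after_side D C b q)"
    "outgoing D C q = (if b then after_side D C b q else after_side D C b p)"
  using assms by (auto simp: joined_def incoming_def outgoing_def before_side_def after_side_def)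

lemma joined_first:
  assumes "joined D b p q"
  shows "next_passage D (if b then p else q) = (if b then q else p)"
  using assms by (simp add: joined_def)

context cocycle_on
begin

text \<open>
  Let \<open>a0 a1 a2\<close>, \<open>n0 n1 n2\<close> and \<open>e0 e1 e2\<close> be the colors on the top, middle and bottom strand, in the order
  in which \<open>hexagon\<close> lists them.  A coloring of the old diagram satisfies the three conditions of \<open>hexagon\<close> for the crossings before the move, and a coloring of the new diagram,
  pulled back to the old semi-arcs, satisfies the three others.  All other crossings see only entries.
\<close>

lemma R3_invariant:
  assumes D: "gauss_code D" and D': "gauss_code D'" and cde: "distinct [c, d, e]"
    and D'_def: "D' = map (map (transpose (c, Over) (d, Over) \<circ> transpose (c, Under) (e, Over) \<circ>
                      transpose (d, Under) (e, Under))) D"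
    and top: "joined D t (c, Over) (d, Over)"
    and middle: "joined D m (c, Under) (e, Over)"
    and bottom: "joined D b (d, Under) (e, Under)"
    and signs: "((sign_of c = Positive) = m) = ((sign_of d = Positive) = b)"
      "((sign_of c = Positive) = t) = ((sign_of e = Positive) = b)"
      "((sign_of d = Positive) = t) = ((sign_of e = Positive) = m)"
  shows "same_invariant D D'"
proof -
  define \<tau> where "\<tau> = transpose (c, Over) (d, Over) \<circ> transpose (c, Under) (e, Over) \<circ>
    transpose (d, Under) (e, Under)"
  have neq: "c \<noteq> d" "c \<noteq> e" "d \<noteq> e" "d \<noteq> c" "e \<noteq> c" "e \<noteq> d"
    using cde by auto
  have \<tau>: "\<tau> (c, Over) = (d, Over)" "\<tau> (d, Over) = (c, Over)" "\<tau> (c, Under) = (e, Over)"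
    "\<tau> (e, Over) = (c, Under)" "\<tau> (d, Under) = (e, Under)" "\<tau> (e, Under) = (d, Under)"
    using neq by (simp_all add: \<tau>_def transpose_def)
  have \<tau>_other: "\<tau> (k, u) = (k, u)" if "k \<notin> {c, d, e}" for k u
    using that by (auto simp: \<tau>_def transpose_def)
  have \<tau>_\<tau>: "\<tau> (\<tau> p) = p" for p
  proof (cases "fst p \<in> {c, d, e}")
    case True
    obtain k u where p: "p = (k, u)"
      by fastforce
    with True have "k = c \<or> k = d \<or> k = e"
      by simp
    then show ?thesis
      unfolding p by (elim disjE; cases u) (simp_all add: \<tau>)
  next
    case False
    then show ?thesis
      using \<tau>_other by (cases p) auto
  qed
  define t1 m1 b1 where "t1 = (if t then (c, Over) else (d, Over))"
    and "m1 = (if m then (c, Under) else (e, Over))"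
    and "b1 = (if b then (d, Under) else (e, Under))"
  define P where "P = {t1, m1, b1}"
  have seconds: "next_passage D t1 = (if t then (d, Over) else (c, Over))"
    "next_passage D m1 = (if m then (e, Over) else (c, Under))"
    "next_passage D b1 = (if b then (e, Under) else (d, Under))"
    using joined_first[OF top] joined_first[OF middle] joined_first[OF bottom]
    by (simp_all add: t1_def m1_def b1_def)
  have image_P: "next_passage D ` P = {next_passage D t1, next_passage D m1, next_passage D b1}"
    by (simp add: P_def)
  have six: "P \<union> next_passage D ` P = {c, d, e} \<times> {Over, Under}"
    unfolding image_P seconds unfolding P_def t1_def m1_def b1_def
    by (cases t; cases m; cases b) auto
  have firsts: "t1 \<in> passages D" "m1 \<in> passages D" "b1 \<in> passages D"
    by (rule moved_in_passages, use seconds neq in \<open>simp add: t1_def m1_def b1_def\<close>)+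
  have first: "P \<subseteq> passages D"
    using firsts by (simp add: P_def)
  have six_passages: "{c, d, e} \<times> {Over, Under} \<subseteq> passages D"
    using firsts unfolding six[symmetric] image_P unfolding P_def by simp
  have \<tau>_in: "\<tau> p \<in> passages D" if "p \<in> passages D" for p
  proof (cases "fst p \<in> {c, d, e}")
    case True
    obtain k u where p: "p = (k, u)"
      by fastforce
    with True have "k = c \<or> k = d \<or> k = e"
      by simp
    then have "\<tau> p \<in> {c, d, e} \<times> {Over, Under}"
      unfolding p by (elim disjE; cases u) (simp_all add: \<tau>)
    then show ?thesis
      by (rule subsetD[OF six_passages])
  next
    case False
    then show ?thesis
      using \<tau>_other[of "fst p" "snd p"] that by simp
  qed
  have rel: "relabelling D P D' \<tau>"
  proof
    show "distinct (concat D)" "distinct (concat D')"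
      using D D' by (simp_all add: gauss_code_def)
    show "P \<inter> next_passage D ` P = {}"
      unfolding image_P seconds unfolding P_def t1_def m1_def b1_def
      using neq by (cases t; cases m; cases b) auto
    show "inj_on \<tau> (passages D)"
      by (rule inj_on_inverseI) (rule \<tau>_\<tau>)
    show "list_all2 (\<lambda>K K'. \<exists>n. K' = rotate n (map \<tau> K)) D D'"
      unfolding D'_def \<tau>_def[symmetric]
      by (simp add: list_all2_conv_all_nth) (metis id_apply rotate0)
  qed (rule first)
  interpret relabelling D P D' \<tau> by (rule rel)
  have passages': "passages D' = passages D"
    unfolding passages_relabelled
  proof (intro equalityI image_subsetI subsetI)
    show "p \<in> \<tau> ` passages D" if "p \<in> passages D" for p
      using image_eqI[of p \<tau> "\<tau> p"] \<tau>_\<tau>[of p] \<tau>_in[OF that] by simp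
  qed (rule \<tau>_in)
  then have crossings': "crossings D' = crossings D"
    by (simp add: crossings_def)
  have origin: "origin p = \<tau> p" if "p \<in> passages D" for p
    using origin_\<rho>[OF \<tau>_in[OF that]] by (simp add: \<tau>_\<tau>)
  have tri: "c \<in> crossings D" "d \<in> crossings D" "e \<in> crossings D"
    using six_passages by (force simp: crossings_def)+

  let ?ec = "sign_of c = Positive" and ?ed = "sign_of d = Positive" and ?ee = "sign_of e = Positive"
  \<comment> \<open>each flag has two descriptions, which agree by the conditions on the signs\<close>
  define T M B where "T \<longleftrightarrow> ?ec = m" and "M \<longleftrightarrow> ?ec = t" and "B \<longleftrightarrow> ?ed = t"
  have flags: "(?ec = m) = T" "(?ed = b) = T" "(?ec = t) = M" "(?ee = b) = M" "(?ed = t) = B" "(?ee = m) = B"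
    using signs by (simp_all add: T_def M_def B_def)
  define a0 a1 a2 where "a0 C = before_side D C t (c, Over)" and "a1 C = after_side D C t (c, Over)"
    and "a2 C = after_side D C t (d, Over)" for C :: "semi_arc \<Rightarrow> 'x"
  define n0 n1 n2 where "n0 C = before_side D C m (c, Under)" and "n1 C = after_side D C m (c, Under)"
    and "n2 C = after_side D C m (e, Over)" for C :: "semi_arc \<Rightarrow> 'x"
  define e0 e1 e2 where "e0 C = before_side D C b (d, Under)" and "e1 C = after_side D C b (d, Under)"
    and "e2 C = after_side D C b (e, Under)" for C :: "semi_arc \<Rightarrow> 'x"
  note colors = joined_colors[where ?'a = 'x, OF top, folded a0_def a1_def a2_def]
    joined_colors[where ?'a = 'x, OF middle, folded n0_def n1_def n2_def]
    joined_colors[where ?'a = 'x, OF bottom, folded e0_def e1_def e2_def]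
  have interior: "a1 C = C (Into (nx t1))" "n1 C = C (Into (nx m1))" "e1 C = C (Into (nx b1))" for C
    unfolding a1_def n1_def e1_def after_side_def seconds
    using seconds by (auto simp: incoming_def outgoing_def t1_def m1_def b1_def)
  \<comment> \<open>the colors at the outer ends of the strands belong to entries\<close>
  have exterior: "a0 C = a0 C'" "a2 C = a2 C'" "n0 C = n0 C'" "n2 C = n2 C'" "e0 C = e0 C'" "e2 C = e2 C'"
    if agree: "\<forall>a \<in> entries. C a = C' a" for C C' :: "semi_arc \<Rightarrow> 'x"
  proof -
    have "C (Into p) = C' (Into p)" "C (Into (nx (nx p))) = C' (Into (nx (nx p)))" if "p \<in> P" for p
      using agree first_entry[OF that] after_entry[OF that] by simp_all
    then have "C (Into p) = C' (Into p)" "C (Into (nx (nx p))) = C' (Into (nx (nx p)))"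
      if "p = t1 \<or> p = m1 \<or> p = b1" for p
      using that by (auto simp: P_def)
    from this[of t1] this[of m1] this[of b1]
    show "a0 C = a0 C'" "a2 C = a2 C'" "n0 C = n0 C'" "n2 C = n2 C'" "e0 C = e0 C'" "e2 C = e2 C'"
      unfolding a0_def a2_def n0_def n2_def e0_def e2_def before_side_def after_side_def
        incoming_def outgoing_def seconds
      by (auto simp: t1_def m1_def b1_def split: if_splits)
  qed
  have in_X: "{a0 C, a1 C, a2 C, n0 C, n1 C, n2 C, e0 C, e1 C, e2 C} \<subseteq> X"
    if "C \<in> semi_arcs D \<rightarrow>\<^sub>E X" for C
    using incoming_in_X[OF that] outgoing_in_X[OF that] six_passages
    unfolding a0_def a1_def a2_def n0_def n1_def n2_def e0_def e1_def e2_def before_side_def after_side_def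
    by auto
  have unpushed: "colored (incoming C) (outgoing D C) c \<longleftrightarrow> crosses T M (n0 C) (n1 C) (a0 C) (a1 C)"
    "colored (incoming C) (outgoing D C) d \<longleftrightarrow> crosses T B (e0 C) (e1 C) (a1 C) (a2 C)"
    "colored (incoming C) (outgoing D C) e \<longleftrightarrow> crosses M B (e1 C) (e2 C) (n1 C) (n2 C)" for C
    unfolding colored_def colors crosses_directed flags by (rule refl)+
  have origin_six: "origin (c, Over) = (d, Over)" "origin (d, Over) = (c, Over)"
    "origin (c, Under) = (e, Over)" "origin (e, Over) = (c, Under)"
    "origin (d, Under) = (e, Under)" "origin (e, Under) = (d, Under)"
    using six_passages by (simp_all add: origin \<tau>)
  have pushed: "colored (incoming C \<circ> origin) (outgoing D C \<circ> origin) c \<longleftrightarrow>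
      crosses T M (n1 C) (n2 C) (a1 C) (a2 C)"
    "colored (incoming C \<circ> origin) (outgoing D C \<circ> origin) d \<longleftrightarrow>
      crosses T B (e1 C) (e2 C) (a0 C) (a1 C)"
    "colored (incoming C \<circ> origin) (outgoing D C \<circ> origin) e \<longleftrightarrow>
      crosses M B (e0 C) (e1 C) (n0 C) (n1 C)" for C
    unfolding colored_def comp_apply origin_six colors crosses_directed flags by (rule refl)+
  have other_entries: "incoming C (k, u) = incoming C' (k, u)" "outgoing D C (k, u) = outgoing D C' (k, u)"
    "origin (k, u) = (k, u)"
    if k: "k \<in> crossings D" "k \<notin> {c, d, e}" and agree: "\<forall>a \<in> entries. C a = C' a" for C C' :: "semi_arc \<Rightarrow> 'x" and k u
  proof -
    have p: "(k, u) \<in> passages D" "(k, u) \<notin> P \<union> nx ` P"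
      using strands_in_passages[OF D k(1)] k(2) unfolding six by simp_all
    then have "Into (k, u) \<in> entries" "Into (nx (k, u)) \<in> entries"
      using Into_next_entries by (simp_all add: Into_entries)
    then show "incoming C (k, u) = incoming C' (k, u)" "outgoing D C (k, u) = outgoing D C' (k, u)"
      using agree by (simp_all add: incoming_def outgoing_def)
    show "origin (k, u) = (k, u)"
      using origin[OF p(1)] \<tau>_other[OF k(2)] by simp
  qed
  have other: "colored (incoming C) (outgoing D C) k \<longleftrightarrow>
      colored (incoming C' \<circ> origin) (outgoing D C' \<circ> origin) k"
    if "k \<in> crossings D" "k \<notin> {c, d, e}" "\<forall>a \<in> entries. C a = C' a" for C C' k
    using other_entries[OF that] by (simp add: colored_def)
  have split: "(\<forall>k \<in> crossings D. Q k) \<longleftrightarrow> Q c \<and> Q d \<and> Q e \<and> (\<forall>k \<in> crossings D - {c, d, e}. Q k)" for Q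
    using tri by blast

  have distinct_firsts: "t1 \<noteq> m1" "t1 \<noteq> b1" "m1 \<noteq> b1"
    using neq by (simp_all add: t1_def m1_def b1_def)
  define z where "z x y w p = (if p = t1 then x else if p = m1 then y else w)"
    for x y w :: 'x and p :: passage
  have filled: "a1 (fill C (z x y w)) = x" "n1 (fill C (z x y w)) = y" "e1 (fill C (z x y w)) = w" for C x y w
    unfolding interior using fill_second[of _ C "z x y w"] distinct_firsts by (simp_all add: P_def z_def)
  have agree_fill: "\<forall>a \<in> entries. fill C y a = C a" for C :: "semi_arc \<Rightarrow> 'x" and y
    by (simp add: fill_entry)

  have both: "hexagon T M B (a0 C) (a1 C) (a2 C) (a1 C'') (n0 C) (n1 C) (n2 C) (n1 C'') (e0 C) (e1 C) (e2 C) (e1 C'')"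
    if C: "C \<in> colorings X \<sigma> D" and C'': "C'' \<in> semi_arcs D \<rightarrow>\<^sub>E X"
      "\<forall>k \<in> crossings D'. colored (incoming C'' \<circ> origin) (outgoing D C'' \<circ> origin) k"
      and agree: "\<forall>a \<in> entries. C a = C'' a" for C C''
    unfolding hexagon_def
    using coloringD(2)[OF D C tri(1)] coloringD(2)[OF D C tri(2)] coloringD(2)[OF D C tri(3)]
      bspec[OF C''(2)[unfolded crossings'] tri(1)] bspec[OF C''(2)[unfolded crossings'] tri(2)]
      bspec[OF C''(2)[unfolded crossings'] tri(3)] in_X[OF coloringD(1)[OF D C]] in_X[OF C''(1)]
    unfolding unpushed pushed exterior[OF agree] by simp
  show ?thesis
  proof (rule relabelling_invariant[OF rel D D'])
    fix C assume C: "C \<in> colorings X \<sigma> D"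
    note CX = coloringD(1)[OF D C]
    have C_tri: "crosses T M (n0 C) (n1 C) (a0 C) (a1 C)" "crosses T B (e0 C) (e1 C) (a1 C) (a2 C)"
      "crosses M B (e1 C) (e2 C) (n1 C) (n2 C)"
      using coloringD(2)[OF D C] tri unfolding unpushed[symmetric] by blast+
    obtain x y w where h: "hexagon T M B (a0 C) (a1 C) (a2 C) x (n0 C) (n1 C) (n2 C) y (e0 C) (e1 C) (e2 C) w"
      using ex_hexagon[OF C_tri] in_X[OF CX] by auto
    have "\<exists>!C''. C'' \<in> semi_arcs D \<rightarrow>\<^sub>E X \<and> (\<forall>a \<in> entries. C'' a = C a) \<and>
        (\<forall>k \<in> crossings D'. colored (incoming C'' \<circ> origin) (outgoing D C'' \<circ> origin) k)"
    proof (rule ex1_interior[where z = "z x y w", OF CX])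
      show "z x y w p \<in> X" for p
        using h by (simp add: z_def hexagon_def)
      let ?C = "fill C (z x y w)"
      have "\<forall>k \<in> crossings D - {c, d, e}. colored (incoming ?C \<circ> origin) (outgoing D ?C \<circ> origin) k"
        using other[of _ C ?C] agree_fill coloringD(2)[OF D C] by simp
      then show "\<forall>k \<in> crossings D'. colored (incoming ?C \<circ> origin) (outgoing D ?C \<circ> origin) k"
        using h unfolding crossings' split pushed filled exterior[OF agree_fill] by (simp add: hexagon_def)
      fix C1 p
      assume C1: "C1 \<in> semi_arcs D \<rightarrow>\<^sub>E X" "\<And>a. a \<in> entries \<Longrightarrow> C1 a = C a"
        "\<forall>k \<in> crossings D'. colored (incoming C1 \<circ> origin) (outgoing D C1 \<circ> origin) k" "p \<in> P"
      have agree: "\<forall>a \<in> entries. C1 a = C a"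
        using C1(2) by blast
      have "crosses M B (e0 C) (e1 C1) (n0 C) (n1 C1)" "crosses T B (e1 C1) (e2 C) (a0 C) (a1 C1)"
        using C1(3) unfolding crossings' split pushed exterior[OF agree] by simp_all
      then have "a1 C1 = x" "n1 C1 = y" "e1 C1 = w"
        using hexagon_unique[OF h, where m = "n1 C1" and a = "a1 C1" and b = "e1 C1"]
          in_X[OF C1(1)] by simp_all
      then show "C1 (Into (nx p)) = z x y w p"
        using C1(4) distinct_firsts unfolding interior by (auto simp: P_def z_def)
    qed
    then show "\<exists>!C''. (C'' \<in> semi_arcs D \<rightarrow>\<^sub>E X \<and>
        (\<forall>k \<in> crossings D'. colored (incoming C'' \<circ> origin) (outgoing D C'' \<circ> origin) k)) \<and>
        (\<forall>a \<in> entries. C a = C'' a)"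
      by (simp only: conj_ac eq_commute[of "C _"])
  next
    fix C''
    assume C'': "C'' \<in> semi_arcs D \<rightarrow>\<^sub>E X \<and>
        (\<forall>k \<in> crossings D'. colored (incoming C'' \<circ> origin) (outgoing D C'' \<circ> origin) k)"
    then have CX: "C'' \<in> semi_arcs D \<rightarrow>\<^sub>E X" by simp
    have C_tri: "crosses M B (e0 C'') (e1 C'') (n0 C'') (n1 C'')" "crosses T B (e1 C'') (e2 C'') (a0 C'') (a1 C'')"
      "crosses T M (n1 C'') (n2 C'') (a1 C'') (a2 C'')"
      using C'' unfolding crossings' split pushed by simp_all
    obtain x y w where h: "hexagon T M B (a0 C'') x (a2 C'') (a1 C'') (n0 C'') y (n2 C'') (n1 C'') (e0 C'') w (e2 C'') (e1 C'')"
      using ex_hexagon_backwards[OF C_tri] in_X[OF CX] by auto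
    have "\<exists>!C. C \<in> semi_arcs D \<rightarrow>\<^sub>E X \<and> (\<forall>a \<in> entries. C a = C'' a) \<and>
        (\<forall>k \<in> crossings D. colored (incoming C) (outgoing D C) k)"
    proof (rule ex1_interior[where z = "z x y w", OF CX])
      show "z x y w p \<in> X" for p
        using h by (simp add: z_def hexagon_def)
      let ?C = "fill C'' (z x y w)"
      have "\<forall>k \<in> crossings D - {c, d, e}. colored (incoming ?C) (outgoing D ?C) k"
        using other[of _ ?C C''] agree_fill C'' unfolding crossings' by simp
      then show "\<forall>k \<in> crossings D. colored (incoming ?C) (outgoing D ?C) k"
        using h unfolding split unpushed filled exterior[OF agree_fill] by (simp add: hexagon_def)
      fix C1 p
      assume C1: "C1 \<in> semi_arcs D \<rightarrow>\<^sub>E X" "\<And>a. a \<in> entries \<Longrightarrow> C1 a = C'' a"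
        "\<forall>k \<in> crossings D. colored (incoming C1) (outgoing D C1) k" "p \<in> P"
      have agree: "\<forall>a \<in> entries. C1 a = C'' a"
        using C1(2) by blast
      have "crosses T M (n0 C'') (n1 C1) (a0 C'') (a1 C1)" "crosses T B (e0 C'') (e1 C1) (a1 C1) (a2 C'')"
        using C1(3) unfolding split unpushed exterior[OF agree] by simp_all
      then have "a1 C1 = x" "n1 C1 = y" "e1 C1 = w"
        using hexagon_unique_backwards[OF h, where m = "n1 C1" and a = "a1 C1" and b = "e1 C1"]
          in_X[OF C1(1)] by simp_all
      then show "C1 (Into (nx p)) = z x y w p"
        using C1(4) distinct_firsts unfolding interior by (auto simp: P_def z_def)
    qed
    then show "\<exists>!C. C \<in> colorings X \<sigma> D \<and> (\<forall>a \<in> entries. C a = C'' a)"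
      unfolding colorings_iff[OF D] by (simp only: conj_ac)
  next
    fix C C'' p
    assume C: "C \<in> colorings X \<sigma> D"
      and C'': "C'' \<in> semi_arcs D \<rightarrow>\<^sub>E X \<and>
        (\<forall>k \<in> crossings D'. colored (incoming C'' \<circ> origin) (outgoing D C'' \<circ> origin) k)"
      and agree: "\<forall>a \<in> entries. C a = C'' a"
    let ?g = "passage_weight (incoming C) (outgoing D C)"
    let ?h = "passage_weight (incoming C'' \<circ> origin) (outgoing D C'' \<circ> origin)"
    {
      assume "p \<in> passages D" "p \<notin> P" "p \<notin> nx ` P"
      moreover obtain k u where p: "p = (k, u)"
        by fastforce
      ultimately have k: "k \<in> crossings D" "k \<notin> {c, d, e}"
        using six by (cases u; force simp: crossings_def)+
      have "\<tau> p = p"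
        using \<tau>_other[OF k(2)] p by simp
      then show "?g p = ?h (\<tau> p)"
        using other_entries[OF k agree] p by (simp add: passage_weight_def split: strand.split)
    next
      note h = both[OF C conjunct1[OF C''] conjunct2[OF C''] agree]
      have X: "{a0 C, a1 C, a2 C, n0 C, n1 C, n2 C, e0 C, e1 C, e2 C, a1 C'', n1 C'', e1 C''} \<subseteq> X"
        using h by (simp add: hexagon_def)
      let ?wd = "weight T B (e0 C) (e1 C) (a1 C) (a2 C)" and ?we = "weight M B (e1 C) (e2 C) (n1 C) (n2 C)"
      let ?wd' = "weight T B (e1 C'') (e2 C) (a0 C) (a1 C'')" and ?we' = "weight M B (e0 C) (e1 C'') (n0 C) (n1 C'')"
      have g: "?g (c, Under) = signed ?ec (weight T M (n0 C) (n1 C) (a0 C) (a1 C))"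
        "?g (d, Under) = signed ?ed ?wd" "?g (e, Under) = signed ?ee ?we"
        unfolding passage_weight_simps colors weight_directed flags by (rule refl)+
      have g': "?h (c, Under) = signed ?ec (weight T M (n1 C'') (n2 C) (a1 C'') (a2 C))"
        "?h (d, Under) = signed ?ed ?wd'" "?h (e, Under) = signed ?ee ?we'"
        unfolding passage_weight_simps comp_apply origin_six colors weight_directed flags exterior[OF agree]
        by (rule refl)+
      have middle_eq: "?g (c, Under) = ?h (c, Under)"
        unfolding g g' using hexagon_weight_middle[OF h] by simp
      have carrier: "?g (c, Under) \<in> carrier H"
        unfolding g using X by simp
      have bottom_eq: "signed T ?wd \<otimes>\<^bsub>H\<^esub> signed M ?we = signed M ?we' \<otimes>\<^bsub>H\<^esub> signed T ?wd'"
        using hexagon_weight_bottom[OF h] .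
      assume "p \<in> P"
      then consider "p = t1" | "p = m1" | "p = b1"
        unfolding P_def by blast
      then show "?g p \<otimes>\<^bsub>H\<^esub> ?g (nx p) = ?h (\<tau> p) \<otimes>\<^bsub>H\<^esub> ?h (\<tau> (nx p))"
      proof cases
        case 1
        then show ?thesis
          using seconds(1) by (cases t) (simp_all add: t1_def \<tau>)
      next
        case 2
        then show ?thesis
          using seconds(2) middle_eq carrier
          by (cases m) (simp_all add: m1_def \<tau> del: passage_weight_simps(2))
      next
        case 3
        show ?thesis
        proof (cases b)
          case True
          then have "T = ?ed" "M = ?ee"
            using flags by simp_all
          then show ?thesis
            using 3 True seconds(3) bottom_eq by (simp add: b1_def \<tau> g g' del: passage_weight_simps)
        next
          case False
          then have *: "?ed = (\<not> T)" "?ee = (\<not> M)"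
            using flags by auto
          have "signed (\<not> M) ?we \<otimes>\<^bsub>H\<^esub> signed (\<not> T) ?wd = signed (\<not> T) ?wd' \<otimes>\<^bsub>H\<^esub> signed (\<not> M) ?we'"
            using bottom_eq X by (intro signed_reverse) simp_all
          then show ?thesis
            using 3 False seconds(3) by (simp add: b1_def \<tau> g g' * del: passage_weight_simps)
        qed
      qed
    }
  qed
qed

end

section \<open>Invariance of the conjugacy biquandle cocycle invariant\<close>

context biquandle_cocycle
begin

lemma reidemeister_invariant:
  assumes "reidemeister D D'"
  shows "same_invariant D D'"
  using assms
proof cases
  case same
  then show ?thesis
    by (intro same_diagram_invariant) (simp_all add: link_diagram_def)
next
  case (R1 F c)
  obtain p where "{p, next_passage D p} = {(c, Over), (c, Under)}"
    using R1(4,5) by (rule monogon_sides)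
  then show ?thesis
    using R1_invariant R1(1,6) by (simp add: link_diagram_def)
next
  case (R2 c d F)
  obtain t b where t: "joined D t (c, Over) (d, Over)" and b: "joined D b (c, Under) (d, Under)"
    and signs: "(sign_of c = Positive) \<noteq> (sign_of d = Positive)"
    using R2(3-6) by (rule bigon_face)
  have D: "gauss_code D"
    using R2(1) by (simp add: link_diagram_def)
  show ?thesis
  proof (cases t)
    case True
    then show ?thesis
      using R2_invariant[OF D R2(3) _ b signs] t R2(7) by (simp add: joined_def)
  next
    case False
    then have "next_passage D (d, Over) = (c, Over)" "joined D (\<not> b) (d, Under) (c, Under)"
      using t b by (simp_all add: joined_def)
    then show ?thesis
      using R2_invariant[OF D R2(3)[symmetric] _ _ signs[symmetric]] R2(7)
      by (simp add: insert_commute)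
  qed
next
  case (R3 c d e F)
  obtain t m b where "joined D t (c, Over) (d, Over)" "joined D m (c, Under) (e, Over)"
    "joined D b (d, Under) (e, Under)"
    "((sign_of c = Positive) = m) = ((sign_of d = Positive) = b)"
    "((sign_of c = Positive) = t) = ((sign_of e = Positive) = b)"
    "((sign_of d = Positive) = t) = ((sign_of e = Positive) = m)"
    using R3(3-6) by (rule trigon_face)
  then show ?thesis
    using R3(1,2) by (intro R3_invariant[OF _ _ R3(3,7)]) (simp_all add: link_diagram_def)
qed

lemma reidemeister_diagrams:
  assumes "reidemeister D D'"
  shows "link_diagram D" "link_diagram D'"
  using assms by (cases; simp)+

lemma equivclp_reidemeister_invariant:
  assumes "equivclp reidemeister D D'" "link_diagram D"
  shows "link_diagram D' \<and> same_invariant D D'"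
  using assms(1)
proof (induction rule: equivclp_induct)
  case base
  then show ?case
    using assms(2) same_invariant_refl by simp
next
  case (step E E')
  then have "link_diagram E'" "same_invariant E E'"
    using reidemeister_diagrams reidemeister_invariant same_invariant_sym by blast+
  then show ?case
    using step.IH same_invariant_trans by blast
qed

end

theorem theorem12:
  fixes X :: "'x set" and \<sigma> :: "'x \<times> 'x \<Rightarrow> 'x \<times> 'x" and s :: "'x \<Rightarrow> 'x"
    and H :: "('h, 'm) monoid_scheme" and f :: "'x \<times> 'x \<Rightarrow> 'h" and D :: code
  assumes "biquandle X \<sigma> s"
    and "group H"
    and "braid_cocycle X \<sigma> H f"
    and "type_I X s H f"
    and "link_diagram D"
  shows
    "(\<forall>b b'. \<forall>C \<in> colorings X \<sigma> D. \<forall>i < length D.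
        conj_class H (Psi X \<sigma> H f D b C i) = conj_class H (Psi X \<sigma> H f D b' C i)) \<and>
     (\<forall>D'. equivclp reidemeister D D' \<longrightarrow>
        length D' = length D \<and>
        (\<exists>\<Phi>. bij_betw \<Phi> (colorings X \<sigma> D) (colorings X \<sigma> D') \<and>
           (\<forall>b b'. \<forall>C \<in> colorings X \<sigma> D. \<forall>i < length D.
              conj_class H (Psi X \<sigma> H f D' b' (\<Phi> C) i) = conj_class H (Psi X \<sigma> H f D b C i))) \<and>
        (\<forall>b b'. conj_invariant X \<sigma> H f D' b' = conj_invariant X \<sigma> H f D b))"
proof -
  interpret biquandle_cocycle X \<sigma> H f s
  proof (intro biquandle_cocycle.intro cocycle_on.intro birack_on.intro
      cocycle_on_axioms.intro biquandle_cocycle_axioms.intro)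
    show "birack X \<sigma>"
      using assms(1) by (simp add: biquandle_def)
  qed (rule assms)+
  have D: "gauss_code D"
    using assms(5) by (simp add: link_diagram_def)
  show ?thesis
  proof (intro conjI allI impI ballI)
    show "conj_class H (Psi X \<sigma> H f D b C i) = conj_class H (Psi X \<sigma> H f D b' C i)"
      if "C \<in> colorings X \<sigma> D" "i < length D" for b b' C i
      using conj_class_Psi[OF D that] by simp
  next
    fix D' assume "equivclp reidemeister D D'"
    then have inv: "same_invariant D D'" and D': "gauss_code D'"
      using equivclp_reidemeister_invariant assms(5) by (auto simp: link_diagram_def)
    note conclusion = same_invariant_conclusion[OF inv D D']
    show "length D' = length D"
      by (rule conclusion(1))
    show "\<exists>\<Phi>. bij_betw \<Phi> (colorings X \<sigma> D) (colorings X \<sigma> D') \<and>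
        (\<forall>b b'. \<forall>C \<in> colorings X \<sigma> D. \<forall>i < length D.
          conj_class H (Psi X \<sigma> H f D' b' (\<Phi> C) i) = conj_class H (Psi X \<sigma> H f D b C i))"
      by (rule conclusion(2))
    show "conj_invariant X \<sigma> H f D' b' = conj_invariant X \<sigma> H f D b" for b b'
      by (rule conclusion(3))
  qed
qed

end
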